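(* Let $n\ge 0$ be an integer and let $f\colon X\to Y$ be a surjective map between compact spaces $X$ and $Y$ with $\mathrm{card}(f^{-1}(y))\le n+1$ for every $y\in Y$. Then $e\text{-}\dim Y\le e\text{-}\dim(X\times\mathbb I^n)$.
   Context: Maps are continuous, compact spaces are Hausdorff (not necessarily metrizable), and $\mathbb I=[0,1]$. For a compact (more generally paracompact) space $Z$ and a CW-complex $L$, $e\text{-}\dim Z\le L$ means that every map $h\colon A\to L$, with $A\subset Z$ closed, extends over $Z$ up to homotopy, i.e. there is a map $H\colon Z\to L$ with $H|A$ homotopic to $h$ (for compact $Z$ this is equivalent to every such $h$ having an extension over $Z$). The notation $e\text{-}\dim Z_1\le e\text{-}\dim Z_2$ means that $e\text{-}\dim Z_1\le L$ for every CW-complex $L$ with $e\text{-}\dim Z_2\le L$. *)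

theory Defs
  imports "HOL-Analysis.Analysis"
begin

text \<open>Dimensions are natural numbers, so balls and cubes live in spaces of functions on the naturals:
  points of \<^term>\<open>Euclidean_space n\<close> vanish at all indices \<open>\<ge> n\<close>, whereas points of the cube are
  extensional functions on \<open>{..<n}\<close>.  In dimension 0 the two balls and the cube are single points and
  the sphere is empty.\<close>

definition unit_cball :: "nat \<Rightarrow> (nat \<Rightarrow> real) set" where
  "unit_cball n = {x \<in> topspace (Euclidean_space n). (\<Sum>i<n. (x i)\<^sup>2) \<le> 1}"

definition unit_ball :: "nat \<Rightarrow> (nat \<Rightarrow> real) set" where
  "unit_ball n = {x \<in> topspace (Euclidean_space n). (\<Sum>i<n. (x i)\<^sup>2) < 1}"

definition unit_sphere :: "nat \<Rightarrow> (nat \<Rightarrow> real) set" where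
  "unit_sphere n = {x \<in> topspace (Euclidean_space n). (\<Sum>i<n. (x i)\<^sup>2) = 1}"

definition cube :: "nat \<Rightarrow> (nat \<Rightarrow> real) topology" where
  "cube n = product_topology (\<lambda>_. top_of_set {0..1}) {..<n}"

definition characteristic_map ::
    "'c topology \<Rightarrow> nat \<Rightarrow> 'c set \<Rightarrow> ((nat \<Rightarrow> real) \<Rightarrow> 'c) \<Rightarrow> bool" where
  "characteristic_map L n e \<Phi> \<longleftrightarrow>
     continuous_map (subtopology (Euclidean_space n) (unit_cball n)) L \<Phi> \<and>
     homeomorphic_map (subtopology (Euclidean_space n) (unit_ball n)) (subtopology L e) \<Phi>"

text \<open>\<open>E n\<close> is the set of open \<open>n\<close>-cells.  The last two conditions are closure finiteness (C) and the
  weak topology (W).\<close>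

definition CW_decomposition :: "'c topology \<Rightarrow> (nat \<Rightarrow> 'c set set) \<Rightarrow> bool" where
  "CW_decomposition L E \<longleftrightarrow>
     Hausdorff_space L \<and>
     (\<Union>n. \<Union>(E n)) = topspace L \<and>
     (\<forall>m n. \<forall>d\<in>E m. \<forall>e\<in>E n. (m, d) \<noteq> (n, e) \<longrightarrow> disjnt d e) \<and>
     (\<forall>n. \<forall>e\<in>E n. \<exists>\<Phi>. characteristic_map L n e \<Phi> \<and>
        (\<exists>F. finite F \<and> F \<subseteq> (\<Union>k<n. E k) \<and> \<Phi> ` unit_sphere n \<subseteq> \<Union>F)) \<and>
     (\<forall>S. S \<subseteq> topspace L \<longrightarrow>
        (\<forall>n. \<forall>e\<in>E n. closedin L (S \<inter> L closure_of e)) \<longrightarrow> closedin L S)"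

definition CW_complex :: "'c topology \<Rightarrow> bool" where
  "CW_complex L \<longleftrightarrow> (\<exists>E. CW_decomposition L E)"

definition edim_le :: "'a topology \<Rightarrow> 'c topology \<Rightarrow> bool" where
  "edim_le Z L \<longleftrightarrow>
     (\<forall>A h. closedin Z A \<longrightarrow> continuous_map (subtopology Z A) L h \<longrightarrow>
        (\<exists>H. continuous_map Z L H \<and>
             homotopic_with (\<lambda>_. True) (subtopology Z A) L H h))"

text \<open>Comparison of extension dimensions over all CW-complexes.  A formula cannot quantify over
  types, so the type of the points of \<open>L\<close> is a parameter; a statement about this relation in which
  \<open>'c\<close> is a free type variable ranges over the CW-complexes on every type.\<close>

definition edim_le_edim :: "'c itself \<Rightarrow> 'a topology \<Rightarrow> 'b topology \<Rightarrow> bool" where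
  "edim_le_edim (_ :: 'c itself) Z1 Z2 \<longleftrightarrow>
     (\<forall>L :: 'c topology. CW_complex L \<longrightarrow> edim_le Z2 L \<longrightarrow> edim_le Z1 L)"

end

theory Submission
  imports Defs
begin

text \<open>Maps of closed subsets of compact spaces into a CW-complex \<open>L\<close> extend, up to homotopy, to
  neighbourhoods: only a finite subcomplex matters, and the property survives attaching a cell.

  Let \<open>Z\<close> be the space of pairs \<open>(y, \<mu>)\<close> where \<open>\<mu>\<close> is a probability measure on the fibre of \<open>f\<close> over
  \<open>y\<close>, embedded in the product of \<open>Y\<close> with a Tychonoff cube.  Stratify \<open>Z\<close> by the number of atoms.
  Each stratum is locally finite-to-one over \<open>X \<times> I\<^sup>n\<close> (position of one atom and weights of the
  others), and maps with finite fibres between compact spaces do not raise the extension dimension of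
  the domain above that of the range; hence the extension dimension of \<open>Z\<close> is at most \<open>L\<close>.

  Given a map from a closed subset of \<open>Y\<close> to \<open>L\<close>, pull it back along the projection from \<open>Z\<close> to \<open>Y\<close>,
  extend it over \<open>Z\<close> and then over a neighbourhood of \<open>Z\<close>.  Since the fibres of the projection are
  convex, it has an approximate section with graph in that neighbourhood, and composing with this
  section gives the extension over \<open>Y\<close>.\<close>


section \<open>Neighbourhood extension up to homotopy\<close>

text \<open>The obstacle is that \<open>f\<close> has in general no section: a choice of one point
  per fibre jumps where points of a fibre merge. Passing from points to measures makes the fibres
  convex, and the exponent \<open>n\<close> is the price: a measure with at most
  \<open>n + 1\<close> atoms has at most \<open>n\<close> free weights, since they sum to 1. The
  strata need not be closed, because atoms may merge or lose their weight; hence the sum theorem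
  asks only for information on closed sets disjoint from the lower strata. All extensions are taken
  up to homotopy, as in \<open>edim_le\<close>. Homotopies that arise on the way are absorbed by
  extending over a cylinder, which is why neighbourhood extension is needed for the product with the
  interval. The spaces need not be metrizable, so distances are replaced by finitely many real
  functions. The cube of all functions to the interval supplies convex combinations, straight-line
  homotopies, and neighbourhoods controlled by finitely many coordinates.\<close>

abbreviation unit_interval :: "real topology" ("\<I>") where
  "\<I> \<equiv> top_of_set {0..1}"

abbreviation homotopic :: "'a topology \<Rightarrow> 'b topology \<Rightarrow> ('a \<Rightarrow> 'b) \<Rightarrow> ('a \<Rightarrow> 'b) \<Rightarrow> bool" where
  "homotopic \<equiv> homotopic_with (\<lambda>_. True)"

text \<open>On \<open>A\<close> the extension matches \<open>h\<close> only up to homotopy, as in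
  \<open>edim_le\<close>. The attaching of a cell leads to this form: near the boundary of the cell
  the given map is deformed before it is extended.\<close>

definition nbhd_ext :: "'z topology \<Rightarrow> 'c topology \<Rightarrow> bool" where
  "nbhd_ext Z L \<longleftrightarrow>
     (\<forall>A h. closedin Z A \<longrightarrow> continuous_map (subtopology Z A) L h \<longrightarrow>
        (\<exists>W H. openin Z W \<and> A \<subseteq> W \<and> continuous_map (subtopology Z W) L H \<and>
               homotopic (subtopology Z A) L H h))"

lemma homotopicI:
  assumes "continuous_map (prod_topology \<I> X) Y h"
    and "\<And>x. x \<in> topspace X \<Longrightarrow> h (0, x) = p x" and "\<And>x. x \<in> topspace X \<Longrightarrow> h (1, x) = q x"
  shows "homotopic X Y p q"
  using assms by (subst homotopic_with) auto

lemma homotopic_subset: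
  assumes "homotopic (subtopology X S) Y f g" "T \<subseteq> S"
  shows "homotopic (subtopology X T) Y f g"
  using homotopic_from_subtopology[OF assms(1), of T] assms(2)
  by (simp add: subtopology_subtopology Int_absorb1)

lemma compact_Hausdorff_normal:
  "compact_space X \<Longrightarrow> Hausdorff_space X \<Longrightarrow> normal_space X"
  using compact_Hausdorff_or_regular_imp_normal_space by blast

lemma continuous_map_union_closed:
  assumes "closedin X S" "closedin X T"
    and f: "continuous_map (subtopology X S) Y f" and g: "continuous_map (subtopology X T) Y g"
    and eq: "\<And>x. x \<in> S \<Longrightarrow> x \<in> T \<Longrightarrow> f x = g x"
  shows "continuous_map (subtopology X (S \<union> T)) Y (\<lambda>x. if x \<in> S then f x else g x)"
proof (rule pasting_lemma_closed[where I = "UNIV::bool set" and T = "\<lambda>b. if b then S else T"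
        and f = "\<lambda>b. if b then f else g"])
  have "closedin (subtopology X (S \<union> T)) S" "closedin (subtopology X (S \<union> T)) T"
    using assms(1,2) by (auto simp: closedin_subset closedin_subset_topspace closedin_Int closedin_subtopology)
  then show "\<And>i. i \<in> UNIV \<Longrightarrow> closedin (subtopology X (S \<union> T)) (if i then S else T)" by auto
  show "continuous_map (subtopology (subtopology X (S \<union> T)) (if i then S else T)) Y (if i then f else g)" for i
    using f g by (auto simp: subtopology_subtopology Int_absorb1)
qed (use eq in auto)

text \<open>The two maps and the homotopy between them form a map on a closed subset of the cylinder.
  Extend it to a neighbourhood in the cylinder and restrict to the graph of a Urysohn function
  that changes from \<open>0\<close> on \<open>B\<close> to \<open>1\<close> on \<open>A\<close> only near \<open>A \<inter> B\<close>.\<close>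

lemma nbhd_ext_union:
  fixes Z :: "'z topology"
  assumes Z: "compact_space Z" "Hausdorff_space Z"
    and L: "nbhd_ext (prod_topology \<I> Z) L"
    and cl: "closedin Z A" "closedin Z B"
    and h: "continuous_map (subtopology Z A) L h" and g: "continuous_map (subtopology Z B) L g"
    and hom: "homotopic (subtopology Z (A \<inter> B)) L g h"
  obtains W H where "openin Z W" "A \<union> B \<subseteq> W" "continuous_map (subtopology Z W) L H"
    "homotopic (subtopology Z A) L H h" "homotopic (subtopology Z B) L H g"
proof -
  let ?P = "prod_topology \<I> Z"
  have AZ: "A \<subseteq> topspace Z" "B \<subseteq> topspace Z" using cl closedin_subset by auto
  obtain D where D: "continuous_map (prod_topology \<I> (subtopology Z (A \<inter> B))) L D"
    "\<And>x. D (0, x) = g x" "\<And>x. D (1, x) = h x"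
    using hom unfolding homotopic_with_def by blast
  let ?S = "{0..1} \<times> (A \<inter> B)" and ?T0 = "{0} \<times> B" and ?T1 = "{1} \<times> A"
  have clI: "closedin \<I> {0..1}" "closedin \<I> {0}" "closedin \<I> {1}"
    by (auto simp: closedin_subset_topspace closed_closedin[symmetric] intro!: closed_subset)
  have clS: "closedin ?P ?S" "closedin ?P ?T0" "closedin ?P ?T1"
    using clI cl by (auto simp: closedin_prod_Times_iff closedin_Int)
  have D': "continuous_map (subtopology ?P ?S) L D"
  proof -
    have "subtopology ?P ?S = prod_topology \<I> (subtopology Z (A \<inter> B))"
      by (simp add: prod_topology_subtopology subtopology_subtopology)
    then show ?thesis using D by simp
  qed
  have c0: "continuous_map (subtopology ?P ?T0) L (g \<circ> snd)"
    by (rule continuous_map_compose[OF _ g])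
       (auto simp: continuous_map_in_subtopology intro!: continuous_map_from_subtopology continuous_map_snd)
  have c1: "continuous_map (subtopology ?P ?T1) L (h \<circ> snd)"
    by (rule continuous_map_compose[OF _ h])
       (auto simp: continuous_map_in_subtopology intro!: continuous_map_from_subtopology continuous_map_snd)
  have c01: "continuous_map (subtopology ?P (?T0 \<union> ?T1)) L (\<lambda>x. if x \<in> ?T0 then (g \<circ> snd) x else (h \<circ> snd) x)"
    by (rule continuous_map_union_closed[OF clS(2,3) c0 c1]) auto
  define k where "k = (\<lambda>x. if x \<in> ?S then D x else if x \<in> ?T0 then (g \<circ> snd) x else (h \<circ> snd) x)"
  let ?M = "?S \<union> (?T0 \<union> ?T1)"
  have k: "continuous_map (subtopology ?P ?M) L k"
    unfolding k_def
    by (rule continuous_map_union_closed[OF clS(1) closedin_Un[OF clS(2,3)] D' c01])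
       (auto simp: D)
  have k0: "k (0, z) = g z" if "z \<in> B" for z using that by (auto simp: k_def D)
  have k1: "k (1, z) = h z" if "z \<in> A" for z using that by (auto simp: k_def D)
  obtain O1 K where O1: "openin ?P O1" "?M \<subseteq> O1" and K: "continuous_map (subtopology ?P O1) L K"
    and Kk: "homotopic (subtopology ?P ?M) L K k"
    using L k clS unfolding nbhd_ext_def by (metis closedin_Un)
  \<comment> \<open>Tube lemma: over \<open>Q\<close> every height lies in \<open>O1\<close>, so the
    graph of \<open>l\<close> needs care only outside \<open>Q\<close>, where \<open>A\<close> and
    \<open>B\<close> are disjoint.\<close>
  obtain Q0 Q where Q: "openin \<I> Q0" "openin Z Q" "{0..1} \<subseteq> Q0" "A \<inter> B \<subseteq> Q" "Q0 \<times> Q \<subseteq> O1"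
    by (rule Wallace_theorem_prod_topology[of \<I> "{0..1}" Z "A \<inter> B" O1])
       (use O1 cl Z in \<open>auto simp: compactin_subtopology closedin_Int closedin_compact_space\<close>)
  have QO: "(t, z) \<in> O1" if "t \<in> {0..1}" "z \<in> Q" for t z using Q that by auto
  have "closedin Z (B - Q)" "closedin Z (A - Q)" "disjnt (B - Q) (A - Q)"
    using cl Q by (auto simp: closedin_diff disjnt_def)
  then obtain l where l: "continuous_map Z \<I> l" "l ` (B - Q) \<subseteq> {0}" "l ` (A - Q) \<subseteq> {1}"
    using Urysohn_lemma[OF compact_Hausdorff_normal[OF Z], of "B - Q" "A - Q" 0 1] by auto
  have l01: "l z \<in> {0..1}" if "z \<in> topspace Z" for z
    using l(1) that by (auto simp: continuous_map_def)
  have l': "continuous_map Z euclideanreal l" using l(1) continuous_map_in_subtopology by blast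
  define W where "W = {z \<in> topspace Z. (l z, z) \<in> O1}"
  have gr: "continuous_map Z ?P (\<lambda>z. (l z, z))" using l(1) by (simp add: continuous_map_pairedI)
  have W: "openin Z W" unfolding W_def using gr O1(1) by (rule openin_continuous_map_preimage)
  \<comment> \<open>All heights from \<open>l z\<close> up to 1 are covered, not just
    \<open>l z\<close>: the later homotopy moves along this vertical segment. \<open>BW\<close> does
    the same downwards.\<close>
  have AW: "(t, z) \<in> O1" if "z \<in> A" "t \<in> {0..1}" "l z \<le> t" for t z
  proof (cases "z \<in> Q")
    case False then have "l z = 1" using l that by auto
    then have "t = 1" using that by auto
    then show ?thesis using O1 that by auto
  qed (use QO that in auto)
  have BW: "(t, z) \<in> O1" if "z \<in> B" "t \<in> {0..1}" "t \<le> l z" for t z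
  proof (cases "z \<in> Q")
    case False then have "l z = 0" using l that by auto
    then have "t = 0" using that by auto
    then show ?thesis using O1 that by auto
  qed (use QO that in auto)
  have ABW: "A \<union> B \<subseteq> W" unfolding W_def using AW BW l01 AZ by force
  have H: "continuous_map (subtopology Z W) L (K \<circ> (\<lambda>z. (l z, z)))"
  proof (rule continuous_map_compose[OF _ K])
    show "continuous_map (subtopology Z W) (subtopology ?P O1) (\<lambda>z. (l z, z))"
      using gr by (auto simp: continuous_map_in_subtopology W_def intro: continuous_map_from_subtopology)
  qed
  \<comment> \<open>Vertical motion of the graph to the level \<open>e\<close>, where
    \<open>K\<close> is homotopic to \<open>k\<close>: level 1 recovers \<open>h\<close> on
    \<open>A\<close>, level 0 recovers \<open>g\<close> on \<open>B\<close>.\<close>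
  have slide: "homotopic (subtopology Z C) L (K \<circ> (\<lambda>z. (l z, z))) c"
    if C: "C \<subseteq> topspace Z" "e \<in> {0..1}" "\<And>t z. z \<in> C \<Longrightarrow> t \<in> {0..1} \<Longrightarrow> ((1 - t) * l z + t * e, z) \<in> O1"
      and Ce: "{e} \<times> C \<subseteq> ?M" "\<And>z. z \<in> C \<Longrightarrow> k (e, z) = c z" for C c and e :: real
  proof -
    have fs: "continuous_map (prod_topology \<I> (subtopology Z C)) euclideanreal fst"
      "continuous_map (prod_topology \<I> (subtopology Z C)) euclideanreal (\<lambda>p. l (snd p))"
      "continuous_map (prod_topology \<I> (subtopology Z C)) Z snd"
      using continuous_map_fst[of \<I> "subtopology Z C"] continuous_map_snd[of \<I> "subtopology Z C"] l'
      by (auto simp: continuous_map_in_subtopology intro: continuous_map_compose[of _ Z snd _ l, unfolded o_def])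
    have aff: "(1 - t) * l z + t * e \<in> {0..1}" if "t \<in> {0..1}" "z \<in> C" for t z
      using convexD_alt[of "{0..1::real}" "l z" e t] l01[of z] that C by auto
    have "continuous_map (prod_topology \<I> (subtopology Z C)) \<I> (\<lambda>p. (1 - fst p) * l (snd p) + fst p * e)"
      using aff by (auto simp: continuous_map_in_subtopology topspace_prod_topology intro!: continuous_intros fs)
    then have m: "continuous_map (prod_topology \<I> (subtopology Z C)) (subtopology ?P O1)
        (\<lambda>p. ((1 - fst p) * l (snd p) + fst p * e, snd p))"
      using C by (auto simp: continuous_map_in_subtopology topspace_prod_topology intro!: continuous_map_pairedI fs)
    have 1: "homotopic (subtopology Z C) L (K \<circ> (\<lambda>z. (l z, z))) (K \<circ> (\<lambda>z. (e, z)))"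
      by (rule homotopicI[OF continuous_map_compose[OF m K]]) auto
    have m2: "continuous_map (subtopology Z C) (subtopology ?P ?M) (\<lambda>z. (e, z))"
      using Ce C by (auto simp: continuous_map_in_subtopology image_subset_iff intro!: continuous_map_pairedI)
    have 2: "homotopic (subtopology Z C) L (K \<circ> (\<lambda>z. (e, z))) (k \<circ> (\<lambda>z. (e, z)))"
      by (rule homotopic_with_compose_continuous_map_right[OF Kk m2]) auto
    have 3: "homotopic (subtopology Z C) L (k \<circ> (\<lambda>z. (e, z))) c"
      using 2 Ce(2) by (intro homotopic_with_equal) (auto dest: homotopic_with_imp_continuous_maps)
    show ?thesis using 1 2 3 homotopic_with_trans by blast
  qed
  have "homotopic (subtopology Z A) L (K \<circ> (\<lambda>z. (l z, z))) h"
  proof (rule slide[of A 1 h])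
    show "((1 - t) * l z + t * 1, z) \<in> O1" if "z \<in> A" "t \<in> {0..1}" for t z
    proof (rule AW)
      have "0 \<le> t * (1 - l z)" "0 \<le> (1 - t) * (1 - l z)"
        using that l01[of z] AZ by (auto intro!: mult_nonneg_nonneg)
      then show "(1 - t) * l z + t * 1 \<in> {0..1}" "l z \<le> (1 - t) * l z + t * 1"
        using that l01[of z] AZ by (auto simp: algebra_simps add_nonneg_nonneg)
    qed fact
  qed (use AZ k1 in auto)
  moreover have "homotopic (subtopology Z B) L (K \<circ> (\<lambda>z. (l z, z))) g"
  proof (rule slide[of B 0 g])
    show "((1 - t) * l z + t * 0, z) \<in> O1" if "z \<in> B" "t \<in> {0..1}" for t z
    proof (rule BW)
      show "(1 - t) * l z + t * 0 \<in> {0..1}" "(1 - t) * l z + t * 0 \<le> l z"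
        using that l01[of z] AZ by (auto simp: mult_le_one mult_left_le_one_le)
    qed fact
  qed (use AZ k0 in auto)
  ultimately show thesis using that W ABW H by blast
qed

lemma edim_le_closed:
  assumes "edim_le Z L" "closedin Z B"
  shows "edim_le (subtopology Z B) L"
  unfolding edim_le_def
proof (intro allI impI)
  fix A h assume A: "closedin (subtopology Z B) A" and h: "continuous_map (subtopology (subtopology Z B) A) L h"
  then have "A \<subseteq> B" "closedin Z A"
    using assms(2) by (auto simp: closedin_closed_subtopology)
  then have eq: "subtopology (subtopology Z B) A = subtopology Z A"
    by (simp add: subtopology_subtopology Int_absorb1)
  then obtain H where "continuous_map Z L H" "homotopic (subtopology Z A) L H h"
    using assms(1) h \<open>closedin Z A\<close> unfolding edim_le_def by metis
  then show "\<exists>H. continuous_map (subtopology Z B) L H \<and> homotopic (subtopology (subtopology Z B) A) L H h"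
    using eq continuous_map_from_subtopology by metis
qed

text \<open>Extending first to a neighbourhood of \<open>A \<union> B\<close> leaves over only a
  closed set off \<open>B\<close>, to which the hypothesis on \<open>C\<close> applies. This form
  suits the strata: measures with exactly \<open>k\<close> atoms need not form a closed set.\<close>

lemma edim_le_sum:
  fixes Z :: "'z topology"
  assumes Z: "compact_space Z" "Hausdorff_space Z"
    and L: "nbhd_ext (prod_topology \<I> Z) (L :: 'c topology)"
    and B: "closedin Z B" "edim_le (subtopology Z B) L"
    and C: "\<And>C. closedin Z C \<Longrightarrow> C \<inter> B = {} \<Longrightarrow> edim_le (subtopology Z C) L"
  shows "edim_le Z L"
proof -
  \<comment> \<open>Used twice below. The dimension hypothesis on \<open>B\<close> yields a map that
    agrees with \<open>h\<close> on \<open>A \<inter> B\<close> only up to homotopy, and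
    \<open>nbhd_ext_union\<close> absorbs that homotopy.\<close>
  have ext: "\<exists>W H. openin Z W \<and> A \<union> B \<subseteq> W \<and> continuous_map (subtopology Z W) L H \<and>
      homotopic (subtopology Z A) L H h"
    if cl: "closedin Z A" "closedin Z B" "continuous_map (subtopology Z A) L h" "edim_le (subtopology Z B) L"
    for A B and h :: "'z \<Rightarrow> 'c"
  proof -
    have "closedin (subtopology Z B) (A \<inter> B)"
      using cl by (metis closedin_Int closedin_subset_topspace inf.cobounded2)
    moreover have eq: "subtopology (subtopology Z B) (A \<inter> B) = subtopology Z (A \<inter> B)"
      by (simp add: subtopology_subtopology Int_absorb1)
    moreover have "continuous_map (subtopology Z (A \<inter> B)) L h"
      using cl(3) by (metis continuous_map_from_subtopology subtopology_subtopology)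
    ultimately obtain g where "continuous_map (subtopology Z B) L g" "homotopic (subtopology Z (A \<inter> B)) L g h"
      using cl(4) unfolding edim_le_def by metis
    from nbhd_ext_union[OF Z L cl(1,2,3) this] show ?thesis by metis
  qed
  show ?thesis
    unfolding edim_le_def
  proof (intro allI impI)
    fix A h assume A: "closedin Z A" "continuous_map (subtopology Z A) L h"
    obtain W H where W: "openin Z W" "A \<union> B \<subseteq> W" and H: "continuous_map (subtopology Z W) L H"
      "homotopic (subtopology Z A) L H h"
      using ext[OF A(1) B(1) A(2) B(2)] by blast
    obtain V N where V: "openin Z V" "closedin Z N" "A \<union> B \<subseteq> V" "V \<subseteq> N" "N \<subseteq> W"
      using compact_Hausdorff_normal[OF Z] W A B
      unfolding normal_space_alt by (metis closedin_Un closedin_closure_of closure_of_subset openin_subset)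
    have C': "closedin Z (topspace Z - V)" "edim_le (subtopology Z (topspace Z - V)) L"
      using V C[of "topspace Z - V"] by blast+
    have HN: "continuous_map (subtopology Z N) L H"
      using H(1) V(5) by (metis continuous_map_from_subtopology_mono)
    obtain W' H' where "openin Z W'" "N \<union> (topspace Z - V) \<subseteq> W'" and H': "continuous_map (subtopology Z W') L H'"
      "homotopic (subtopology Z N) L H' H"
      using ext[OF V(2) C'(1) HN C'(2)] by blast
    \<comment> \<open>\<open>N\<close> contains \<open>V\<close>, so \<open>N\<close> and the
      complement of \<open>V\<close> already cover \<open>Z\<close>.\<close>
    then have "W' = topspace Z" using V openin_subset by blast
    then have "continuous_map Z L H'" using H' by simp
    moreover have "homotopic (subtopology Z A) L H' h"
      using homotopic_subset[OF H'(2), of A] V H(2) homotopic_with_trans by blast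
    ultimately show "\<exists>H. continuous_map Z L H \<and> homotopic (subtopology Z A) L H h" by blast
  qed
qed


section \<open>Attaching a cell\<close>

definition nrm :: "nat \<Rightarrow> (nat \<Rightarrow> real) \<Rightarrow> real" where
  "nrm n x = sqrt (\<Sum>i<n. (x i)\<^sup>2)"

abbreviation cball_top :: "nat \<Rightarrow> (nat \<Rightarrow> real) topology" where
  "cball_top n \<equiv> subtopology (Euclidean_space n) (unit_cball n)"

lemma nrm_nonneg [simp]: "0 \<le> nrm n x"
  by (simp add: nrm_def sum_nonneg)

lemma nrm_scale: "nrm n (\<lambda>i. c * x i) = \<bar>c\<bar> * nrm n x"
  by (simp add: nrm_def power_mult_distrib sum_distrib_left[symmetric] real_sqrt_mult)

lemma abs_coord_le_nrm: "i < n \<Longrightarrow> \<bar>x i\<bar> \<le> nrm n x"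
  unfolding nrm_def by (rule real_le_rsqrt) (auto intro: member_le_sum)

lemma mem_unit_cball: "x \<in> unit_cball n \<longleftrightarrow> (\<forall>i\<ge>n. x i = 0) \<and> nrm n x \<le> 1"
  and mem_unit_ball: "x \<in> unit_ball n \<longleftrightarrow> (\<forall>i\<ge>n. x i = 0) \<and> nrm n x < 1"
  and mem_unit_sphere: "x \<in> unit_sphere n \<longleftrightarrow> (\<forall>i\<ge>n. x i = 0) \<and> nrm n x = 1"
  by (auto simp: unit_cball_def unit_ball_def unit_sphere_def topspace_Euclidean_space nrm_def)

lemma unit_cball_topspace [simp]: "x \<in> unit_cball n \<Longrightarrow> x \<in> topspace (Euclidean_space n)"
  "topspace (Euclidean_space n) \<inter> unit_cball n = unit_cball n"
  by (auto simp: unit_cball_def)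

lemma unit_cball_decomp: "unit_cball n = unit_ball n \<union> unit_sphere n"
  by (auto simp: mem_unit_cball mem_unit_ball mem_unit_sphere)

lemma continuous_map_coord: "continuous_map (cball_top n) euclideanreal (\<lambda>x. x i)"
  unfolding Euclidean_space_def
  by (intro continuous_map_from_subtopology continuous_map_product_projection) auto

lemma continuous_map_nrm:
  assumes "\<And>i. i < n \<Longrightarrow> continuous_map X euclideanreal (\<lambda>z. g z i)"
  shows "continuous_map X euclideanreal (\<lambda>z. nrm n (g z))"
  unfolding nrm_def by (intro continuous_intros) (use assms in auto)

text \<open>Points of the ball vanish in all coordinates from \<open>n\<close> on, so continuity has
  to be checked only in the first \<open>n\<close>.\<close>

lemma continuous_map_into_cball:
  assumes "\<And>i. i < n \<Longrightarrow> continuous_map X euclideanreal (\<lambda>z. g z i)"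
    and "\<And>z. z \<in> topspace X \<Longrightarrow> g z \<in> unit_cball n"
  shows "continuous_map X (cball_top n) g"
proof -
  have "continuous_map X euclideanreal (\<lambda>z. g z i)" for i
  proof (cases "i < n")
    case False
    then have "g z i = 0" if "z \<in> topspace X" for z
      using assms(2)[OF that] by (auto simp: mem_unit_cball)
    then show ?thesis
      using continuous_map_eq[of X euclideanreal "\<lambda>z. 0" "\<lambda>z. g z i"] by simp
  qed (use assms in auto)
  then have "continuous_map X (powertop_real UNIV) g"
    by (simp add: continuous_map_componentwise_UNIV)
  then show ?thesis
    using assms(2) by (auto simp: Euclidean_space_def continuous_map_in_subtopology mem_unit_cball)
qed

text \<open>The ball sits in the space of all real sequences, so compactness comes from Tychonoff's
  theorem: it is closed in a product of copies of \<open>{-1..1}\<close>.\<close>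

lemma compact_cball: "compact_space (cball_top n)"
proof -
  have eq: "cball_top n = top_of_set (unit_cball n)"
  proof -
    have "unit_cball n \<subseteq> {x. \<forall>i\<ge>n. x i = 0}" by (auto simp: mem_unit_cball)
    then show ?thesis
      by (simp add: Euclidean_space_def euclidean_product_topology subtopology_subtopology Int_absorb1)
  qed
  have "closed (unit_cball n)"
  proof -
    have c: "continuous_on UNIV (\<lambda>x :: nat \<Rightarrow> real. x i)" for i by simp
    have "unit_cball n = (\<Inter>i\<in>{n..}. {x. x i = 0}) \<inter> {x. nrm n x \<le> 1}"
      by (auto simp: mem_unit_cball)
    also have "closed \<dots>"
      unfolding nrm_def
      by (intro closed_Int closed_INT ballI closed_Collect_eq closed_Collect_le continuous_intros c)
    finally show ?thesis .
  qed
  moreover have "compact (PiE UNIV (\<lambda>_::nat. {-1..1::real}))"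
  proof -
    have "compactin (product_topology (\<lambda>_::nat. euclideanreal) UNIV) (PiE UNIV (\<lambda>_. {-1..1}))"
      by (simp add: compactin_PiE)
    then show ?thesis by (simp add: euclidean_product_topology)
  qed
  moreover have "unit_cball n \<subseteq> PiE UNIV (\<lambda>_. {-1..1})"
  proof
    fix x assume x: "x \<in> unit_cball n"
    have "\<bar>x i\<bar> \<le> 1" for i
      using x abs_coord_le_nrm[of i n x] by (cases "i < n") (auto simp: mem_unit_cball)
    then have "x i \<in> {-1..1}" for i by (metis abs_le_iff atLeastAtMost_iff minus_le_iff)
    then show "x \<in> PiE UNIV (\<lambda>_. {-1..1})" by auto
  qed
  ultimately have "compact (unit_cball n)"
    by (metis compact_Int_closed inf.absorb_iff2)
  then show ?thesis unfolding eq by (simp add: compact_space_subtopology)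
qed

text \<open>A map from a compact to a Hausdorff space is closed, hence a quotient map onto its
  image. This gives continuity of functions defined through an inverse, such as the radial
  coordinate on a closed cell, where the characteristic map need not be injective.\<close>

lemma continuous_map_on_compact_image:
  assumes C: "compact_space C" and X: "Hausdorff_space X" and p: "continuous_map C X p"
    and gp: "continuous_map C Y (g \<circ> p)"
  shows "continuous_map (subtopology X (p ` topspace C)) Y g"
proof -
  have "continuous_map C (subtopology X (p ` topspace C)) p"
    using p by (auto simp: continuous_map_in_subtopology)
  moreover have "Hausdorff_space (subtopology X (p ` topspace C))"
    using X by (rule Hausdorff_space_subtopology)
  moreover have "p ` topspace C = topspace (subtopology X (p ` topspace C))"
    using p by (auto simp: continuous_map_def)
  ultimately have "quotient_map C (subtopology X (p ` topspace C)) p"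
    using C by (metis continuous_imp_closed_map continuous_closed_imp_quotient_map)
  then show ?thesis using gp continuous_compose_quotient_map by blast
qed

definition clamp01 :: "real \<Rightarrow> real" where "clamp01 t = max 0 (min 1 t)"

lemma clamp01 [simp]: "0 \<le> clamp01 t" "clamp01 t \<le> 1" "t \<in> {0..1} \<Longrightarrow> clamp01 t = t"
  "clamp01 0 = 0" "clamp01 1 = 1"
  by (auto simp: clamp01_def)

lemma continuous_map_clamp01:
  "continuous_map X euclideanreal g \<Longrightarrow> continuous_map X \<I> (\<lambda>z. clamp01 (g z))"
  unfolding clamp01_def continuous_map_in_subtopology
  by (auto intro!: continuous_map_real_max continuous_map_real_min)

text \<open>Where the radial coordinate \<open>\<rho>\<close> is at most \<open>2/3\<close>, the map has values in the cell and extends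
  by Tietze's theorem; where it is at least \<open>1/3\<close>, it can be pushed radially (by \<open>d\<close>) into \<open>K\<close> and
  extends by hypothesis, up to a homotopy \<open>\<Gamma>\<close>.  The two extensions are joined on the overlap by
  following first \<open>d\<close> and then \<open>\<Gamma>\<close>, with \<open>\<rho>\<close> as the time.\<close>

lemma nbhd_ext_attach:
  fixes Z :: "'z topology" and L :: "'c topology"
  assumes Z: "compact_space Z" "Hausdorff_space Z" and L: "Hausdorff_space L"
    and K: "compactin L K"
    and ext: "nbhd_ext Z (subtopology L K)"
    and e: "e \<subseteq> topspace L" "disjnt e K"
    and char: "characteristic_map L n e \<Phi>" and bd: "\<Phi> ` unit_sphere n \<subseteq> K"
  shows "nbhd_ext Z (subtopology L (K \<union> e))"
proof -
  let ?D = "cball_top n" and ?Kt = "subtopology L (K \<union> e)"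
  have \<Phi>: "continuous_map ?D L \<Phi>" using char by (simp add: characteristic_map_def)
  obtain \<psi> where \<psi>: "continuous_map (subtopology L e) (subtopology (Euclidean_space n) (unit_ball n)) \<psi>"
    and \<psi>\<Phi>: "\<And>x. x \<in> unit_ball n \<Longrightarrow> \<psi> (\<Phi> x) = x" and \<Phi>\<psi>: "\<And>k. k \<in> e \<Longrightarrow> \<Phi> (\<psi> k) = k"
    and \<Phi>b: "\<And>x. x \<in> unit_ball n \<Longrightarrow> \<Phi> x \<in> e"
  proof -
    have tb: "topspace (subtopology (Euclidean_space n) (unit_ball n)) = unit_ball n"
      by (auto simp: unit_ball_def)
    have te: "topspace (subtopology L e) = e" using e by auto
    obtain g where g: "homeomorphic_maps (subtopology (Euclidean_space n) (unit_ball n)) (subtopology L e) \<Phi> g"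
      using char by (auto simp: characteristic_map_def homeomorphic_map_maps)
    show thesis
    proof (rule that[of g])
      show "continuous_map (subtopology L e) (subtopology (Euclidean_space n) (unit_ball n)) g"
        using g by (simp add: homeomorphic_maps_def)
    qed (use g tb te in \<open>auto simp: homeomorphic_maps_def continuous_map_def\<close>)
  qed
  have \<psi>b: "\<psi> k \<in> unit_ball n" if "k \<in> e" for k
    using \<psi> that e by (auto simp: continuous_map_def unit_ball_def)
  have \<Phi>s: "\<Phi> x \<in> K" "\<Phi> x \<notin> e" if "x \<in> unit_sphere n" for x using bd e that by (auto simp: disjnt_def)
  have KL: "K \<subseteq> topspace L" using K by (simp add: compactin_subset_topspace)
  have clK: "closedin L K" using K L by (simp add: compactin_imp_closedin)
  have \<Phi>K: "\<Phi> x \<in> K \<union> e" if "x \<in> unit_cball n" for x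
    using that \<Phi>s \<Phi>b by (auto simp: unit_cball_decomp)
  have \<Phi>t: "continuous_map ?D ?Kt \<Phi>"
    using \<Phi> \<Phi>K by (auto simp: continuous_map_in_subtopology)
  have Ke: "K \<union> e = K \<union> \<Phi> ` unit_cball n"
    using \<Phi>K \<psi>b \<Phi>\<psi> by (force simp: unit_cball_decomp)
  have cl\<Phi>: "closedin L (\<Phi> ` S)" if "closedin ?D S" for S
  proof -
    have "compactin ?D S" using that compact_cball closedin_compact_space by blast
    then show ?thesis using \<Phi> L by (meson compactin_imp_closedin image_compactin)
  qed

  \<comment> \<open>The value 1 outside the cell matches the norm on the sphere, which
    \<open>\<Phi>\<close> sends into \<open>K\<close>; so continuity can be pasted from the two
    closed pieces \<open>K\<close> and the image of the ball.\<close>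
  define rad where "rad k = (if k \<in> e then nrm n (\<psi> k) else 1)" for k
  have rad\<Phi>: "rad (\<Phi> x) = nrm n x" if "x \<in> unit_cball n" for x
    using that \<Phi>s \<Phi>b \<psi>\<Phi> by (auto simp: rad_def unit_cball_decomp mem_unit_sphere)
  have rad01: "rad k \<in> {0..1}" for k
    using \<psi>b[of k] by (auto simp: rad_def mem_unit_ball)
  have contrad: "continuous_map ?Kt euclideanreal rad"
  proof -
    have 1: "continuous_map (subtopology L K) euclideanreal (\<lambda>k. 1)" by simp
    have "continuous_map (subtopology L (\<Phi> ` topspace ?D)) euclideanreal rad"
    proof (rule continuous_map_on_compact_image[OF compact_cball L \<Phi>])
      have "continuous_map ?D euclideanreal (nrm n)"
        by (intro continuous_map_nrm continuous_map_coord)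
      then show "continuous_map ?D euclideanreal (rad \<circ> \<Phi>)"
        by (rule continuous_map_eq) (simp add: rad\<Phi>)
    qed
    then have 2: "continuous_map (subtopology L (\<Phi> ` unit_cball n)) euclideanreal rad" by simp
    have "continuous_map (subtopology L (K \<union> \<Phi> ` unit_cball n)) euclideanreal (\<lambda>k. if k \<in> K then 1 else rad k)"
      by (rule continuous_map_union_closed[OF clK cl\<Phi>[OF closedin_topspace, simplified] 1 2]) (use e in \<open>auto simp: rad_def disjnt_def\<close>)
    then show ?thesis unfolding Ke
      by (rule continuous_map_eq) (use e in \<open>auto simp: rad_def disjnt_def\<close>)
  qed

  \<comment> \<open>The radius must be positive because pushing outwards is undefined at the centre.
    It is 1/4 because the points to be pushed later have radius at least 1/3, and the gap leaves
    room for a neighbourhood.\<close>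
  define shell where "shell = {x \<in> unit_cball n. 1/4 \<le> nrm n x}"
  \<comment> \<open>The factor turns radius \<open>r\<close> into \<open>(1 - s) * r + s\<close>, so
    the sphere is reached at time 1. Points outside the cell stay fixed.\<close>
  define d where "d = (\<lambda>(s, k). if k \<in> e then \<Phi> (\<lambda>i. (1 - s + s / nrm n (\<psi> k)) * \<psi> k i) else k)"
  let ?M = "{k \<in> topspace L \<inter> (K \<union> e). 1/4 \<le> rad k}"
  have M: "?M = K \<union> \<Phi> ` shell"
  proof (intro set_eqI iffI)
    fix k assume "k \<in> ?M"
    then have "k \<in> K \<union> \<Phi> ` unit_cball n" "1/4 \<le> rad k" unfolding Ke by auto
    then show "k \<in> K \<union> \<Phi> ` shell" using rad\<Phi> by (auto simp: shell_def)
  next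
    fix k assume "k \<in> K \<union> \<Phi> ` shell"
    then show "k \<in> ?M"
    proof
      assume "k \<in> \<Phi> ` shell"
      then show ?thesis using rad\<Phi> \<Phi>K e KL by (fastforce simp: shell_def)
    qed (use e KL in \<open>auto simp: rad_def disjnt_def\<close>)
  qed
  have pushin: "(\<lambda>i. (1 - s + s / nrm n x) * x i) \<in> unit_cball n"
    and push1: "s = 1 \<Longrightarrow> (\<lambda>i. (1 - s + s / nrm n x) * x i) \<in> unit_sphere n"
    if x: "x \<in> shell" "s \<in> {0..1}" for s x
  proof -
    have "0 < nrm n x" "nrm n x \<le> 1" using x by (auto simp: shell_def mem_unit_cball)
    then have *: "nrm n (\<lambda>i. (1 - s + s / nrm n x) * x i) = (1 - s) * nrm n x + s"
      using x by (subst nrm_scale) (simp add: abs_of_nonneg distrib_right)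
    have "(1 - s) * nrm n x \<le> 1 - s" using \<open>nrm n x \<le> 1\<close> x by (simp add: mult_left_le)
    then show "(\<lambda>i. (1 - s + s / nrm n x) * x i) \<in> unit_cball n"
      using * x by (auto simp: mem_unit_cball shell_def)
    show "(\<lambda>i. (1 - s + s / nrm n x) * x i) \<in> unit_sphere n" if "s = 1"
      using * x that by (auto simp: mem_unit_sphere shell_def mem_unit_cball)
  qed
  have d\<Phi>: "d (s, \<Phi> x) = \<Phi> (\<lambda>i. (1 - s + s / nrm n x) * x i)" if "x \<in> unit_cball n" for s x
    using that \<Phi>s \<Phi>b \<psi>\<Phi> by (auto simp: d_def unit_cball_decomp mem_unit_sphere)
  have d0: "d (0, k) = k" for k by (auto simp: d_def \<Phi>\<psi>)
  have d1: "d (1, k) \<in> K" if "k \<in> ?M" for k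
  proof -
    have "k \<in> K \<union> \<Phi> ` shell" using that M by blast
    then show ?thesis
    proof
      assume "k \<in> \<Phi> ` shell"
      then show ?thesis using d\<Phi> push1[of _ 1] \<Phi>s(1) by (auto simp: shell_def)
    qed (use e in \<open>auto simp: d_def disjnt_def\<close>)
  qed
  \<comment> \<open>Since \<open>\<psi>\<close> is available only on the open cell, continuity on
    the cell side is checked after composing with \<open>\<Phi>\<close>, on the compact product of
    the interval and the shell.\<close>
  have contd: "continuous_map (prod_topology \<I> (subtopology L ?M)) ?Kt d"
  proof -
    let ?I = "prod_topology \<I> L" and ?C = "prod_topology \<I> (subtopology ?D shell)"
    have clsh: "closedin ?D shell"
    proof -
      have "continuous_map ?D euclideanreal (nrm n)"
        by (intro continuous_map_nrm continuous_map_coord)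
      moreover have "shell = {x \<in> topspace ?D. nrm n x \<in> {1/4..}}" by (auto simp: shell_def)
      ultimately show ?thesis using closedin_continuous_map_preimage[of ?D euclideanreal "nrm n" "{1/4..}"] by simp
    qed
    have csh: "compact_space (subtopology ?D shell)"
      using clsh compact_cball closedin_compact_space compact_space_subtopology by blast
    have tsh: "topspace (subtopology ?D shell) = shell" by (auto simp: shell_def)
    have \<Phi>sh: "continuous_map (subtopology ?D shell) L \<Phi>" using \<Phi> by (rule continuous_map_from_subtopology)
    have 1: "continuous_map (subtopology ?I ({0..1} \<times> K)) ?Kt snd"
      by (auto simp: continuous_map_in_subtopology intro!: continuous_map_from_subtopology continuous_map_snd)
    have p: "continuous_map ?C ?I (\<lambda>p. (fst p, \<Phi> (snd p)))"
      using continuous_map_compose[OF continuous_map_snd \<Phi>sh]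
      by (auto intro!: continuous_map_pairedI continuous_map_fst simp: o_def)
    have ti: "(\<lambda>p. (fst p, \<Phi> (snd p))) ` topspace ?C = {0..1} \<times> \<Phi> ` shell"
      unfolding topspace_prod_topology tsh by (force simp: image_iff)
    have "continuous_map (subtopology ?I ((\<lambda>p. (fst p, \<Phi> (snd p))) ` topspace ?C)) ?Kt d"
    proof (rule continuous_map_on_compact_image[OF _ _ p])
      show "compact_space ?C" using csh by (simp add: compact_space_prod_topology compact_space_subtopology)
      show "Hausdorff_space ?I" using L by (simp add: Hausdorff_space_prod_topology Hausdorff_space_subtopology)
      have c1: "continuous_map ?C euclideanreal fst"
        using continuous_map_fst[of \<I> "subtopology ?D shell"] by (simp add: continuous_map_in_subtopology)
      have c2: "continuous_map ?C euclideanreal (\<lambda>p. snd p i)" for i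
        using continuous_map_compose[OF continuous_map_snd continuous_map_from_subtopology[OF continuous_map_coord], of \<I> n shell i]
        by (simp add: o_def)
      have nz: "nrm n (snd p) \<noteq> 0" if "p \<in> topspace ?C" for p
        using that by (auto simp: tsh shell_def)
      have "continuous_map ?C ?D (\<lambda>p i. (1 - fst p + fst p / nrm n (snd p)) * snd p i)"
        by (intro continuous_map_into_cball continuous_intros continuous_map_nrm c1 c2)
           (use nz pushin in \<open>auto simp: tsh\<close>)
      then have "continuous_map ?C ?Kt (\<Phi> \<circ> (\<lambda>p i. (1 - fst p + fst p / nrm n (snd p)) * snd p i))"
        using \<Phi>t by (rule continuous_map_compose)
      then show "continuous_map ?C ?Kt (d \<circ> (\<lambda>p. (fst p, \<Phi> (snd p))))"
        by (rule continuous_map_eq) (auto simp: tsh d\<Phi> shell_def)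
    qed
    then have 2: "continuous_map (subtopology ?I ({0..1} \<times> \<Phi> ` shell)) ?Kt d" unfolding ti .
    have ii: "closedin \<I> {0..1}" using closedin_topspace[of \<I>] by simp
    have "continuous_map (subtopology ?I ({0..1} \<times> K \<union> {0..1} \<times> \<Phi> ` shell)) ?Kt (\<lambda>x. if x \<in> {0..1} \<times> K then snd x else d x)"
      by (rule continuous_map_union_closed[OF _ _ 1 2])
         (use ii clK cl\<Phi>[OF clsh] e in \<open>auto simp: closedin_prod_Times_iff d_def disjnt_def\<close>)
    then have "continuous_map (subtopology ?I ({0..1} \<times> K \<union> {0..1} \<times> \<Phi> ` shell)) ?Kt d"
      by (rule continuous_map_eq) (use e in \<open>auto simp: d_def disjnt_def\<close>)
    moreover have "prod_topology \<I> (subtopology L ?M) = subtopology ?I ({0..1} \<times> K \<union> {0..1} \<times> \<Phi> ` shell)"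
      unfolding M by (simp add: prod_topology_subtopology subtopology_subtopology Times_Un_distrib1 Sigma_Un_distrib2[symmetric] Times_Int_Times)
    ultimately show ?thesis by simp
  qed

  show ?thesis
    unfolding nbhd_ext_def
  proof (intro allI impI)
    fix A h assume A: "closedin Z A" and h: "continuous_map (subtopology Z A) ?Kt h"
    have AZ: "A \<subseteq> topspace Z" using A closedin_subset by blast
    have hK: "h z \<in> topspace L \<inter> (K \<union> e)" if "z \<in> A" for z using h that AZ by (auto simp: continuous_map_def)
    note normal = compact_Hausdorff_normal[OF Z]
    have "continuous_map (subtopology Z A) euclideanreal (rad \<circ> h)"
      using h contrad by (rule continuous_map_compose)
    then obtain \<rho> where \<rho>: "continuous_map Z euclideanreal \<rho>" and \<rho>h: "\<And>z. z \<in> A \<Longrightarrow> \<rho> z = rad (h z)"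
      and \<rho>01: "\<rho> ` topspace Z \<subseteq> {0..1}"
      using Tietze_extension_closed_real_interval[OF normal A, of "rad \<circ> h" 0 1] rad01
      by (auto simp: image_subset_iff)
    \<comment> \<open>The bound 2/3 keeps the images of these points away from \<open>K\<close>,
      where \<open>rad\<close> is 1, so \<open>h\<close> can be followed by \<open>\<psi>\<close>
      there.\<close>
    define A2 where "A2 = {z \<in> A. \<rho> z \<le> 2/3}"
    have A2: "closedin Z A2"
    proof -
      have "A2 = A \<inter> {z \<in> topspace Z. \<rho> z \<in> {..2/3}}" using AZ by (auto simp: A2_def)
      then show ?thesis using A closedin_continuous_map_preimage[OF \<rho>, of "{..2/3}"] by auto
    qed
    have hA2: "h z \<in> e" if "z \<in> A2" for z
      using that \<rho>h[of z] by (auto simp: A2_def rad_def split: if_splits)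
    have \<psi>h: "continuous_map (subtopology Z A2) euclideanreal (\<lambda>z. \<psi> (h z) i)" for i
    proof -
      have 1: "continuous_map (subtopology Z A2) (subtopology L e) h"
        using continuous_map_from_subtopology_mono[OF h, of A2] hA2
        by (auto simp: continuous_map_in_subtopology A2_def)
      have 2: "continuous_map (subtopology (Euclidean_space n) (unit_ball n)) euclideanreal (\<lambda>x. x i)"
        unfolding Euclidean_space_def
        by (intro continuous_map_from_subtopology continuous_map_product_projection) auto
      show ?thesis
        using continuous_map_compose[OF continuous_map_compose[OF 1 \<psi>] 2] by (simp add: o_def)
    qed
    have "\<exists>g. continuous_map Z euclideanreal g \<and> (\<forall>z\<in>A2. g z = \<psi> (h z) i)" for i
    proof (rule Tietze_extension_realinterval[OF normal A2 _ _ \<psi>h, of UNIV i])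
    qed auto
    then obtain f where f: "\<And>i. continuous_map Z euclideanreal (f i)" "\<And>i z. z \<in> A2 \<Longrightarrow> f i z = \<psi> (h z) i"
      by metis
    define F0 where "F0 z i = (if i < n then f i z else 0)" for z i
    \<comment> \<open>The coordinatewise Tietze extension may leave the ball. Division by the
      maximum of 1 and the norm brings it back and changes nothing on \<open>A2\<close>, where the
      norm is below 1.\<close>
    define F where "F z = (\<lambda>i. (1 / max 1 (nrm n (F0 z))) * F0 z i)" for z
    have F: "continuous_map Z ?D F"
      unfolding F_def
    proof (rule continuous_map_into_cball)
      have c: "continuous_map Z euclideanreal (\<lambda>z. F0 z i)" if "i < n" for i
        using that f by (simp add: F0_def)
      show "continuous_map Z euclideanreal (\<lambda>z. 1 / max 1 (nrm n (F0 z)) * F0 z i)" if "i < n" for i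
      proof -
        have "continuous_map Z euclideanreal (\<lambda>z. max 1 (nrm n (F0 z)))"
          by (rule continuous_map_real_max) (use continuous_map_nrm[of n Z F0, OF c] in auto)
        then have "continuous_map Z euclideanreal (\<lambda>z. 1 / max 1 (nrm n (F0 z)))"
          by (rule continuous_map_real_divide[rotated]) auto
        then show ?thesis using c[OF that] by (rule continuous_map_real_mult)
      qed
      show "(\<lambda>i. 1 / max 1 (nrm n (F0 z)) * F0 z i) \<in> unit_cball n" for z
      proof -
        have "nrm n (\<lambda>i. 1 / max 1 (nrm n (F0 z)) * F0 z i) = nrm n (F0 z) / max 1 (nrm n (F0 z))"
          unfolding nrm_scale by simp
        then show ?thesis unfolding mem_unit_cball by (simp add: F0_def[of z])
      qed
    qed
    have FD: "F z \<in> unit_cball n" if "z \<in> topspace Z" for z using F that by (auto simp: continuous_map_def)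
    have FA2: "F z = \<psi> (h z)" if z: "z \<in> A2" for z
    proof -
      have "F0 z = \<psi> (h z)"
        using f(2)[OF z] \<psi>b[OF hA2[OF z]] by (auto simp: F0_def mem_unit_ball fun_eq_iff)
      moreover have "nrm n (\<psi> (h z)) < 1" using \<psi>b[OF hA2[OF z]] by (auto simp: mem_unit_ball)
      ultimately show ?thesis by (simp add: F_def)
    qed
    have \<Phi>F: "continuous_map Z ?Kt (\<lambda>z. \<Phi> (F z))"
      using continuous_map_compose[OF F \<Phi>t] by (simp add: o_def)
    have \<Phi>FA2: "\<Phi> (F z) = h z" if "z \<in> A2" for z using FA2 \<Phi>\<psi> hA2 that by simp
    have nF: "continuous_map Z euclideanreal (\<lambda>z. nrm n (F z))"
      by (rule continuous_map_nrm) (use continuous_map_compose[OF F continuous_map_coord] in \<open>simp add: o_def\<close>)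
    have \<Phi>FM: "\<Phi> (F z) \<in> ?M" if "z \<in> topspace Z" "1/4 \<le> nrm n (F z)" for z
    proof -
      have "\<Phi> (F z) \<in> K \<union> e" "rad (\<Phi> (F z)) = nrm n (F z)"
        using FD[OF that(1)] by (auto simp: \<Phi>K rad\<Phi> simp del: Un_iff)
      then show ?thesis using e(1) KL that(2) by auto
    qed
    have nFA2: "nrm n (F z) = \<rho> z" if "z \<in> A2" for z
      using FA2[OF that] \<rho>h[of z] hA2[OF that] that by (auto simp: rad_def A2_def)

    define A1 where "A1 = {z \<in> A. 1/3 \<le> \<rho> z}"
    \<comment> \<open>The overlap of the two extensions: \<open>\<rho>\<close> selects the band, and
      the norm bound ensures that \<open>\<Phi> (F z)\<close> can be pushed into
      \<open>K\<close>.\<close>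
    define N where "N = {z \<in> topspace Z. 1/3 \<le> \<rho> z \<and> \<rho> z \<le> 2/3 \<and> 1/4 \<le> nrm n (F z)}"
    have clN: "closedin Z N"
    proof -
      have "N = {z \<in> topspace Z. \<rho> z \<in> {1/3..2/3}} \<inter> {z \<in> topspace Z. nrm n (F z) \<in> {1/4..}}"
        by (auto simp: N_def)
      then show ?thesis
        using closedin_continuous_map_preimage[OF \<rho>, of "{1/3..2/3}"]
          closedin_continuous_map_preimage[OF nF, of "{1/4..}"] by auto
    qed
    have clA1: "closedin Z A1"
    proof -
      have "A1 = A \<inter> {z \<in> topspace Z. \<rho> z \<in> {1/3..}}" using AZ by (auto simp: A1_def)
      then show ?thesis using A closedin_continuous_map_preimage[OF \<rho>, of "{1/3..}"] by auto
    qed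
    have contdh: "continuous_map X ?Kt (\<lambda>x. d (clamp01 (a x), b x))"
      if "continuous_map X euclideanreal a" "continuous_map X ?Kt b" "\<And>x. x \<in> topspace X \<Longrightarrow> 1/4 \<le> rad (b x)"
      for X :: "'x topology" and a b
    proof -
      have "b x \<in> topspace ?Kt" if "x \<in> topspace X" for x
        using \<open>continuous_map X ?Kt b\<close> that by (simp add: continuous_map_def Pi_iff)
      then have "continuous_map X (subtopology L ?M) b"
        using that(2,3) by (auto simp: continuous_map_in_subtopology image_subset_iff)
      with continuous_map_clamp01[OF that(1)]
      have "continuous_map X (prod_topology \<I> (subtopology L ?M)) (\<lambda>x. (clamp01 (a x), b x))"
        by (rule continuous_map_pairedI)
      from continuous_map_compose[OF this contd] show ?thesis by (simp add: o_def)
    qed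
    \<comment> \<open>The two formulas agree on \<open>A1 \<inter> N\<close>: there
      \<open>\<rho>\<close> is at most 2/3, so the point lies in \<open>A2\<close> and
      \<open>\<Phi> (F z)\<close> equals \<open>h z\<close>.\<close>
    define h1 where "h1 z = (if z \<in> A1 then d (1, h z) else d (1, \<Phi> (F z)))" for z
    have h1N: "h1 z = d (1, \<Phi> (F z))" if "z \<in> N" for z
      using that \<Phi>FA2[of z] by (auto simp: h1_def N_def A1_def A2_def)
    have hM: "h z \<in> ?M" if "z \<in> A1" for z
      using that \<rho>h[of z] hK[of z] by (auto simp: A1_def)
    have h1: "continuous_map (subtopology Z (A1 \<union> N)) (subtopology L K) h1"
    proof -
      have hA1: "continuous_map (subtopology Z A1) ?Kt h"
        using h by (rule continuous_map_from_subtopology_mono) (auto simp: A1_def)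
      have "continuous_map (subtopology Z A1) ?Kt (\<lambda>z. d (clamp01 1, h z))"
        using hM by (intro contdh hA1) auto
      moreover have "continuous_map (subtopology Z N) ?Kt (\<lambda>z. d (clamp01 1, \<Phi> (F z)))"
        using \<Phi>FM by (intro contdh continuous_map_from_subtopology[OF \<Phi>F]) (auto simp: N_def)
      moreover have "d (clamp01 1, h z) = d (clamp01 1, \<Phi> (F z))" if "z \<in> A1" "z \<in> N" for z
        using h1N[of z] that by (simp add: h1_def)
      ultimately have "continuous_map (subtopology Z (A1 \<union> N)) ?Kt
          (\<lambda>z. if z \<in> A1 then d (clamp01 1, h z) else d (clamp01 1, \<Phi> (F z)))"
        using continuous_map_union_closed[OF clA1 clN] by blast
      then have "continuous_map (subtopology Z (A1 \<union> N)) ?Kt h1"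
        unfolding h1_def clamp01(5) .
      moreover have "h1 z \<in> K" if "z \<in> A1 \<union> N" for z
        using that d1[OF hM] d1[OF \<Phi>FM] by (auto simp: h1_def N_def)
      ultimately show ?thesis by (auto simp: continuous_map_in_subtopology)
    qed
    obtain W1 G where W1: "openin Z W1" "A1 \<union> N \<subseteq> W1" and G: "continuous_map (subtopology Z W1) (subtopology L K) G"
      and hom: "homotopic (subtopology Z (A1 \<union> N)) (subtopology L K) h1 G"
      using ext h1 clA1 clN unfolding nbhd_ext_def by (metis closedin_Un homotopic_with_symD)
    obtain \<Gamma> where \<Gamma>: "continuous_map (prod_topology \<I> (subtopology Z (A1 \<union> N))) (subtopology L K) \<Gamma>"
      and \<Gamma>0: "\<And>z. \<Gamma> (0, z) = h1 z" and \<Gamma>1: "\<And>z. \<Gamma> (1, z) = G z"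
      using hom unfolding homotopic_with_def by auto
    have incl: "continuous_map (subtopology L K) ?Kt id"
      by (auto simp: continuous_map_in_subtopology intro: continuous_map_from_subtopology)
    have cont\<Gamma>: "continuous_map X ?Kt (\<lambda>x. \<Gamma> (clamp01 (a x), b x))"
      if "continuous_map X euclideanreal a" "continuous_map X Z b" "\<And>x. x \<in> topspace X \<Longrightarrow> b x \<in> A1 \<union> N"
      for X :: "'x topology" and a b
    proof -
      have "continuous_map X (subtopology Z (A1 \<union> N)) b"
        using that(2,3) by (auto simp: continuous_map_in_subtopology image_subset_iff)
      with continuous_map_clamp01[OF that(1)]
      have "continuous_map X (prod_topology \<I> (subtopology Z (A1 \<union> N))) (\<lambda>x. (clamp01 (a x), b x))"
        by (rule continuous_map_pairedI)
      from continuous_map_compose[OF continuous_map_compose[OF this \<Gamma>] incl] show ?thesis by (simp add: o_def)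
    qed
    \<comment> \<open>This is what the formula for \<open>E\<close> requires: points of the band
      from 1/3 to 2/3 lie in \<open>N\<close>, and points with \<open>\<rho>\<close> at least 2/3
      lie in \<open>W1\<close>. Strict inequalities make the set open.\<close>
    define V where "V = {z \<in> topspace Z. (\<rho> z < 1/3 \<or> 1/4 < nrm n (F z) \<or> 2/3 < \<rho> z) \<and> (\<rho> z < 2/3 \<or> z \<in> W1)}"
    have V: "openin Z V"
    proof -
      have "V = ({z \<in> topspace Z. \<rho> z \<in> {..<1/3}} \<union> {z \<in> topspace Z. nrm n (F z) \<in> {1/4<..}} \<union> {z \<in> topspace Z. \<rho> z \<in> {2/3<..}})
          \<inter> ({z \<in> topspace Z. \<rho> z \<in> {..<2/3}} \<union> W1)"
        using openin_subset[OF W1(1)] by (auto simp: V_def)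
      then show ?thesis
        using openin_continuous_map_preimage[OF \<rho>, of "{..<1/3}"] openin_continuous_map_preimage[OF \<rho>, of "{..<2/3}"]
          openin_continuous_map_preimage[OF \<rho>, of "{2/3<..}"] openin_continuous_map_preimage[OF nF, of "{1/4<..}"] W1(1)
        by auto
    qed
    have AV: "A \<subseteq> V"
    proof
      fix z assume z: "z \<in> A"
      have "z \<in> A2 \<or> 2/3 < \<rho> z" "\<rho> z < 1/3 \<or> z \<in> A1" using z by (auto simp: A2_def A1_def)
      then show "z \<in> V" using nFA2[of z] z AZ W1(2) by (auto simp: V_def)
    qed
    have V1: "z \<in> topspace Z" "1/4 \<le> nrm n (F z)" if "z \<in> V" "1/3 \<le> \<rho> z" "\<rho> z \<le> 2/3" for z
      using that unfolding V_def by simp_all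
    have V2: "z \<in> W1" if "z \<in> V" "2/3 \<le> \<rho> z" for z
      using that unfolding V_def by simp
    \<comment> \<open>Both times run from 0 to 1, for \<open>d\<close> while \<open>\<rho>\<close>
      goes from 1/3 to 1/2 and for \<open>\<Gamma>\<close> while it goes from 1/2 to 2/3. At 1/2 the
      two formulas meet in \<open>h1\<close>.\<close>
    define E where "E z = (if \<rho> z \<le> 1/3 then \<Phi> (F z) else if \<rho> z \<le> 1/2 then d (clamp01 (6 * \<rho> z - 2), \<Phi> (F z))
        else if \<rho> z \<le> 2/3 then \<Gamma> (clamp01 (6 * \<rho> z - 3), z) else G z)" for z
    have E: "continuous_map (subtopology Z V) ?Kt E"
      unfolding E_def
    proof (intro continuous_map_cases_le)
      show "continuous_map (subtopology (subtopology Z V) {x \<in> topspace (subtopology Z V). \<rho> x \<le> 1/3}) ?Kt (\<lambda>z. \<Phi> (F z))"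
        by (intro continuous_map_from_subtopology \<Phi>F)
    next
      let ?Y = "subtopology (subtopology (subtopology Z V) {x \<in> topspace (subtopology Z V). 1/3 \<le> \<rho> x})
       {x \<in> topspace (subtopology (subtopology Z V) {x \<in> topspace (subtopology Z V). 1/3 \<le> \<rho> x}). \<rho> x \<le> 1/2}"
      show "continuous_map ?Y ?Kt (\<lambda>z. d (clamp01 (6 * \<rho> z - 2), \<Phi> (F z)))"
      proof (rule contdh)
        show "1/4 \<le> rad (\<Phi> (F z))" if "z \<in> topspace ?Y" for z
        proof -
          have "z \<in> V" "1/3 \<le> \<rho> z" "\<rho> z \<le> 1/2" using that by simp_all
          then show ?thesis using \<Phi>FM[of z] V1[of z] by simp
        qed
      qed (intro continuous_intros continuous_map_from_subtopology \<rho> \<Phi>F)+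
    next
      let ?Y = "subtopology (subtopology (subtopology (subtopology Z V) {x \<in> topspace (subtopology Z V). 1/3 \<le> \<rho> x})
       {x \<in> topspace (subtopology (subtopology Z V) {x \<in> topspace (subtopology Z V). 1/3 \<le> \<rho> x}). 1/2 \<le> \<rho> x})
       {x \<in> topspace (subtopology (subtopology (subtopology Z V) {x \<in> topspace (subtopology Z V). 1/3 \<le> \<rho> x})
       {x \<in> topspace (subtopology (subtopology Z V) {x \<in> topspace (subtopology Z V). 1/3 \<le> \<rho> x}). 1/2 \<le> \<rho> x}). \<rho> x \<le> 2/3}"
      show "continuous_map ?Y ?Kt (\<lambda>z. \<Gamma> (clamp01 (6 * \<rho> z - 3), z))"
      proof (rule cont\<Gamma>)
        show "z \<in> A1 \<union> N" if "z \<in> topspace ?Y" for z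
        proof -
          have "z \<in> V" "1/2 \<le> \<rho> z" "\<rho> z \<le> 2/3" using that by simp_all
          then show ?thesis using V1[of z] by (simp add: N_def)
        qed
      qed (intro continuous_intros continuous_map_from_subtopology \<rho> continuous_map_id[unfolded id_def])+
    next
      let ?Y = "subtopology (subtopology (subtopology (subtopology Z V) {x \<in> topspace (subtopology Z V). 1/3 \<le> \<rho> x})
       {x \<in> topspace (subtopology (subtopology Z V) {x \<in> topspace (subtopology Z V). 1/3 \<le> \<rho> x}). 1/2 \<le> \<rho> x})
       {x \<in> topspace (subtopology (subtopology (subtopology Z V) {x \<in> topspace (subtopology Z V). 1/3 \<le> \<rho> x})
       {x \<in> topspace (subtopology (subtopology Z V) {x \<in> topspace (subtopology Z V). 1/3 \<le> \<rho> x}). 1/2 \<le> \<rho> x}). 2/3 \<le> \<rho> x}"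
      have "continuous_map (subtopology Z W1) ?Kt G"
        using continuous_map_compose[OF G incl] by simp
      then show "continuous_map ?Y ?Kt G"
        unfolding subtopology_subtopology by (rule continuous_map_from_subtopology_mono) (use V2 in force)
    next
      show "\<Phi> (F z) = (if \<rho> z \<le> 1/2 then d (clamp01 (6 * \<rho> z - 2), \<Phi> (F z))
             else if \<rho> z \<le> 2/3 then \<Gamma> (clamp01 (6 * \<rho> z - 3), z) else G z)" if "\<rho> z = 1/3" for z
        unfolding that by (simp add: d0)
    next
      fix z assume z: "z \<in> topspace (subtopology (subtopology Z V) {x \<in> topspace (subtopology Z V). 1/3 \<le> \<rho> x})" "\<rho> z = 1/2"
      then have "z \<in> N" by (auto simp: V_def N_def)
      then show "d (clamp01 (6 * \<rho> z - 2), \<Phi> (F z)) = (if \<rho> z \<le> 2/3 then \<Gamma> (clamp01 (6 * \<rho> z - 3), z) else G z)"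
        unfolding z(2) using h1N by (simp add: \<Gamma>0)
    next
      show "\<Gamma> (clamp01 (6 * \<rho> z - 3), z) = G z" if "\<rho> z = 2/3" for z
        unfolding that by (simp add: \<Gamma>1)
    qed (intro continuous_map_from_subtopology \<rho> continuous_map_const[THEN iffD2]; simp)+
    \<comment> \<open>The total time that \<open>E\<close> has used, one unit for \<open>d\<close>
      and one for \<open>\<Gamma>\<close>; in the band it is \<open>6 * \<rho> z - 2\<close>.
      Scaling it by \<open>s\<close> runs the deformation from \<open>h\<close> to \<open>E\<close>;
      on \<open>A\<close> the map \<open>\<Phi> (F z)\<close> is \<open>h z\<close> as long as
      \<open>\<rho>\<close> is at most 2/3.\<close>
    define \<tau> where "\<tau> z = 2 * clamp01 (3 * \<rho> z - 1)" for z
    define P where "P = (\<lambda>(s, z). if \<rho> z \<le> 1/3 then h z else if s * \<tau> z \<le> 1 then d (clamp01 (s * \<tau> z), h z)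
        else \<Gamma> (clamp01 (s * \<tau> z - 1), z))"
    let ?X = "prod_topology \<I> (subtopology Z A)"
    have p1: "continuous_map ?X euclideanreal fst"
      using continuous_map_fst[of \<I> "subtopology Z A"] by (simp add: continuous_map_in_subtopology)
    have p2: "continuous_map ?X Z snd"
      using continuous_map_snd[of \<I> "subtopology Z A"] by (simp add: continuous_map_in_subtopology)
    have p\<rho>: "continuous_map ?X euclideanreal (\<lambda>x. \<rho> (snd x))"
      using continuous_map_compose[OF p2 \<rho>] by (simp add: o_def)
    have p\<tau>: "continuous_map ?X euclideanreal (\<lambda>x. fst x * \<tau> (snd x))"
    proof -
      have "continuous_map ?X euclideanreal (\<lambda>x. 3 * \<rho> (snd x) - 1)"
        by (intro continuous_intros p\<rho>)
      then have "continuous_map ?X euclideanreal (\<lambda>x. clamp01 (3 * \<rho> (snd x) - 1))"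
        using continuous_map_clamp01 continuous_map_in_subtopology by blast
      then show ?thesis unfolding \<tau>_def by (intro continuous_intros p1)
    qed
    have ph: "continuous_map ?X ?Kt (\<lambda>x. h (snd x))"
      using continuous_map_compose[OF continuous_map_snd h] by (simp add: o_def)
    have P: "continuous_map ?X ?Kt P"
      unfolding P_def case_prod_unfold
    proof (intro continuous_map_cases_le p\<rho> continuous_map_from_subtopology[OF ph])
      let ?Y = "subtopology (subtopology ?X {x \<in> topspace ?X. 1/3 \<le> \<rho> (snd x)})
         {x \<in> topspace (subtopology ?X {x \<in> topspace ?X. 1/3 \<le> \<rho> (snd x)}). fst x * \<tau> (snd x) \<le> 1}"
      show "continuous_map ?Y ?Kt (\<lambda>x. d (clamp01 (fst x * \<tau> (snd x)), h (snd x)))"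
      proof (rule contdh)
        show "1/4 \<le> rad (h (snd x))" if "x \<in> topspace ?Y" for x
          using that \<rho>h by auto
      qed (intro continuous_map_from_subtopology p\<tau> ph)+
    next
      let ?Y = "subtopology (subtopology ?X {x \<in> topspace ?X. 1/3 \<le> \<rho> (snd x)})
         {x \<in> topspace (subtopology ?X {x \<in> topspace ?X. 1/3 \<le> \<rho> (snd x)}). 1 \<le> fst x * \<tau> (snd x)}"
      show "continuous_map ?Y ?Kt (\<lambda>x. \<Gamma> (clamp01 (fst x * \<tau> (snd x) - 1), snd x))"
      proof (rule cont\<Gamma>)
        show "snd x \<in> A1 \<union> N" if "x \<in> topspace ?Y" for x
          using that by (auto simp: A1_def)
      qed (intro continuous_intros continuous_map_from_subtopology p\<tau> p2)+
    next
      show "h (snd x) = (if fst x * \<tau> (snd x) \<le> 1 then d (clamp01 (fst x * \<tau> (snd x)), h (snd x))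
            else \<Gamma> (clamp01 (fst x * \<tau> (snd x) - 1), snd x))" if "\<rho> (snd x) = 1/3" for x
        unfolding \<tau>_def that by (simp add: d0)
    next
      fix x assume x: "x \<in> topspace (subtopology ?X {x \<in> topspace ?X. 1/3 \<le> \<rho> (snd x)})" "fst x * \<tau> (snd x) = 1"
      then show "d (clamp01 (fst x * \<tau> (snd x)), h (snd x)) = \<Gamma> (clamp01 (fst x * \<tau> (snd x) - 1), snd x)"
        by (auto simp: \<Gamma>0 h1_def A1_def)
    qed (intro continuous_map_from_subtopology p\<tau> continuous_map_const[THEN iffD2]; simp)+
    have "homotopic (subtopology Z A) ?Kt h E"
    proof (rule homotopicI[OF P])
      show "P (0, z) = h z" for z by (simp add: P_def d0)
      fix z assume "z \<in> topspace (subtopology Z A)"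
      then have z: "z \<in> A" by auto
      have "\<rho> z \<in> {0..1}" using \<rho>01 z AZ by blast
      then have \<tau>: "1/3 \<le> \<rho> z \<Longrightarrow> \<rho> z \<le> 2/3 \<Longrightarrow> \<tau> z = 6 * \<rho> z - 2" "2/3 < \<rho> z \<Longrightarrow> \<tau> z = 2"
        by (auto simp: \<tau>_def clamp01_def)
      have "\<Phi> (F z) = h z" if "\<rho> z \<le> 2/3" using \<Phi>FA2[of z] z that by (auto simp: A2_def)
      then show "P (1, z) = E z"
        using \<tau> by (auto simp: P_def E_def \<Gamma>1)
    qed
    then have "homotopic (subtopology Z A) ?Kt E h" by (rule homotopic_with_symD)
    with V AV E show "\<exists>W H. openin Z W \<and> A \<subseteq> W \<and> continuous_map (subtopology Z W) ?Kt H \<and> homotopic (subtopology Z A) ?Kt H h"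
      by (intro exI[of _ V] exI[of _ E] conjI)
  qed
qed


section \<open>CW-complexes\<close>

lemma
  assumes "CW_decomposition L E"
  shows CW_Hausdorff: "Hausdorff_space L"
    and CW_cover: "(\<Union>n. \<Union>(E n)) = topspace L"
    and CW_disjnt: "d \<in> E m \<Longrightarrow> e \<in> E n \<Longrightarrow> (m, d) \<noteq> (n, e) \<Longrightarrow> disjnt d e"
    and CW_cell: "e \<in> E n \<Longrightarrow> \<exists>\<Phi>. characteristic_map L n e \<Phi> \<and>
        (\<exists>F. finite F \<and> F \<subseteq> (\<Union>k<n. E k) \<and> \<Phi> ` unit_sphere n \<subseteq> \<Union>F)"
    and CW_weak: "S \<subseteq> topspace L \<Longrightarrow> (\<And>n e. e \<in> E n \<Longrightarrow> closedin L (S \<inter> L closure_of e)) \<Longrightarrow> closedin L S"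
  using assms unfolding CW_decomposition_def by - (elim conjE; simp)+

lemma CW_cell_subset: "CW_decomposition L E \<Longrightarrow> e \<in> E n \<Longrightarrow> e \<subseteq> topspace L"
  using CW_cover by blast

definition cells_union :: "(nat \<times> 'c set) set \<Rightarrow> 'c set" where
  "cells_union \<K> = {x. \<exists>k d. (k, d) \<in> \<K> \<and> x \<in> d}"

definition cells_below :: "(nat \<times> 'c set) set \<Rightarrow> nat \<Rightarrow> 'c set" where
  "cells_below \<K> n = {x. \<exists>k d. (k, d) \<in> \<K> \<and> k < n \<and> x \<in> d}"

lemma cells_below_mono: "\<K> \<subseteq> \<K>' \<Longrightarrow> cells_below \<K> n \<subseteq> cells_below \<K>' n"
  by (auto simp: cells_below_def)

text \<open>Boundaries must be covered by lower cells of the same family, so the cells can be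
  attached one at a time in order of dimension.\<close>

definition finite_subcomplex :: "'c topology \<Rightarrow> (nat \<Rightarrow> 'c set set) \<Rightarrow> (nat \<times> 'c set) set \<Rightarrow> bool" where
  "finite_subcomplex L E \<K> \<longleftrightarrow> finite \<K> \<and>
     (\<forall>n e. (n, e) \<in> \<K> \<longrightarrow> e \<in> E n \<and>
        (\<exists>\<Phi>. characteristic_map L n e \<Phi> \<and> \<Phi> ` unit_sphere n \<subseteq> cells_below \<K> n))"

lemma finite_subcomplexD:
  assumes "finite_subcomplex L E \<K>" "(n, e) \<in> \<K>"
  obtains \<Phi> where "e \<in> E n" "characteristic_map L n e \<Phi>" "\<Phi> ` unit_sphere n \<subseteq> cells_below \<K> n"
  using assms unfolding finite_subcomplex_def by metis

lemma finite_subcomplexI: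
  assumes "finite \<K>" "\<And>n e. (n, e) \<in> \<K> \<Longrightarrow> e \<in> E n"
    and "\<And>n e. (n, e) \<in> \<K> \<Longrightarrow> \<exists>\<Phi>. characteristic_map L n e \<Phi> \<and> \<Phi> ` unit_sphere n \<subseteq> cells_below \<K> n"
  shows "finite_subcomplex L E \<K>"
  using assms unfolding finite_subcomplex_def by simp

lemma finite_subcomplex_Union:
  assumes "finite I" "\<And>i. i \<in> I \<Longrightarrow> finite_subcomplex L E (\<K> i)"
  shows "finite_subcomplex L E (\<Union>i\<in>I. \<K> i)"
proof (rule finite_subcomplexI)
  show "finite (\<Union>i\<in>I. \<K> i)" using assms by (auto simp: finite_subcomplex_def)
  fix n e assume "(n, e) \<in> (\<Union>i\<in>I. \<K> i)"
  then obtain i where i: "i \<in> I" "(n, e) \<in> \<K> i" by blast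
  obtain \<Phi> where \<Phi>: "e \<in> E n" "characteristic_map L n e \<Phi>" "\<Phi> ` unit_sphere n \<subseteq> cells_below (\<K> i) n"
    using finite_subcomplexD[OF assms(2)[OF i(1)] i(2)] .
  have "cells_below (\<K> i) n \<subseteq> cells_below (\<Union>i\<in>I. \<K> i) n"
    using i(1) by (intro cells_below_mono) blast
  with \<Phi> show "e \<in> E n" "\<exists>\<Phi>. characteristic_map L n e \<Phi> \<and> \<Phi> ` unit_sphere n \<subseteq> cells_below (\<Union>i\<in>I. \<K> i) n"
    by (simp, intro exI[of _ \<Phi>] conjI, simp_all)
qed

text \<open>Closure finiteness, iterated: the boundary is covered by finitely many cells of lower
  dimension, each in a finite subcomplex by strong induction on \<open>n\<close>. Adding the cell to
  the union of these gives the required family.\<close>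

lemma cell_in_finite_subcomplex:
  assumes E: "CW_decomposition L E" and "e \<in> E n"
  shows "\<exists>\<K>. finite_subcomplex L E \<K> \<and> (n, e) \<in> \<K>"
  using assms(2)
proof (induction n arbitrary: e rule: less_induct)
  case (less n)
  obtain \<Phi> F where \<Phi>: "characteristic_map L n e \<Phi>" and F: "finite F" "F \<subseteq> (\<Union>k<n. E k)" "\<Phi> ` unit_sphere n \<subseteq> \<Union>F"
    using CW_cell[OF E less.prems] by blast
  have "\<exists>k \<K>. k < n \<and> finite_subcomplex L E \<K> \<and> (k, d) \<in> \<K>" if d: "d \<in> F" for d
  proof -
    obtain k where "k < n" "d \<in> E k" using subsetD[OF F(2) d] by auto
    with less.IH[OF this] show ?thesis by auto
  qed
  then obtain k \<K> where k: "\<And>d. d \<in> F \<Longrightarrow> k d < n" and \<K>: "\<And>d. d \<in> F \<Longrightarrow> finite_subcomplex L E (\<K> d)"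
    "\<And>d. d \<in> F \<Longrightarrow> (k d, d) \<in> \<K> d"
    by metis
  let ?U = "\<Union>d\<in>F. \<K> d"
  have U: "finite_subcomplex L E ?U" by (rule finite_subcomplex_Union[OF F(1) \<K>(1)])
  have "\<Union>F \<subseteq> cells_below (insert (n, e) ?U) n"
  proof
    fix x assume "x \<in> \<Union>F"
    then obtain d where d: "d \<in> F" "x \<in> d" by blast
    then have "(k d, d) \<in> insert (n, e) ?U" using \<K>(2)[OF d(1)] by blast
    then show "x \<in> cells_below (insert (n, e) ?U) n"
      using k[OF d(1)] d(2) unfolding cells_below_def mem_Collect_eq by (intro exI conjI)
  qed
  then have \<Phi>F: "\<Phi> ` unit_sphere n \<subseteq> cells_below (insert (n, e) ?U) n" using F(3) by simp
  have "finite_subcomplex L E (insert (n, e) ?U)"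
  proof (rule finite_subcomplexI)
    show "finite (insert (n, e) ?U)" using U by (simp add: finite_subcomplex_def)
    fix m c assume "(m, c) \<in> insert (n, e) ?U"
    then consider "m = n" "c = e" | "(m, c) \<in> ?U" by blast
    then have "c \<in> E m \<and> (\<exists>\<Phi>. characteristic_map L m c \<Phi> \<and> \<Phi> ` unit_sphere m \<subseteq> cells_below (insert (n, e) ?U) m)"
    proof cases
      case 1
      then show ?thesis using \<Phi> \<Phi>F less.prems by auto
    next
      case 2
      obtain \<Psi> where "c \<in> E m" "characteristic_map L m c \<Psi>" "\<Psi> ` unit_sphere m \<subseteq> cells_below ?U m"
        using finite_subcomplexD[OF U 2] .
      moreover have "cells_below ?U m \<subseteq> cells_below (insert (n, e) ?U) m" by (intro cells_below_mono) blast
      ultimately show ?thesis by (meson subset_trans)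
    qed
    then show "c \<in> E m" "\<exists>\<Phi>. characteristic_map L m c \<Phi> \<and> \<Phi> ` unit_sphere m \<subseteq> cells_below (insert (n, e) ?U) m"
      by simp_all
  qed
  then show ?case by blast
qed

lemma compactin_characteristic_image:
  assumes "characteristic_map L n e \<Phi>"
  shows "compactin L (\<Phi> ` unit_cball n)"
proof -
  have "compactin (cball_top n) (topspace (cball_top n))"
    using compact_cball[of n] by (simp only: compact_space_def)
  then have "compactin (cball_top n) (unit_cball n)" by (simp only: topspace_subtopology unit_cball_topspace)
  moreover have "continuous_map (cball_top n) L \<Phi>" using assms by (simp add: characteristic_map_def)
  ultimately show ?thesis by (rule image_compactin)
qed

lemma characteristic_image_cball:
  assumes "characteristic_map L n e \<Phi>" "e \<subseteq> topspace L"
  shows "\<Phi> ` unit_cball n = e \<union> \<Phi> ` unit_sphere n"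
proof -
  have "topspace (subtopology (Euclidean_space n) (unit_ball n)) = unit_ball n"
    by (auto simp: unit_ball_def)
  then have "\<Phi> ` unit_ball n = e"
    using assms homeomorphic_imp_surjective_map[of "subtopology (Euclidean_space n) (unit_ball n)" "subtopology L e" \<Phi>]
    by (simp add: characteristic_map_def Int_absorb1)
  then show ?thesis by (simp add: unit_cball_decomp image_Un)
qed

text \<open>Choosing one point of \<open>C\<close> in each cell that meets it gives a set all of whose subsets are closed,
  hence a set without accumulation point.\<close>

lemma finite_cells_meeting_compact:
  assumes E: "CW_decomposition L E" and C: "compactin L C"
  shows "finite {(n, e). e \<in> E n \<and> e \<inter> C \<noteq> {}}"
proof (rule ccontr)
  let ?M = "{(n, e). e \<in> E n \<and> e \<inter> C \<noteq> {}}"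
  assume inf: "infinite ?M"
  have "\<forall>q\<in>?M. \<exists>x. x \<in> snd q \<inter> C" by auto
  from bchoice[OF this] obtain p where "\<forall>q\<in>?M. p q \<in> snd q \<inter> C" ..
  then have p: "\<And>q. q \<in> ?M \<Longrightarrow> p q \<in> snd q \<inter> C" by (rule bspec)
  have inj: "q = r" if "q \<in> ?M" "r \<in> ?M" "p q \<in> snd r" for q r
  proof (rule ccontr)
    assume "q \<noteq> r"
    moreover have "snd q \<in> E (fst q)" "snd r \<in> E (fst r)" using that by auto
    ultimately have "disjnt (snd q) (snd r)" using CW_disjnt[OF E, of "snd q" "fst q" "snd r" "fst r"] by simp
    then show False using p[OF that(1)] that(3) unfolding disjnt_def by blast
  qed
  have "inj_on p ?M"
  proof (rule inj_onI)
    fix q r assume qr: "q \<in> ?M" "r \<in> ?M" "p q = p r"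
    then have "p q \<in> snd r" using p[OF qr(2)] by simp
    then show "q = r" using inj qr by blast
  qed
  then have infP: "infinite (p ` ?M)" using inf finite_imageD by blast
  have PC: "p ` ?M \<subseteq> C" using p by blast
  \<comment> \<open>A closed cell is covered by finitely many open cells, and \<open>S\<close> has
    at most one point in each; so the intersection is finite, hence closed, and the weak topology
    does the rest.\<close>
  have clo: "closedin L S" if S: "S \<subseteq> p ` ?M" for S
  proof (rule CW_weak[OF E])
    show SL: "S \<subseteq> topspace L" using S PC compactin_subset_topspace[OF C] by blast
    fix n e assume e: "e \<in> E n"
    obtain \<Phi> F where \<Phi>: "characteristic_map L n e \<Phi>" and F: "finite F" "F \<subseteq> (\<Union>k<n. E k)" "\<Phi> ` unit_sphere n \<subseteq> \<Union>F"
      using CW_cell[OF E e] by blast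
    have "closedin L (\<Phi> ` unit_cball n)"
      using compactin_characteristic_image[OF \<Phi>] CW_Hausdorff[OF E] by (simp add: compactin_imp_closedin)
    then have "L closure_of e \<subseteq> \<Phi> ` unit_cball n"
      using characteristic_image_cball[OF \<Phi> CW_cell_subset[OF E e]] by (intro closure_of_minimal) auto
    then have sub: "S \<inter> L closure_of e \<subseteq> (\<Union>d\<in>insert e F. S \<inter> d)"
      using F(3) characteristic_image_cball[OF \<Phi> CW_cell_subset[OF E e]] by auto
    have fin: "finite (S \<inter> d)" if d: "d \<in> E m" for d m
    proof (rule finite_subset)
      show "S \<inter> d \<subseteq> {p (m, d)}"
      proof
        fix x assume x: "x \<in> S \<inter> d"
        then obtain q where q: "q \<in> ?M" "x = p q" using S by blast
        then have "x \<in> d \<inter> C" using p x by auto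
        then have "(m, d) \<in> ?M" using d by auto
        from inj[OF q(1) this] q x show "x \<in> {p (m, d)}" by auto
      qed
    qed simp
    have "finite (S \<inter> d)" if "d \<in> insert e F" for d
      using that fin e F(2) by auto
    then have "finite (\<Union>d\<in>insert e F. S \<inter> d)" using F(1) by (intro finite_UN_I) auto
    then have "finite (S \<inter> L closure_of e)" using finite_subset[OF sub] by blast
    moreover have "S \<inter> L closure_of e \<subseteq> topspace L" using SL by blast
    ultimately show "closedin L (S \<inter> L closure_of e)"
      using CW_Hausdorff[OF E] Hausdorff_imp_t1_space t1_space_closedin_finite by metis
  qed
  obtain x where x: "x \<in> L derived_set_of (p ` ?M)"
    using compactin_imp_Bolzano_Weierstrass[OF C] infP PC by blast
  \<comment> \<open>The complement of this set is a neighbourhood of \<open>x\<close> that contains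
    no chosen point other than possibly \<open>x\<close> itself.\<close>
  have "closedin L (p ` ?M - {x})" using clo by blast
  then have "openin L (topspace L - (p ` ?M - {x}))" by blast
  moreover have "x \<in> topspace L - (p ` ?M - {x})" using x by (auto simp: derived_set_of_def)
  ultimately obtain y where "y \<noteq> x" "y \<in> p ` ?M" "y \<in> topspace L - (p ` ?M - {x})"
    using x unfolding derived_set_of_def mem_Collect_eq by meson
  then show False by blast
qed

text \<open>Removing a cell of maximal dimension leaves a subcomplex, since no boundary refers to
  that cell, and \<open>nbhd_ext_attach\<close> puts it back. Compactness is carried along because
  the attaching step asks for it.\<close>

lemma nbhd_ext_finite_subcomplex:
  fixes Z :: "'z topology"
  assumes Z: "compact_space Z" "Hausdorff_space Z" and E: "CW_decomposition L E"
    and "finite_subcomplex L E \<K>"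
  shows "compactin L (cells_union \<K>) \<and> nbhd_ext Z (subtopology L (cells_union \<K>))"
  using assms(4)
proof (induction "card \<K>" arbitrary: \<K>)
  case 0
  then have "\<K> = {}" by (simp add: finite_subcomplex_def)
  then have em: "cells_union \<K> = {}" by (simp add: cells_union_def)
  have "nbhd_ext Z (subtopology L {})"
    unfolding nbhd_ext_def
  proof (intro allI impI)
    fix A h assume A: "closedin Z A" "continuous_map (subtopology Z A) (subtopology L {}) h"
    then have "A = {}" using closedin_subset[OF A(1)] by (auto simp: continuous_map_def)
    then show "\<exists>W H. openin Z W \<and> A \<subseteq> W \<and> continuous_map (subtopology Z W) (subtopology L {}) H \<and>
       homotopic (subtopology Z A) (subtopology L {}) H h"
      using A by (intro exI[of _ "{}"] exI[of _ h]) simp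
  qed
  then show ?case by (simp add: em)
next
  case (Suc c)
  have fin: "finite \<K>" using Suc by (simp add: finite_subcomplex_def)
  have "\<K> \<noteq> {}" using Suc.hyps(2) by auto
  then have "Max (fst ` \<K>) \<in> fst ` \<K>" using fin by simp
  then obtain n e where ne: "(n, e) \<in> \<K>" and n: "n = Max (fst ` \<K>)" by force
  have mx: "m \<le> n" if "(m, d) \<in> \<K>" for m d
    unfolding n using that fin by (intro Max_ge) force+
  define \<K>' where "\<K>' = \<K> - {(n, e)}"
  \<comment> \<open>The removed cell has dimension \<open>n\<close>, whereas boundaries refer to
    dimensions strictly below \<open>m\<close>, and no \<open>m\<close> that occurs exceeds
    \<open>n\<close>.\<close>
  have sub: "cells_below \<K>' m = cells_below \<K> m" if "m \<le> n" for m
  proof -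
    have "(k, d) \<in> \<K>' \<and> k < m \<longleftrightarrow> (k, d) \<in> \<K> \<and> k < m" for k d
      using that by (auto simp: \<K>'_def)
    then show ?thesis unfolding cells_below_def by (metis (lifting))
  qed
  have "finite_subcomplex L E \<K>'"
  proof (rule finite_subcomplexI)
    show "finite \<K>'" using fin by (simp add: \<K>'_def)
    fix m d assume "(m, d) \<in> \<K>'"
    then have *: "(m, d) \<in> \<K>" by (simp add: \<K>'_def)
    obtain \<Psi> where "d \<in> E m" "characteristic_map L m d \<Psi>" "\<Psi> ` unit_sphere m \<subseteq> cells_below \<K> m"
      using finite_subcomplexD[OF Suc.prems *] .
    then show "d \<in> E m"
      "\<exists>\<Phi>. characteristic_map L m d \<Phi> \<and> \<Phi> ` unit_sphere m \<subseteq> cells_below \<K>' m"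
      unfolding sub[OF mx[OF *]] by auto
  qed
  moreover have "c = card \<K>'" using Suc.hyps(2) fin ne by (simp add: \<K>'_def)
  ultimately have IH: "compactin L (cells_union \<K>')" "nbhd_ext Z (subtopology L (cells_union \<K>'))"
    using Suc.hyps(1) by blast+
  obtain \<Phi> where eE: "e \<in> E n" and \<Phi>: "characteristic_map L n e \<Phi>" "\<Phi> ` unit_sphere n \<subseteq> cells_below \<K> n"
    using finite_subcomplexD[OF Suc.prems ne] .
  have "cells_below \<K>' n \<subseteq> cells_union \<K>'" by (auto simp: cells_below_def cells_union_def)
  then have bd: "\<Phi> ` unit_sphere n \<subseteq> cells_union \<K>'" using \<Phi>(2) sub[of n] by simp
  have eL: "e \<subseteq> topspace L" by (rule CW_cell_subset[OF E eE])
  have "disjnt e d" if "(m, d) \<in> \<K>'" for m d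
  proof (rule CW_disjnt[OF E eE])
    have "(m, d) \<in> \<K>" using that by (simp add: \<K>'_def)
    then show "d \<in> E m" using finite_subcomplexD[OF Suc.prems] by blast
    show "(n, e) \<noteq> (m, d)" using that by (auto simp: \<K>'_def)
  qed
  then have dj: "disjnt e (cells_union \<K>')" by (force simp: disjnt_def cells_union_def)
  have U: "cells_union \<K> = cells_union \<K>' \<union> e" using ne by (auto simp: \<K>'_def cells_union_def)
  have "nbhd_ext Z (subtopology L (cells_union \<K>' \<union> e))"
    by (rule nbhd_ext_attach[OF Z CW_Hausdorff[OF E] IH eL dj \<Phi>(1) bd])
  moreover have "cells_union \<K>' \<union> e = cells_union \<K>' \<union> \<Phi> ` unit_cball n"
    using characteristic_image_cball[OF \<Phi>(1) eL] bd by blast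
  then have "compactin L (cells_union \<K>' \<union> e)"
    using compactin_Un[OF IH(1) compactin_characteristic_image[OF \<Phi>(1)]] by simp
  ultimately show ?case unfolding U by blast
qed

theorem CW_complex_nbhd_ext:
  fixes Z :: "'z topology"
  assumes Z: "compact_space Z" "Hausdorff_space Z" and L: "CW_complex L"
  shows "nbhd_ext Z L"
  unfolding nbhd_ext_def
proof (intro allI impI)
  fix A h assume A: "closedin Z A" and h: "continuous_map (subtopology Z A) L h"
  obtain E where E: "CW_decomposition L E" using L by (auto simp: CW_complex_def)
  have AZ: "A \<subseteq> topspace Z" using A closedin_subset by blast
  have "compactin (subtopology Z A) A"
    using A Z by (simp add: closedin_compact_space compactin_subtopology)
  then have hA: "compactin L (h ` A)" using h image_compactin by blast
  let ?M = "{(n, e). e \<in> E n \<and> e \<inter> h ` A \<noteq> {}}"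
  have "\<forall>q\<in>?M. \<exists>\<K>. finite_subcomplex L E \<K> \<and> q \<in> \<K>"
    using cell_in_finite_subcomplex[OF E] by auto
  from bchoice[OF this] obtain \<K> where "\<forall>q\<in>?M. finite_subcomplex L E (\<K> q) \<and> q \<in> \<K> q" ..
  then have \<K>: "\<And>q. q \<in> ?M \<Longrightarrow> finite_subcomplex L E (\<K> q)" "\<And>q. q \<in> ?M \<Longrightarrow> q \<in> \<K> q"
    by - (drule (1) bspec, erule conjE, assumption)+
  define U where "U = cells_union (\<Union>q\<in>?M. \<K> q)"
  have ext: "nbhd_ext Z (subtopology L U)"
    unfolding U_def
    by (rule conjunct2[OF nbhd_ext_finite_subcomplex[OF Z E finite_subcomplex_Union]])
       (use finite_cells_meeting_compact[OF E hA] \<K>(1) in auto)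
  have "h ` A \<subseteq> U"
  proof
    fix y assume y: "y \<in> h ` A"
    then have "y \<in> topspace L" using hA compactin_subset_topspace by blast
    then obtain n e where e: "e \<in> E n" "y \<in> e" using CW_cover[OF E] by blast
    then have "(n, e) \<in> ?M" using y by blast
    with \<K>(2)[OF this] have "(n, e) \<in> (\<Union>q\<in>?M. \<K> q)" by blast
    then show "y \<in> U" using e(2) unfolding U_def cells_union_def by blast
  qed
  then have "continuous_map (subtopology Z A) (subtopology L U) h"
    using h AZ by (auto simp: continuous_map_in_subtopology)
  then obtain W H where W: "openin Z W" "A \<subseteq> W" "continuous_map (subtopology Z W) (subtopology L U) H"
    "homotopic (subtopology Z A) (subtopology L U) H h"
    using ext A unfolding nbhd_ext_def by meson
  have incl: "continuous_map (subtopology L U) L id" by (simp add: continuous_map_from_subtopology)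
  have "continuous_map (subtopology Z W) L H"
    using W(3) by (rule continuous_map_into_fulltopology)
  moreover have "homotopic (subtopology Z A) L H h"
    using homotopic_with_compose_continuous_map_left[OF W(4) incl, of "\<lambda>_. True"] by simp
  ultimately show "\<exists>W H. openin Z W \<and> A \<subseteq> W \<and> continuous_map (subtopology Z W) L H \<and> homotopic (subtopology Z A) L H h"
    using W(1,2) by (intro exI[of _ W] exI[of _ H] conjI)
qed

lemma CW_complex_nbhd_ext_cylinder:
  assumes "compact_space Z" "Hausdorff_space Z" "CW_complex L"
  shows "nbhd_ext (prod_topology \<I> Z) L"
  using assms
  by (intro CW_complex_nbhd_ext)
     (auto simp: compact_space_prod_topology Hausdorff_space_prod_topology compact_space_subtopology Hausdorff_space_subtopology)


section \<open>The cube of functionals on a compact space\<close>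

text \<open>A point of \<open>fcube X\<close> is a functional on the maps from \<open>X\<close> to the interval, and \<open>comb X I t p\<close> is
  the finitely supported measure with mass \<open>t i\<close> at \<open>p i\<close>, viewed as such a functional.\<close>

definition funs :: "'a topology \<Rightarrow> ('a \<Rightarrow> real) set" where
  "funs X = {\<phi>. continuous_map X \<I> \<phi>}"

definition fcube :: "'a topology \<Rightarrow> (('a \<Rightarrow> real) \<Rightarrow> real) topology" where
  "fcube X = product_topology (\<lambda>_. \<I>) (funs X)"

definition comb :: "'a topology \<Rightarrow> 'i set \<Rightarrow> ('i \<Rightarrow> real) \<Rightarrow> ('i \<Rightarrow> 'a) \<Rightarrow> ('a \<Rightarrow> real) \<Rightarrow> real" where
  "comb X I t p = (\<lambda>\<phi>\<in>funs X. \<Sum>i\<in>I. t i * \<phi> (p i))"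

lemma funs01: "\<phi> \<in> funs X \<Longrightarrow> x \<in> topspace X \<Longrightarrow> \<phi> x \<in> {0..1}"
  by (auto simp: funs_def continuous_map_def)

lemma compact_fcube: "compact_space (fcube X)"
  by (simp add: fcube_def compact_space_product_topology compact_space_subtopology)

lemma Hausdorff_fcube: "Hausdorff_space (fcube X)"
  by (simp add: fcube_def Hausdorff_space_product_topology Hausdorff_space_subtopology)

lemma topspace_fcube: "topspace (fcube X) = (\<Pi>\<^sub>E \<phi>\<in>funs X. {0..1})"
  by (simp add: fcube_def)

lemma compact_Hausdorff_prod_fcube:
  assumes "compact_space Y" "Hausdorff_space Y"
  shows "compact_space (prod_topology Y (fcube X))" "Hausdorff_space (prod_topology Y (fcube X))"
  using assms by (simp_all add: compact_space_prod_topology Hausdorff_space_prod_topology compact_fcube Hausdorff_fcube)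

lemma convex_sum_01:
  fixes a :: "'i \<Rightarrow> real"
  assumes "\<And>i. i \<in> I \<Longrightarrow> 0 \<le> t i" "(\<Sum>i\<in>I. t i) = 1" "\<And>i. i \<in> I \<Longrightarrow> t i \<noteq> 0 \<Longrightarrow> a i \<in> {0..1}"
  shows "(\<Sum>i\<in>I. t i * a i) \<in> {0..1}"
proof -
  have "0 \<le> t i * a i \<and> t i * a i \<le> t i" if "i \<in> I" for i
    using assms(1,3)[OF that] by (cases "t i = 0") (auto simp: mult_left_le)
  then have "0 \<le> (\<Sum>i\<in>I. t i * a i)" "(\<Sum>i\<in>I. t i * a i) \<le> (\<Sum>i\<in>I. t i)"
    by (auto intro: sum_nonneg sum_mono)
  then show ?thesis using assms(2) by simp
qed

lemma comb_in_fcube: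
  assumes "\<And>i. i \<in> I \<Longrightarrow> 0 \<le> t i" "(\<Sum>i\<in>I. t i) = 1" "\<And>i. i \<in> I \<Longrightarrow> t i \<noteq> 0 \<Longrightarrow> p i \<in> topspace X"
  shows "comb X I t p \<in> topspace (fcube X)"
  unfolding topspace_fcube comb_def
proof (rule restrict_PiE_iff[THEN iffD2], intro ballI)
  fix \<phi> assume "\<phi> \<in> funs X"
  then show "(\<Sum>i\<in>I. t i * \<phi> (p i)) \<in> {0..1}"
    using assms funs01[of \<phi> X] by (intro convex_sum_01) auto
qed

text \<open>Indices of weight zero are unrestricted, because base points attached to a partition of
  unity are controlled only where their weight is nonzero. The bound stays strict since some weight
  is positive.\<close>

lemma convex_sum_close:
  fixes a b :: "'i \<Rightarrow> real"
  assumes I: "finite I" "\<And>i. i \<in> I \<Longrightarrow> 0 \<le> t i" "(\<Sum>i\<in>I. t i) = 1"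
    and ab: "\<And>i. i \<in> I \<Longrightarrow> t i \<noteq> 0 \<Longrightarrow> \<bar>a i - b i\<bar> < \<epsilon>"
  shows "\<bar>(\<Sum>i\<in>I. t i * a i) - (\<Sum>i\<in>I. t i * b i)\<bar> < \<epsilon>"
proof -
  have "\<bar>(\<Sum>i\<in>I. t i * a i) - (\<Sum>i\<in>I. t i * b i)\<bar> = \<bar>\<Sum>i\<in>I. t i * (a i - b i)\<bar>"
    by (simp add: sum_subtractf right_diff_distrib)
  also have "\<dots> \<le> (\<Sum>i\<in>I. t i * \<bar>a i - b i\<bar>)"
    using sum_abs[of "\<lambda>i. t i * (a i - b i)" I] I(2) by (simp add: abs_mult)
  also have "\<dots> < (\<Sum>i\<in>I. t i * \<epsilon>)"
  proof (rule sum_strict_mono_ex1[OF I(1)])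
    show "\<forall>i\<in>I. t i * \<bar>a i - b i\<bar> \<le> t i * \<epsilon>"
      using I(2) ab by (metis less_eq_real_def mult_left_mono mult_zero_left)
    obtain j where "j \<in> I" "t j \<noteq> 0" using I(3) by (metis sum.neutral zero_neq_one)
    then show "\<exists>i\<in>I. t i * \<bar>a i - b i\<bar> < t i * \<epsilon>"
      using I(2)[of j] ab[of j] by (intro bexI[of _ j]) auto
  qed
  also have "\<dots> = \<epsilon>" using I(3) by (simp add: sum_distrib_right[symmetric])
  finally show ?thesis .
qed

lemma continuous_map_into_fcube:
  assumes "\<And>\<phi>. \<phi> \<in> funs X \<Longrightarrow> continuous_map T euclideanreal (\<lambda>z. g z \<phi>)"
    and "\<And>z. z \<in> topspace T \<Longrightarrow> g z \<in> topspace (fcube X)"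
  shows "continuous_map T (fcube X) g"
  unfolding fcube_def continuous_map_componentwise
proof (intro conjI ballI)
  show "g ` topspace T \<subseteq> extensional (funs X)"
    using assms(2) by (auto simp: topspace_fcube PiE_def)
  fix \<phi> assume "\<phi> \<in> funs X"
  then show "continuous_map T \<I> (\<lambda>z. g z \<phi>)"
    using assms by (auto simp: continuous_map_in_subtopology topspace_fcube PiE_def Pi_def)
qed

lemma continuous_map_fcube_eval:
  "\<phi> \<in> funs X \<Longrightarrow> continuous_map (fcube X) euclideanreal (\<lambda>u. u \<phi>)"
  unfolding fcube_def using continuous_map_product_projection[of \<phi> "funs X" "\<lambda>_. \<I>"]
  by (simp add: continuous_map_in_subtopology)

text \<open>A Lebesgue number argument: boxes of twice the radius fit into \<open>O1\<close>,
  finitely many boxes of the single radius cover \<open>C\<close>, and the triangle inequality makes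
  one choice of \<open>F\<close> and \<open>\<epsilon>\<close> work for all of
  \<open>C\<close>.\<close>

lemma fcube_box:
  assumes C: "compactin (fcube X) C" and O1: "openin (fcube X) O1" "C \<subseteq> O1"
  obtains F \<epsilon> where "finite F" "F \<subseteq> funs X" "\<epsilon> > (0::real)"
    "\<And>c u. c \<in> C \<Longrightarrow> u \<in> topspace (fcube X) \<Longrightarrow> (\<And>\<phi>. \<phi> \<in> F \<Longrightarrow> \<bar>u \<phi> - c \<phi>\<bar> < \<epsilon>) \<Longrightarrow> u \<in> O1"
proof -
  define box where "box c F \<epsilon> = {u \<in> topspace (fcube X). \<forall>\<phi>\<in>F. \<bar>u \<phi> - c \<phi>\<bar> < \<epsilon>}"
    for c :: "('a \<Rightarrow> real) \<Rightarrow> real" and F and \<epsilon> :: real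
  have obox: "openin (fcube X) (box c F \<epsilon>)" if F: "finite F" "F \<subseteq> funs X" for c F \<epsilon>
  proof -
    have "openin (fcube X) {u \<in> topspace (fcube X). u \<phi> \<in> {c \<phi> - \<epsilon><..<c \<phi> + \<epsilon>}}" if "\<phi> \<in> F" for \<phi>
      by (rule openin_continuous_map_preimage[OF continuous_map_fcube_eval]) (use F that in auto)
    then have "openin (fcube X) (topspace (fcube X) \<inter> (\<Inter>\<phi>\<in>F. {u \<in> topspace (fcube X). u \<phi> \<in> {c \<phi> - \<epsilon><..<c \<phi> + \<epsilon>}}))"
      using F(1) by (cases "F = {}") (auto intro!: openin_Int openin_INT2)
    moreover have "box c F \<epsilon> = topspace (fcube X) \<inter> (\<Inter>\<phi>\<in>F. {u \<in> topspace (fcube X). u \<phi> \<in> {c \<phi> - \<epsilon><..<c \<phi> + \<epsilon>}})"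
      by (auto simp: box_def abs_less_iff algebra_simps)
    ultimately show ?thesis by simp
  qed
  have "\<exists>F \<epsilon>. finite F \<and> F \<subseteq> funs X \<and> \<epsilon> > 0 \<and> box c F (2 * \<epsilon>) \<subseteq> O1" if c: "c \<in> C" for c
  proof -
    obtain U where U: "finite {\<phi> \<in> funs X. U \<phi> \<noteq> topspace \<I>}" "\<And>\<phi>. \<phi> \<in> funs X \<Longrightarrow> openin \<I> (U \<phi>)"
      "c \<in> Pi\<^sub>E (funs X) U" "Pi\<^sub>E (funs X) U \<subseteq> O1"
      using O1(1)[unfolded fcube_def openin_product_topology_alt, rule_format, OF subsetD[OF O1(2) c]] by auto
    let ?F = "{\<phi> \<in> funs X. U \<phi> \<noteq> topspace \<I>}"
    have "\<exists>\<delta>>0. \<forall>s\<in>{0..1}. \<bar>s - c \<phi>\<bar> < \<delta> \<longrightarrow> s \<in> U \<phi>" if \<phi>: "\<phi> \<in> ?F" for \<phi>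
    proof -
      have "openin \<I> (U \<phi>)" "c \<phi> \<in> U \<phi>" using U \<phi> by auto
      then show ?thesis unfolding openin_euclidean_subtopology_iff by (auto simp: dist_real_def)
    qed
    then have "\<forall>\<phi>\<in>?F. \<exists>\<delta>>0. \<forall>s\<in>{0..1}. \<bar>s - c \<phi>\<bar> < \<delta> \<longrightarrow> s \<in> U \<phi>" ..
    from bchoice[OF this] obtain \<delta>
      where "\<forall>\<phi>\<in>?F. \<delta> \<phi> > 0 \<and> (\<forall>s\<in>{0..1}. \<bar>s - c \<phi>\<bar> < \<delta> \<phi> \<longrightarrow> s \<in> U \<phi>)" ..
    then have \<delta>: "\<And>\<phi>. \<phi> \<in> ?F \<Longrightarrow> \<delta> \<phi> > 0"
      "\<And>\<phi> s. \<phi> \<in> ?F \<Longrightarrow> s \<in> {0..1} \<Longrightarrow> \<bar>s - c \<phi>\<bar> < \<delta> \<phi> \<Longrightarrow> s \<in> U \<phi>"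
      by simp_all
    define \<epsilon> where "\<epsilon> = Min (insert 1 (\<delta> ` ?F)) / 2"
    have "\<epsilon> > 0" unfolding \<epsilon>_def using U(1) \<delta>(1) by (auto simp: Min_gr_iff)
    have \<epsilon>: "2 * \<epsilon> \<le> \<delta> \<phi>" if "\<phi> \<in> ?F" for \<phi> unfolding \<epsilon>_def using U(1) that by (auto intro!: Min_le)
    have "box c ?F (2 * \<epsilon>) \<subseteq> Pi\<^sub>E (funs X) U"
    proof
      fix u assume u: "u \<in> box c ?F (2 * \<epsilon>)"
      then have ut: "u \<in> (\<Pi>\<^sub>E \<phi>\<in>funs X. {0..1})" by (simp add: box_def topspace_fcube)
      show "u \<in> Pi\<^sub>E (funs X) U"
      proof (rule PiE_I)
        fix \<phi> assume \<phi>: "\<phi> \<in> funs X"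
        then have u01: "u \<phi> \<in> {0..1}" using ut by blast
        show "u \<phi> \<in> U \<phi>"
        proof (cases "\<phi> \<in> ?F")
          case True
          then have "\<bar>u \<phi> - c \<phi>\<bar> < \<delta> \<phi>" using u \<epsilon>[OF True] unfolding box_def by fastforce
          then show ?thesis using \<delta>(2)[OF True u01] by simp
        qed (use \<phi> u01 in simp)
      qed (use ut in \<open>auto simp: PiE_def extensional_def\<close>)
    qed
    then have "finite ?F \<and> ?F \<subseteq> funs X \<and> \<epsilon> > 0 \<and> box c ?F (2 * \<epsilon>) \<subseteq> O1"
      using U(1,4) \<open>\<epsilon> > 0\<close> by auto
    then show ?thesis by (intro exI)
  qed
  then have "\<forall>c\<in>C. \<exists>F \<epsilon>. finite F \<and> F \<subseteq> funs X \<and> \<epsilon> > 0 \<and> box c F (2 * \<epsilon>) \<subseteq> O1" ..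
  then obtain F where "\<forall>c\<in>C. \<exists>\<epsilon>. finite (F c) \<and> F c \<subseteq> funs X \<and> \<epsilon> > 0 \<and> box c (F c) (2 * \<epsilon>) \<subseteq> O1"
    unfolding bchoice_iff ..
  then obtain \<epsilon> where "\<forall>c\<in>C. finite (F c) \<and> F c \<subseteq> funs X \<and> \<epsilon> c > 0 \<and> box c (F c) (2 * \<epsilon> c) \<subseteq> O1"
    unfolding bchoice_iff ..
  then have F: "\<And>c. c \<in> C \<Longrightarrow> finite (F c) \<and> F c \<subseteq> funs X \<and> \<epsilon> c > 0 \<and> box c (F c) (2 * \<epsilon> c) \<subseteq> O1"
    by (rule bspec)
  have CX: "C \<subseteq> topspace (fcube X)" using C compactin_subset_topspace by blast
  let ?\<U> = "(\<lambda>c. box c (F c) (\<epsilon> c)) ` C"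
  have "\<exists>\<F>. finite \<F> \<and> \<F> \<subseteq> ?\<U> \<and> C \<subseteq> \<Union>\<F>"
  proof (rule compactinD[OF C])
    show "openin (fcube X) U" if "U \<in> ?\<U>" for U using that obox F by blast
    show "C \<subseteq> \<Union>?\<U>" using F CX by (force simp: box_def)
  qed
  then obtain D where D: "finite D" "D \<subseteq> C" "C \<subseteq> (\<Union>c\<in>D. box c (F c) (\<epsilon> c))"
    by (metis (no_types, lifting) finite_subset_image)
  \<comment> \<open>The inserted 1 keeps the minimum meaningful when \<open>D\<close> is
    empty.\<close>
  define \<epsilon>' where "\<epsilon>' = Min (insert 1 (\<epsilon> ` D))"
  show thesis
  proof (rule that[of "\<Union>c\<in>D. F c" \<epsilon>'])
    show "finite (\<Union>c\<in>D. F c)" using D F by auto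
    show "(\<Union>c\<in>D. F c) \<subseteq> funs X" using D(2) F by (intro UN_least) blast
    show "0 < \<epsilon>'" unfolding \<epsilon>'_def using D F by (subst Min_gr_iff) auto
    fix c u assume c: "c \<in> C" and u: "u \<in> topspace (fcube X)"
      and cu: "\<And>\<phi>. \<phi> \<in> (\<Union>c\<in>D. F c) \<Longrightarrow> \<bar>u \<phi> - c \<phi>\<bar> < \<epsilon>'"
    obtain d where d: "d \<in> D" "c \<in> box d (F d) (\<epsilon> d)" using D(3) c by blast
    have "\<epsilon>' \<le> \<epsilon> d" unfolding \<epsilon>'_def using D(1) d(1) by (auto intro: Min_le)
    have "\<bar>u \<phi> - d \<phi>\<bar> < 2 * \<epsilon> d" if "\<phi> \<in> F d" for \<phi>
    proof -
      have "\<bar>u \<phi> - c \<phi>\<bar> < \<epsilon>'" using cu that d(1) by blast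
      moreover have "\<bar>c \<phi> - d \<phi>\<bar> < \<epsilon> d" using d(2) that by (simp add: box_def)
      ultimately show ?thesis using \<open>\<epsilon>' \<le> \<epsilon> d\<close> by linarith
    qed
    then have "u \<in> box d (F d) (2 * \<epsilon> d)" using u by (simp add: box_def)
    then show "u \<in> O1" using F d(1) D(2) by blast
  qed
qed

definition funs_box :: "'a topology \<Rightarrow> ('a \<Rightarrow> real) set \<Rightarrow> real \<Rightarrow> 'a \<Rightarrow> 'a set" where
  "funs_box X F \<epsilon> s = {x \<in> topspace X. \<forall>\<phi>\<in>F. \<bar>\<phi> x - \<phi> s\<bar> < \<epsilon>}"

lemma openin_funs_box:
  assumes F: "finite F" "F \<subseteq> funs X"
  shows "openin X (funs_box X F \<epsilon> s)"
proof -
  have "openin X {x \<in> topspace X. \<phi> x \<in> {\<phi> s - \<epsilon><..<\<phi> s + \<epsilon>}}" if "\<phi> \<in> F" for \<phi>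
  proof (rule openin_continuous_map_preimage)
    show "continuous_map X euclideanreal \<phi>"
      using F that by (auto simp: funs_def continuous_map_in_subtopology)
  qed simp
  then have "openin X (topspace X \<inter> (\<Inter>\<phi>\<in>F. {x \<in> topspace X. \<phi> x \<in> {\<phi> s - \<epsilon><..<\<phi> s + \<epsilon>}}))"
    using F(1) by (cases "F = {}") (auto intro!: openin_Int openin_INT2)
  moreover have "funs_box X F \<epsilon> s = topspace X \<inter> (\<Inter>\<phi>\<in>F. {x \<in> topspace X. \<phi> x \<in> {\<phi> s - \<epsilon><..<\<phi> s + \<epsilon>}})"
    by (auto simp: funs_box_def abs_less_iff algebra_simps)
  ultimately show ?thesis by simp
qed

lemma separating_fun:
  assumes X: "compact_space X" "Hausdorff_space X" and U: "openin X U" "x \<in> U"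
  obtains \<theta> where "\<theta> \<in> funs X" "\<theta> x = 1" "\<And>z. z \<in> topspace X \<Longrightarrow> z \<notin> U \<Longrightarrow> \<theta> z = 0"
proof -
  have "x \<in> topspace X" using U openin_subset by blast
  then have "closedin X {x}" using X Hausdorff_imp_t1_space t1_space_closedin_singleton by metis
  moreover have "closedin X (topspace X - U)" using U(1) by blast
  moreover have "disjnt (topspace X - U) {x}" using U(2) by (simp add: disjnt_def)
  ultimately obtain \<theta> where "continuous_map X \<I> \<theta>" "\<theta> ` (topspace X - U) \<subseteq> {0}" "\<theta> ` {x} \<subseteq> {1}"
    using Urysohn_lemma[OF compact_Hausdorff_normal[OF X], of "topspace X - U" "{x}" 0 1] by auto
  then show thesis using that[of \<theta>] by (auto simp: funs_def)
qed

section \<open>Partitions of unity and star refinements\<close>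

lemma partition_of_unity:
  assumes Y: "compact_space Y" "Hausdorff_space Y"
    and V: "\<And>y. y \<in> topspace Y \<Longrightarrow> openin Y (V y)" "\<And>y. y \<in> topspace Y \<Longrightarrow> y \<in> V y"
  obtains T and l :: "'a \<Rightarrow> 'a \<Rightarrow> real" where "finite T" "T \<subseteq> topspace Y"
    "\<And>t. t \<in> T \<Longrightarrow> continuous_map Y euclideanreal (l t)" "\<And>t y. y \<in> topspace Y \<Longrightarrow> 0 \<le> l t y"
    "\<And>y. y \<in> topspace Y \<Longrightarrow> (\<Sum>t\<in>T. l t y) = 1"
    "\<And>t y. t \<in> T \<Longrightarrow> y \<in> topspace Y \<Longrightarrow> l t y \<noteq> 0 \<Longrightarrow> y \<in> V t"
proof -
  have "\<forall>y\<in>topspace Y. \<exists>\<theta>. \<theta> \<in> funs Y \<and> \<theta> y = 1 \<and> (\<forall>z\<in>topspace Y. z \<notin> V y \<longrightarrow> \<theta> z = 0)"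
    using separating_fun[OF Y V] by metis
  from bchoice[OF this] obtain \<theta> where
    "\<forall>y\<in>topspace Y. \<theta> y \<in> funs Y \<and> \<theta> y y = 1 \<and> (\<forall>z\<in>topspace Y. z \<notin> V y \<longrightarrow> \<theta> y z = (0::real))" ..
  then have \<theta>: "\<theta> y \<in> funs Y" "\<theta> y y = 1" "\<And>z. z \<in> topspace Y \<Longrightarrow> z \<notin> V y \<Longrightarrow> \<theta> y z = (0::real)"
    if "y \<in> topspace Y" for y
    using that by auto
  have \<theta>c: "continuous_map Y euclideanreal (\<theta> y)" if "y \<in> topspace Y" for y
    using \<theta>(1)[OF that] by (simp add: funs_def continuous_map_in_subtopology)
  have \<theta>0: "0 \<le> \<theta> t y" if "t \<in> topspace Y" "y \<in> topspace Y" for t y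
    using funs01[OF \<theta>(1)[OF that(1)] that(2)] by simp
  let ?\<U> = "(\<lambda>y. {z \<in> topspace Y. \<theta> y z \<in> {0<..}}) ` topspace Y"
  have "\<exists>\<F>. finite \<F> \<and> \<F> \<subseteq> ?\<U> \<and> topspace Y \<subseteq> \<Union>\<F>"
  proof (rule compactinD)
    show "compactin Y (topspace Y)" using Y by (simp add: compact_space_def)
    show "openin Y U" if "U \<in> ?\<U>" for U
      using that openin_continuous_map_preimage[OF \<theta>c, of _ "{0<..}"] by auto
    show "topspace Y \<subseteq> \<Union>?\<U>" using \<theta>(2) by force
  qed
  then obtain T where T: "finite T" "T \<subseteq> topspace Y" "topspace Y \<subseteq> (\<Union>y\<in>T. {z \<in> topspace Y. \<theta> y z \<in> {0<..}})"
    by (metis (no_types, lifting) finite_subset_image)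
  define s where "s z = (\<Sum>t\<in>T. \<theta> t z)" for z
  have s: "s z > 0" if z: "z \<in> topspace Y" for z
  proof -
    obtain t where "t \<in> T" "\<theta> t z > 0" using T(3) z by auto
    then show ?thesis unfolding s_def using T \<theta>0 z by (intro sum_pos2[of _ t]) auto
  qed
  have sc: "continuous_map Y euclideanreal s"
    unfolding s_def using T \<theta>c by (intro continuous_map_sum) auto
  \<comment> \<open>Vanishing outside \<open>T\<close> makes nonnegativity hold for every
    index.\<close>
  define l where "l t z = (if t \<in> T then \<theta> t z / s z else 0)" for t z
  show thesis
  proof (rule that[of T l])
    show "finite T" "T \<subseteq> topspace Y" by fact+
    show "continuous_map Y euclideanreal (l t)" if "t \<in> T" for t
    proof -
      have "s z \<noteq> 0" if "z \<in> topspace Y" for z using s[OF that] by simp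
      then have "continuous_map Y euclideanreal (\<lambda>z. \<theta> t z / s z)"
        using that T(2) by (intro continuous_map_real_divide \<theta>c sc) auto
      moreover have "l t = (\<lambda>z. \<theta> t z / s z)" using that by (simp add: l_def fun_eq_iff)
      ultimately show ?thesis by simp
    qed
    show "0 \<le> l t y" if "y \<in> topspace Y" for t y
      unfolding l_def using \<theta>0 s[OF that] that T by auto
    show "(\<Sum>t\<in>T. l t y) = 1" if "y \<in> topspace Y" for y
    proof -
      have "(\<Sum>t\<in>T. l t y) = (\<Sum>t\<in>T. \<theta> t y) / s y" by (simp add: l_def sum_divide_distrib)
      then show ?thesis using s[OF that] by (simp add: s_def)
    qed
    show "y \<in> V t" if "t \<in> T" "y \<in> topspace Y" "l t y \<noteq> 0" for t y
      using that \<theta>(3)[of t] T by (auto simp: l_def)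
  qed
qed

text \<open>The closed sets \<open>C t\<close>, where \<open>l t\<close> is at least the average
  \<open>1 / card T\<close>, cover \<open>Y\<close> and lie in \<open>W t\<close>. Each
  \<open>V y\<close> avoids every \<open>C t\<close> that does not contain \<open>y\<close>; so if
  \<open>V y\<close> meets \<open>C k\<close>, then \<open>y\<close> is in \<open>C k\<close> and
  \<open>V y\<close> lies in \<open>W k\<close>.\<close>

lemma star_refinement:
  assumes Y: "compact_space Y" "Hausdorff_space Y"
    and W: "\<And>y. y \<in> topspace Y \<Longrightarrow> openin Y (W y)" "\<And>y. y \<in> topspace Y \<Longrightarrow> y \<in> W y"
  obtains V where "\<And>y. y \<in> topspace Y \<Longrightarrow> openin Y (V y)" "\<And>y. y \<in> topspace Y \<Longrightarrow> y \<in> V y"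
    "\<And>z. z \<in> topspace Y \<Longrightarrow> \<exists>k\<in>topspace Y. z \<in> W k \<and> (\<forall>y\<in>topspace Y. z \<in> V y \<longrightarrow> V y \<subseteq> W k)"
proof -
  obtain T and l :: "'a \<Rightarrow> 'a \<Rightarrow> real" where T: "finite T" "T \<subseteq> topspace Y"
    and l: "\<And>t. t \<in> T \<Longrightarrow> continuous_map Y euclideanreal (l t)" "\<And>t y. y \<in> topspace Y \<Longrightarrow> 0 \<le> l t y"
    "\<And>y. y \<in> topspace Y \<Longrightarrow> (\<Sum>t\<in>T. l t y) = 1"
    "\<And>t y. t \<in> T \<Longrightarrow> y \<in> topspace Y \<Longrightarrow> l t y \<noteq> 0 \<Longrightarrow> y \<in> W t"
    using partition_of_unity[OF Y W] by metis
  define C where "C t = {z \<in> topspace Y. l t z \<in> {1 / card T..}}" for t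
  have C: "closedin Y (C t)" if "t \<in> T" for t
    unfolding C_def by (rule closedin_continuous_map_preimage[OF l(1)[OF that]]) simp
  have CW: "C t \<subseteq> W t" if "t \<in> T" for t
  proof
    fix z assume z: "z \<in> C t"
    have "0 < card T" using T that card_gt_0_iff by blast
    then have "0 < l t z" using z unfolding C_def by (auto intro: less_le_trans[of 0 "1 / card T"])
    then show "z \<in> W t" using l(4)[OF that] z by (auto simp: C_def)
  qed
  define V where "V y = topspace Y \<inter> (\<Inter>t\<in>T. if y \<in> C t then W t else topspace Y - C t)" for y
  show thesis
  proof (rule that[of V])
    show "openin Y (V y)" if "y \<in> topspace Y" for y
    proof (cases "T = {}")
      case False
      have "openin Y (if y \<in> C t then W t else topspace Y - C t)" if "t \<in> T" for t
        using that W(1) T C by auto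
      then show ?thesis unfolding V_def using T(1) False
        by (intro openin_Int openin_topspace openin_INT2) auto
    qed (simp add: V_def)
    show "y \<in> V y" if "y \<in> topspace Y" for y
      using that CW unfolding V_def by auto
    show "\<exists>k\<in>topspace Y. z \<in> W k \<and> (\<forall>y\<in>topspace Y. z \<in> V y \<longrightarrow> V y \<subseteq> W k)" if z: "z \<in> topspace Y" for z
    proof -
      have "\<exists>k\<in>T. 1 / card T \<le> l k z"
      proof (rule ccontr)
        assume "\<not> ?thesis"
        then have *: "\<And>k. k \<in> T \<Longrightarrow> l k z < 1 / card T" by auto
        have "T \<noteq> {}" using l(3)[OF z] by auto
        then have "(\<Sum>k\<in>T. l k z) < (\<Sum>k\<in>T. 1 / card T)" using * T(1) by (intro sum_strict_mono) auto
        then show False using l(3)[OF z] T(1) \<open>T \<noteq> {}\<close> by simp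
      qed
      then obtain k where k: "k \<in> T" "z \<in> C k" using z by (auto simp: C_def)
      have "V y \<subseteq> W k" if "z \<in> V y" for y
      proof -
        have "z \<in> (if y \<in> C k then W k else topspace Y - C k)"
          using that k(1) unfolding V_def by blast
        then have "y \<in> C k" using k(2) by (auto split: if_splits)
        then show ?thesis using k(1) unfolding V_def by auto
      qed
      then show ?thesis using k CW T(2) by (intro bexI[of _ k]) auto
    qed
  qed
qed


section \<open>Segments in the cube and the embedding of a compact space\<close>

definition seg :: "'a topology \<Rightarrow> real \<Rightarrow> (('a \<Rightarrow> real) \<Rightarrow> real) \<Rightarrow> (('a \<Rightarrow> real) \<Rightarrow> real) \<Rightarrow> ('a \<Rightarrow> real) \<Rightarrow> real" where
  "seg X r a b = (\<lambda>\<phi>\<in>funs X. (1 - r) * a \<phi> + r * b \<phi>)"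

lemma seg_in_fcube:
  assumes "a \<in> topspace (fcube X)" "b \<in> topspace (fcube X)" "r \<in> {0..1}"
  shows "seg X r a b \<in> topspace (fcube X)"
  unfolding topspace_fcube seg_def
proof (rule restrict_PiE_iff[THEN iffD2], intro ballI)
  fix \<phi> assume "\<phi> \<in> funs X"
  then have "a \<phi> \<in> {0..1}" "b \<phi> \<in> {0..1}" using assms by (auto simp: topspace_fcube)
  then show "(1 - r) * a \<phi> + r * b \<phi> \<in> {0..1}"
    using convexD_alt[of "{0..1::real}" "a \<phi>" "b \<phi>" r] assms(3) by auto
qed

lemma seg_0: "a \<in> topspace (fcube X) \<Longrightarrow> seg X 0 a b = a"
  and seg_1: "b \<in> topspace (fcube X) \<Longrightarrow> seg X 1 a b = b"
  by (auto simp: seg_def topspace_fcube PiE_def extensional_def fun_eq_iff)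

text \<open>The straight-line homotopy. \<open>O1\<close> need not be convex; it has to contain only
  the segments actually travelled.\<close>

lemma homotopic_segment:
  assumes u: "continuous_map T (fcube X) u" and w: "continuous_map T (fcube X) w"
    and H: "continuous_map (subtopology (fcube X) O1) L H"
    and seg: "\<And>z r. z \<in> topspace T \<Longrightarrow> r \<in> {0..1} \<Longrightarrow> seg X r (u z) (w z) \<in> O1"
  shows "homotopic T L (H \<circ> u) (H \<circ> w)"
proof -
  let ?P = "prod_topology \<I> T"
  have uw: "u z \<in> topspace (fcube X)" "w z \<in> topspace (fcube X)" if "z \<in> topspace T" for z
    using u w that by (auto simp: continuous_map_def)
  have p1: "continuous_map ?P euclideanreal fst"
    using continuous_map_fst[of \<I> T] by (simp add: continuous_map_in_subtopology)
  have p2: "continuous_map ?P euclideanreal (\<lambda>x. v (snd x) \<phi>)"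
    if "continuous_map T (fcube X) v" "\<phi> \<in> funs X" for v \<phi>
    using continuous_map_compose[OF continuous_map_compose[OF continuous_map_snd that(1)]
        continuous_map_fcube_eval[OF that(2)]] by (simp add: o_def)
  have c: "continuous_map ?P (fcube X) (\<lambda>x. seg X (fst x) (u (snd x)) (w (snd x)))"
  proof (rule continuous_map_into_fcube)
    show "continuous_map ?P euclideanreal (\<lambda>x. seg X (fst x) (u (snd x)) (w (snd x)) \<phi>)"
      if "\<phi> \<in> funs X" for \<phi>
      using that by (simp add: seg_def) (intro continuous_intros p1 p2 u w)
    show "seg X (fst x) (u (snd x)) (w (snd x)) \<in> topspace (fcube X)" if "x \<in> topspace ?P" for x
      using that by (intro seg_in_fcube uw) auto
  qed
  have "continuous_map ?P (subtopology (fcube X) O1) (\<lambda>x. seg X (fst x) (u (snd x)) (w (snd x)))"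
    using c seg by (auto simp: continuous_map_in_subtopology)
  from continuous_map_compose[OF this H] show ?thesis
    by (rule homotopicI) (simp_all add: seg_0 seg_1 uw)
qed

text \<open>The unit mass at \<open>x\<close>, in other words the canonical map of \<open>X\<close>
  into its Tychonoff cube.\<close>

definition point_eval :: "'a topology \<Rightarrow> 'a \<Rightarrow> ('a \<Rightarrow> real) \<Rightarrow> real" where
  "point_eval X x = (\<lambda>\<phi>\<in>funs X. \<phi> x)"

lemma point_eval_in_fcube: "x \<in> topspace X \<Longrightarrow> point_eval X x \<in> topspace (fcube X)"
  unfolding topspace_fcube point_eval_def restrict_PiE_iff by (intro ballI funs01)

lemma continuous_map_point_eval: "continuous_map X (fcube X) (point_eval X)"
proof (rule continuous_map_into_fcube)
  show "continuous_map X euclideanreal (\<lambda>z. point_eval X z \<phi>)" if "\<phi> \<in> funs X" for \<phi>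
    using that by (simp add: point_eval_def) (simp add: funs_def continuous_map_in_subtopology)
qed (rule point_eval_in_fcube)

lemma inj_point_eval:
  assumes "compact_space X" "Hausdorff_space X"
  shows "inj_on (point_eval X) (topspace X)"
proof (rule inj_onI, rule ccontr)
  fix x y assume xy: "x \<in> topspace X" "y \<in> topspace X" "point_eval X x = point_eval X y" "x \<noteq> y"
  then obtain U where U: "openin X U" "x \<in> U" "y \<notin> U"
    using assms(2) unfolding Hausdorff_space_def by (metis disjnt_iff)
  obtain \<theta> where "\<theta> \<in> funs X" "\<theta> x = 1" "\<theta> y = 0"
    using separating_fun[OF assms U(1,2)] xy(2) U(3) by metis
  then show False using fun_cong[OF xy(3), of \<theta>] by (simp add: point_eval_def)
qed

text \<open>\<open>X\<close> has no linear structure, so \<open>h\<close> is moved to the embedded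
  copy of \<open>A\<close> in the cube and extended there. Maps into the open set \<open>O1\<close>
  can then be compared by \<open>homotopic_segment\<close>.\<close>

lemma fcube_nbhd_ext:
  fixes X :: "'a topology"
  assumes X: "compact_space X" "Hausdorff_space X" and L: "CW_complex L"
    and A: "closedin X A" and h: "continuous_map (subtopology X A) L h"
  obtains O1 H where "openin (fcube X) O1" "point_eval X ` A \<subseteq> O1"
    "continuous_map (subtopology (fcube X) O1) L H" "homotopic (subtopology X A) L (H \<circ> point_eval X) h"
proof -
  let ?e = "point_eval X"
  have AX: "A \<subseteq> topspace X" using A closedin_subset by blast
  have cA: "compact_space (subtopology X A)"
    using A X by (simp add: closedin_compact_space compact_space_subtopology)
  have e: "continuous_map (subtopology X A) (fcube X) ?e"
    by (intro continuous_map_from_subtopology continuous_map_point_eval)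
  have "inj_on ?e A" using inj_point_eval[OF X] AX by (rule inj_on_subset)
  then have "continuous_map (subtopology X A) L ((h \<circ> inv_into A ?e) \<circ> ?e)"
    by (intro continuous_map_eq[OF h]) auto
  from continuous_map_on_compact_image[OF cA Hausdorff_fcube e this]
  have hi: "continuous_map (subtopology (fcube X) (?e ` A)) L (h \<circ> inv_into A ?e)"
    using AX by (simp add: Int_absorb1)
  have "compactin (fcube X) (?e ` topspace (subtopology X A))"
    using cA e image_compactin unfolding compact_space_def by blast
  then have "closedin (fcube X) (?e ` A)"
    using Hausdorff_fcube AX by (auto simp: Int_absorb1 intro: compactin_imp_closedin)
  with hi obtain O1 H where O1: "openin (fcube X) O1" "?e ` A \<subseteq> O1"
    "continuous_map (subtopology (fcube X) O1) L H"
    "homotopic (subtopology (fcube X) (?e ` A)) L H (h \<circ> inv_into A ?e)"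
    using CW_complex_nbhd_ext[OF compact_fcube[of X] Hausdorff_fcube[of X] L, unfolded nbhd_ext_def, rule_format, of "?e ` A" "h \<circ> inv_into A ?e"]
    by auto
  have "continuous_map (subtopology X A) (subtopology (fcube X) (?e ` A)) ?e"
    using e by (auto simp: continuous_map_in_subtopology)
  then have 1: "homotopic (subtopology X A) L (H \<circ> ?e) ((h \<circ> inv_into A ?e) \<circ> ?e)"
    by (rule homotopic_with_compose_continuous_map_right[OF O1(4)]) simp
  have "homotopic (subtopology X A) L (H \<circ> ?e) h"
    using \<open>inj_on ?e A\<close> by (intro homotopic_with_eq[OF 1]) auto
  then show thesis using that O1 by blast
qed

section \<open>Homeomorphic copies, finite closed unions, separation of fibres\<close>

lemma edim_le_homeomorphic_maps:
  assumes ir: "homeomorphic_maps Z' Z i r" and "edim_le Z' L"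
  shows "edim_le Z L"
  unfolding edim_le_def
proof (intro allI impI)
  fix A h assume A: "closedin Z A" and h: "continuous_map (subtopology Z A) L h"
  have i: "continuous_map Z' Z i" and r: "continuous_map Z Z' r" and ri: "\<And>y. y \<in> topspace Z \<Longrightarrow> i (r y) = y"
    using ir by (auto simp: homeomorphic_maps_def)
  let ?A = "{x \<in> topspace Z'. i x \<in> A}"
  have A': "closedin Z' ?A" using i A by (rule closedin_continuous_map_preimage)
  have "continuous_map (subtopology Z' ?A) (subtopology Z A) i"
    using i by (auto simp: continuous_map_in_subtopology continuous_map_from_subtopology)
  from continuous_map_compose[OF this h] A' obtain H where H: "continuous_map Z' L H"
    "homotopic (subtopology Z' ?A) L H (h \<circ> i)"
    using assms(2) unfolding edim_le_def by blast
  have "r y \<in> ?A" if "y \<in> topspace Z \<inter> A" for y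
    using that r ri by (auto simp: continuous_map_def)
  then have "continuous_map (subtopology Z A) (subtopology Z' ?A) r"
    using r by (auto simp: continuous_map_in_subtopology continuous_map_from_subtopology)
  then have 1: "homotopic (subtopology Z A) L (H \<circ> r) ((h \<circ> i) \<circ> r)"
    by (rule homotopic_with_compose_continuous_map_right[OF H(2)]) simp
  have "homotopic (subtopology Z A) L (H \<circ> r) h"
    by (rule homotopic_with_eq[OF 1]) (auto simp: ri)
  then show "\<exists>H. continuous_map Z L H \<and> homotopic (subtopology Z A) L H h"
    using continuous_map_compose[OF r H(1)] by blast
qed

text \<open>A closed subset of the union that misses \<open>B j\<close> lies in the union of the
  others, so the sum theorem applies. The case of no sets settles the empty space, where the later
  induction over the strata starts.\<close>

lemma edim_le_finite_union:
  fixes Z :: "'z topology"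
  assumes Z: "compact_space Z" "Hausdorff_space Z" and L: "CW_complex (L :: 'c topology)"
    and "finite I" and "\<And>i. i \<in> I \<Longrightarrow> closedin Z (B i)" "\<And>i. i \<in> I \<Longrightarrow> edim_le (subtopology Z (B i)) L"
  shows "edim_le (subtopology Z (\<Union>i\<in>I. B i)) L"
  using assms(4-)
proof (induction I rule: finite_induct)
  case empty
  show ?case
    unfolding edim_le_def
  proof (intro allI impI)
    fix A and h :: "'z \<Rightarrow> 'c"
    have "homotopic (subtopology (subtopology Z (\<Union>i\<in>{}. B i)) A) L h h"
      by (simp add: continuous_map_def openin_subtopology subtopology_subtopology)
    then show "\<exists>H. continuous_map (subtopology Z (\<Union>i\<in>{}. B i)) L H \<and>
        homotopic (subtopology (subtopology Z (\<Union>i\<in>{}. B i)) A) L H h"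
      by (intro exI[of _ h]) simp
  qed
next
  case (insert j I)
  let ?U = "\<Union>i\<in>I. B i"
  have U: "closedin Z ?U" using insert by (intro closedin_Union) auto
  have IH: "edim_le (subtopology Z ?U) L" using insert by auto
  have BjZ: "closedin Z (B j)" using insert by auto
  then have UZ: "closedin Z (B j \<union> ?U)" using U by blast
  let ?Z = "subtopology Z (B j \<union> ?U)"
  have ss: "subtopology ?Z S = subtopology Z S" if "S \<subseteq> B j \<union> ?U" for S
    using that by (simp add: subtopology_subtopology Int_absorb1)
  have cZ: "compact_space ?Z" "Hausdorff_space ?Z"
    using UZ Z by (simp_all add: closedin_compact_space compact_space_subtopology Hausdorff_space_subtopology)
  have "edim_le ?Z L"
  proof (rule edim_le_sum[OF cZ])
    show "nbhd_ext (prod_topology \<I> ?Z) L" by (rule CW_complex_nbhd_ext_cylinder[OF cZ L])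
    show "closedin ?Z (B j)" using BjZ by (simp add: closedin_closed_subtopology[OF UZ])
    show "edim_le (subtopology ?Z (B j)) L" using insert by (simp add: ss)
    fix C assume "closedin ?Z C" "C \<inter> B j = {}"
    then have C: "closedin Z C" "C \<subseteq> ?U" by (auto simp: closedin_closed_subtopology[OF UZ])
    then have "closedin (subtopology Z ?U) C" by (simp add: closedin_closed_subtopology[OF U])
    from edim_le_closed[OF IH this] show "edim_le (subtopology ?Z C) L"
      using C by (simp add: ss subtopology_subtopology Int_absorb1 le_supI2)
  qed
  then show ?case by simp
qed

lemma finite_Hausdorff_separation:
  assumes X: "Hausdorff_space X" and S: "finite S" "S \<subseteq> topspace X"
  obtains D where "\<And>s. s \<in> S \<Longrightarrow> openin X (D s)" "\<And>s. s \<in> S \<Longrightarrow> s \<in> D s"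
    "\<And>s s'. s \<in> S \<Longrightarrow> s' \<in> S \<Longrightarrow> s \<noteq> s' \<Longrightarrow> D s \<inter> D s' = {}"
proof -
  have "\<exists>U V. openin X U \<and> openin X V \<and> s \<in> U \<and> s' \<in> V \<and> U \<inter> V = {}" if "s \<in> S" "s' \<in> S" "s \<noteq> s'" for s s'
    using X S(2) that unfolding Hausdorff_space_def disjnt_def by (meson subsetD)
  then obtain U V where UV: "\<And>s s'. s \<in> S \<Longrightarrow> s' \<in> S \<Longrightarrow> s \<noteq> s' \<Longrightarrow>
      openin X (U s s') \<and> openin X (V s s') \<and> s \<in> U s s' \<and> s' \<in> V s s' \<and> U s s' \<inter> V s s' = {}"
    by metis
  \<comment> \<open>Each pair is separated once in either order. Intersecting with the sets from
    both orders makes any two of the \<open>D s\<close> disjoint although the choice of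
    \<open>U\<close> and \<open>V\<close> is not symmetric.\<close>
  define D where "D s = topspace X \<inter> (\<Inter>s'\<in>S - {s}. U s s' \<inter> V s' s)" for s
  show thesis
  proof (rule that[of D])
    show "openin X (D s)" if "s \<in> S" for s
    proof (cases "S - {s} = {}")
      case False
      show ?thesis unfolding D_def
        by (intro openin_Int openin_topspace openin_INT2) (use S UV that False in auto)
    next
      case True
      show ?thesis unfolding D_def True by simp
    qed
    show "s \<in> D s" if "s \<in> S" for s using that S UV by (auto simp: D_def)
    show "D s \<inter> D s' = {}" if "s \<in> S" "s' \<in> S" "s \<noteq> s'" for s s'
    proof -
      have "D s \<subseteq> U s s'" "D s' \<subseteq> V s s'" using that unfolding D_def by blast+
      then show ?thesis using UV[OF that] by blast
    qed
  qed
qed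

text \<open>Maps from compact to Hausdorff spaces are closed, so removing the image of the
  complement of \<open>U\<close> from \<open>Y\<close> leaves an open set.\<close>

lemma fibre_nbhd:
  assumes X: "compact_space X" and Y: "Hausdorff_space Y" and g: "continuous_map X Y g"
    and U: "openin X U" "{x \<in> topspace X. g x = y} \<subseteq> U" and y: "y \<in> topspace Y"
  obtains V where "openin Y V" "y \<in> V" "\<And>x. x \<in> topspace X \<Longrightarrow> g x \<in> V \<Longrightarrow> x \<in> U"
proof (rule that[of "topspace Y - g ` (topspace X - U)"])
  have "closed_map X Y g" using X Y g continuous_imp_closed_map by blast
  then have "closedin Y (g ` (topspace X - U))" using U(1) by (simp add: closed_map_def closedin_diff)
  then show "openin Y (topspace Y - g ` (topspace X - U))" by blast
qed (use U y in auto)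


section \<open>Maps with finite fibres\<close>

text \<open>Over a fine cover of \<open>Y\<close> the space \<open>X\<close> splits into finitely many small disjoint sheets, and a
  partition of unity moves each point of \<open>X\<close> inside the cube by little to an average of base points
  of sheets.  Together with \<open>g\<close> this is a map \<open>p\<close> from \<open>X\<close> into a finite union of graphs over \<open>Y\<close>, one
  for each choice of sheets, and \<open>h\<close> factors through \<open>p\<close> up to homotopy.\<close>

lemma edim_le_finite_fibres_surj:
  fixes X :: "'a topology" and Y :: "'b topology" and L :: "'c topology"
  assumes X: "compact_space X" "Hausdorff_space X" and Y: "compact_space Y" "Hausdorff_space Y"
    and L: "CW_complex L" and g: "continuous_map X Y g" and surj: "g ` topspace X = topspace Y"
    and fib: "\<And>y. y \<in> topspace Y \<Longrightarrow> finite {x \<in> topspace X. g x = y}"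
    and YL: "edim_le Y L"
  shows "edim_le X L"
  unfolding edim_le_def
proof (intro allI impI)
  fix A h assume A: "closedin X A" and h: "continuous_map (subtopology X A) L h"
  let ?e = "point_eval X" and ?P = "prod_topology Y (fcube X)"
  have AX: "A \<subseteq> topspace X" using A closedin_subset by blast
  have gY: "g x \<in> topspace Y" if "x \<in> topspace X" for x using surj that by blast
  note cP = compact_Hausdorff_prod_fcube[OF Y, of X]
  obtain O1 H where O1: "openin (fcube X) O1" "?e ` A \<subseteq> O1"
    and H: "continuous_map (subtopology (fcube X) O1) L H" and Hh: "homotopic (subtopology X A) L (H \<circ> ?e) h"
    using fcube_nbhd_ext[OF X L A h] .
  have "compactin (fcube X) (?e ` A)"
    using closedin_compact_space[OF X(1) A] continuous_map_point_eval image_compactin by blast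
  then obtain F \<epsilon> where F: "finite F" "F \<subseteq> funs X" and \<epsilon>: "\<epsilon> > (0::real)"
    and box: "\<And>c u. c \<in> ?e ` A \<Longrightarrow> u \<in> topspace (fcube X) \<Longrightarrow> (\<And>\<phi>. \<phi> \<in> F \<Longrightarrow> \<bar>u \<phi> - c \<phi>\<bar> < \<epsilon>) \<Longrightarrow> u \<in> O1"
    using fcube_box[OF _ O1] by metis
  define S where "S y = {x \<in> topspace X. g x = y}" for y
  have S: "finite (S y)" "S y \<subseteq> topspace X" "S y \<noteq> {}" if y: "y \<in> topspace Y" for y
  proof -
    have "y \<in> g ` topspace X" using y by (simp add: surj)
    then obtain x where "x \<in> topspace X" "g x = y" by blast
    then have "x \<in> S y" by (simp add: S_def)
    then show "S y \<noteq> {}" by (auto)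
    show "finite (S y)" using fib[OF y] unfolding S_def .
    show "S y \<subseteq> topspace X" unfolding S_def by blast
  qed
  define N where "N = funs_box X F \<epsilon>"
  have N: "openin X (N s)" for s unfolding N_def using F by (rule openin_funs_box)
  \<comment> \<open>Sheets around the points of one fibre: disjoint, small in the sense of
    \<open>N\<close>, and together covering everything over a neighbourhood \<open>V\<close> of
    \<open>y\<close>.\<close>
  have "\<exists>U V. (\<forall>s\<in>S y. openin X (U s) \<and> s \<in> U s \<and> U s \<subseteq> N s) \<and>
      (\<forall>s\<in>S y. \<forall>s'\<in>S y. s \<noteq> s' \<longrightarrow> U s \<inter> U s' = {}) \<and>
      openin Y V \<and> y \<in> V \<and> (\<forall>x\<in>topspace X. g x \<in> V \<longrightarrow> (\<exists>s\<in>S y. x \<in> U s))" if y: "y \<in> topspace Y" for y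
  proof -
    obtain D where D: "\<And>s. s \<in> S y \<Longrightarrow> openin X (D s)" "\<And>s. s \<in> S y \<Longrightarrow> s \<in> D s"
      "\<And>s s'. s \<in> S y \<Longrightarrow> s' \<in> S y \<Longrightarrow> s \<noteq> s' \<Longrightarrow> D s \<inter> D s' = {}"
      using finite_Hausdorff_separation[OF X(2) S(1,2)[OF y]] by metis
    define U where "U s = N s \<inter> D s" for s
    have U: "openin X (U s)" "s \<in> U s" "U s \<subseteq> N s" if "s \<in> S y" for s
      using D(1,2)[OF that] N[of s] S(2)[OF y] that \<epsilon> by (auto simp: U_def N_def funs_box_def)
    have oU: "openin X (\<Union>s\<in>S y. U s)" using U(1) by blast
    have fU: "{x \<in> topspace X. g x = y} \<subseteq> (\<Union>s\<in>S y. U s)" using U(2) by (auto simp: S_def)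
    obtain V where V: "openin Y V" "y \<in> V" "\<And>x. x \<in> topspace X \<Longrightarrow> g x \<in> V \<Longrightarrow> x \<in> (\<Union>s\<in>S y. U s)"
      using fibre_nbhd[OF X(1) Y(2) g oU fU y] by blast
    have 1: "\<forall>s\<in>S y. openin X (U s) \<and> s \<in> U s \<and> U s \<subseteq> N s" using U by simp
    have 2: "\<forall>s\<in>S y. \<forall>s'\<in>S y. s \<noteq> s' \<longrightarrow> U s \<inter> U s' = {}"
      using D(3) unfolding U_def by blast
    have "\<forall>x\<in>topspace X. g x \<in> V \<longrightarrow> (\<exists>s\<in>S y. x \<in> U s)" using V(3) by simp
    with 1 2 V(1,2) show ?thesis by (intro exI[of _ U] exI[of _ V] conjI)
  qed
  then have "\<forall>y\<in>topspace Y. \<exists>U V. (\<forall>s\<in>S y. openin X (U s) \<and> s \<in> U s \<and> U s \<subseteq> N s) \<and>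
      (\<forall>s\<in>S y. \<forall>s'\<in>S y. s \<noteq> s' \<longrightarrow> U s \<inter> U s' = {}) \<and>
      openin Y V \<and> y \<in> V \<and> (\<forall>x\<in>topspace X. g x \<in> V \<longrightarrow> (\<exists>s\<in>S y. x \<in> U s))" ..
  then obtain U V where UV: "\<forall>y\<in>topspace Y. (\<forall>s\<in>S y. openin X (U y s) \<and> s \<in> U y s \<and> U y s \<subseteq> N s) \<and>
      (\<forall>s\<in>S y. \<forall>s'\<in>S y. s \<noteq> s' \<longrightarrow> U y s \<inter> U y s' = {}) \<and>
      openin Y (V y) \<and> y \<in> V y \<and> (\<forall>x\<in>topspace X. g x \<in> V y \<longrightarrow> (\<exists>s\<in>S y. x \<in> U y s))"
    unfolding bchoice_iff by (elim exE)
  have U: "openin X (U y s)" "U y s \<subseteq> N s" if "y \<in> topspace Y" "s \<in> S y" for y s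
    using bspec[OF UV that(1)] that(2) by auto
  have Udj: "s = s'" if "y \<in> topspace Y" "s \<in> S y" "s' \<in> S y" "x \<in> U y s" "x \<in> U y s'" for y s s' x
    using bspec[OF UV that(1)] that by blast
  have V: "openin Y (V y)" "y \<in> V y" if "y \<in> topspace Y" for y
    using bspec[OF UV that] by auto
  have Vcov: "\<exists>s\<in>S y. x \<in> U y s" if "y \<in> topspace Y" "x \<in> topspace X" "g x \<in> V y" for y x
    using bspec[OF UV that(1)] that by auto
  obtain T and l :: "'b \<Rightarrow> 'b \<Rightarrow> real" where T: "finite T" "T \<subseteq> topspace Y"
    and l: "\<And>t. t \<in> T \<Longrightarrow> continuous_map Y euclideanreal (l t)" "\<And>t y. y \<in> topspace Y \<Longrightarrow> 0 \<le> l t y"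
    "\<And>y. y \<in> topspace Y \<Longrightarrow> (\<Sum>t\<in>T. l t y) = 1"
    "\<And>t y. t \<in> T \<Longrightarrow> y \<in> topspace Y \<Longrightarrow> l t y \<noteq> 0 \<Longrightarrow> y \<in> V t"
    using partition_of_unity[OF Y V] by metis
  have TY: "t \<in> topspace Y" if "t \<in> T" for t using T that by blast
  \<comment> \<open>For each \<open>t\<close> the whole weight \<open>l t (g x)\<close> goes to the
    base point \<open>s\<close> of the sheet that contains \<open>x\<close>.\<close>
  define \<kappa> where "\<kappa> = (\<lambda>(t, s) x. if x \<in> U t s then l t (g x) else 0)"
  define I where "I = Sigma T S"
  have finI: "finite I" unfolding I_def using T S by auto
  have lg: "continuous_map X euclideanreal (\<lambda>x. l t (g x))" if "t \<in> T" for t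
    using continuous_map_compose[OF g l(1)[OF that]] by (simp add: o_def)
  have \<kappa>c: "continuous_map X euclideanreal (\<kappa> i)" if "i \<in> I" for i
  proof -
    obtain t s where i: "i = (t, s)" "t \<in> T" "s \<in> S t" using \<open>i \<in> I\<close> unfolding I_def by (rule SigmaE)
    \<comment> \<open>Off the other sheets \<open>\<kappa> i\<close> is \<open>l t\<close> after
      \<open>g\<close>; off its own sheet it is 0. Disjointness of the sheets makes these two closed
      sets cover \<open>X\<close>. A point of both lies in no sheet, hence not over
      \<open>V t\<close>, so the two formulas agree there.\<close>
    let ?A = "topspace X - (\<Union>s'\<in>S t - {s}. U t s')" and ?B = "topspace X - U t s"
    have cl: "closedin X ?A" "closedin X ?B"
      using U(1)[OF TY[OF i(2)]] i(3) by (auto intro!: closedin_diff)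
    have outside: "l t (g x) = 0" if "x \<in> topspace X" "\<And>s'. s' \<in> S t \<Longrightarrow> x \<notin> U t s'" for x
      using Vcov[OF TY[OF i(2)] that(1)] l(4)[OF i(2) gY[OF that(1)]] that(2) by blast
    have "continuous_map (subtopology X (?A \<union> ?B)) euclideanreal (\<lambda>x. if x \<in> ?A then l t (g x) else 0)"
      by (rule continuous_map_union_closed[OF cl]) (use lg[OF i(2)] outside in \<open>auto intro: continuous_map_from_subtopology\<close>)
    moreover have "?A \<union> ?B = topspace X" using Udj[OF TY[OF i(2)]] i(3) by blast
    ultimately have "continuous_map X euclideanreal (\<lambda>x. if x \<in> ?A then l t (g x) else 0)" by simp
    then show ?thesis
    proof (rule continuous_map_eq)
      fix x assume x: "x \<in> topspace X"
      show "(if x \<in> ?A then l t (g x) else 0) = \<kappa> i x"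
      proof (cases "x \<in> U t s")
        case True
        then have "x \<in> ?A" using Udj[OF TY[OF i(2)]] i(3) x by blast
        then show ?thesis using True by (simp add: \<kappa>_def i)
      next
        case False
        then have "x \<in> ?A \<Longrightarrow> l t (g x) = 0" using outside[OF x] by blast
        then show ?thesis using False by (simp add: \<kappa>_def i)
      qed
    qed
  qed
  have \<kappa>0: "0 \<le> \<kappa> i x" if "x \<in> topspace X" for i x
    using l(2)[OF gY[OF that]] by (simp add: \<kappa>_def split: prod.split)
  have \<kappa>U: "x \<in> U t s" if "\<kappa> (t, s) x \<noteq> 0" for t s x
    using that by (auto simp: \<kappa>_def split: if_splits)
  \<comment> \<open>For fixed \<open>x\<close> at most one sheet counts for each \<open>t\<close>,
    so the sum over all sheets collapses to a sum along one choice \<open>c\<close>. This is what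
    places \<open>p x\<close> on one of finitely many graphs.\<close>
  have fibsum: "(\<Sum>i\<in>I. \<kappa> i x * a (snd i)) = (\<Sum>t\<in>T. l t (g x) * a (c t))"
    if x: "x \<in> topspace X" and c: "\<And>t. t \<in> T \<Longrightarrow> c t \<in> S t" "\<And>t. t \<in> T \<Longrightarrow> l t (g x) \<noteq> 0 \<Longrightarrow> x \<in> U t (c t)"
    for x c and a :: "'a \<Rightarrow> real"
  proof -
    have "(\<Sum>i\<in>I. \<kappa> i x * a (snd i)) = (\<Sum>t\<in>T. \<Sum>s\<in>S t. \<kappa> (t, s) x * a s)"
      unfolding I_def using T S by (subst sum.Sigma) (auto simp: case_prod_unfold)
    also have "\<dots> = (\<Sum>t\<in>T. l t (g x) * a (c t))"
    proof (rule sum.cong[OF refl])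
      fix t assume t: "t \<in> T"
      have "\<kappa> (t, s) x * a s = (if s = c t then l t (g x) * a (c t) else 0)" if s: "s \<in> S t" for s
      proof (cases "l t (g x) = 0")
        case False
        then have "x \<in> U t (c t)" using c t by blast
        then have "x \<in> U t s \<longleftrightarrow> s = c t" using Udj[OF TY[OF t] s c(1)[OF t]] by auto
        then show ?thesis by (auto simp: \<kappa>_def)
      qed (simp add: \<kappa>_def)
      then have "(\<Sum>s\<in>S t. \<kappa> (t, s) x * a s) = (\<Sum>s\<in>S t. if s = c t then l t (g x) * a (c t) else 0)"
        by (intro sum.cong) auto
      also have "\<dots> = l t (g x) * a (c t)" using S(1)[OF TY[OF t]] c(1)[OF t] by simp
      finally show "(\<Sum>s\<in>S t. \<kappa> (t, s) x * a s) = l t (g x) * a (c t)" .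
    qed
    finally show ?thesis .
  qed
  have choice: "\<exists>c\<in>PiE T S. \<forall>t\<in>T. l t (g x) \<noteq> 0 \<longrightarrow> x \<in> U t (c t)" if x: "x \<in> topspace X" for x
  proof -
    have "\<exists>s\<in>S t. l t (g x) \<noteq> 0 \<longrightarrow> x \<in> U t s" if t: "t \<in> T" for t
      using Vcov[OF TY[OF t] x] l(4)[OF t gY[OF x]] S(3)[OF TY[OF t]] by blast
    then obtain c where c: "\<And>t. t \<in> T \<Longrightarrow> c t \<in> S t \<and> (l t (g x) \<noteq> 0 \<longrightarrow> x \<in> U t (c t))" by metis
    then show ?thesis by (intro bexI[of _ "restrict c T"]) auto
  qed
  have sum1: "(\<Sum>i\<in>I. \<kappa> i x) = 1" if x: "x \<in> topspace X" for x
  proof -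
    obtain c where "c \<in> PiE T S" "\<forall>t\<in>T. l t (g x) \<noteq> 0 \<longrightarrow> x \<in> U t (c t)" using choice[OF x] by blast
    then have "(\<Sum>i\<in>I. \<kappa> i x * 1) = (\<Sum>t\<in>T. l t (g x) * 1)" by (intro fibsum[OF x]) auto
    then show ?thesis using l(3)[OF gY[OF x]] by simp
  qed
  have IX: "snd i \<in> topspace X" if "i \<in> I" for i
    using S(2)[OF TY, of "fst i"] that by (auto simp: I_def)
  define q where "q x = comb X I (\<lambda>i. \<kappa> i x) snd" for x
  define p where "p x = (g x, q x)" for x
  define u where "u c y = comb X T (\<lambda>t. l t y) c" for c y
  have q: "continuous_map X (fcube X) q"
  proof (rule continuous_map_into_fcube)
    show "continuous_map X euclideanreal (\<lambda>z. q z \<phi>)" if "\<phi> \<in> funs X" for \<phi>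
      using that finI \<kappa>c by (simp add: q_def comb_def) (intro continuous_map_sum continuous_map_real_mult_right)
    show "q x \<in> topspace (fcube X)" if "x \<in> topspace X" for x
      unfolding q_def using \<kappa>0[OF that] sum1[OF that] IX by (intro comb_in_fcube) auto
  qed
  have p: "continuous_map X ?P p"
    unfolding p_def using g q by (rule continuous_map_pairedI)
  have u: "continuous_map Y (fcube X) (u c)" if c: "c \<in> PiE T S" for c
  proof (rule continuous_map_into_fcube)
    show "continuous_map Y euclideanreal (\<lambda>z. u c z \<phi>)" if "\<phi> \<in> funs X" for \<phi>
      using that T l(1) by (simp add: u_def comb_def) (intro continuous_map_sum continuous_map_real_mult_right)
    show "u c y \<in> topspace (fcube X)" if "y \<in> topspace Y" for y
    proof -
      have "c t \<in> topspace X" if "t \<in> T" for t using c S(2)[OF TY[OF that]] that by blast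
      then show ?thesis unfolding u_def using l(2,3)[OF that] by (intro comb_in_fcube) auto
    qed
  qed
  \<comment> \<open>Each graph is a homeomorphic copy of \<open>Y\<close>, and there are only
    finitely many choices \<open>c\<close>, so the bound for \<open>Y\<close> passes to the union of
    the graphs.\<close>
  define G where "G c = (\<lambda>y. (y, u c y)) ` topspace Y" for c
  have gr: "continuous_map Y ?P (\<lambda>y. (y, u c y))" if "c \<in> PiE T S" for c
    using u[OF that] by (intro continuous_map_pairedI) auto
  have clG: "closedin ?P (G c)" if "c \<in> PiE T S" for c
  proof -
    have "compactin ?P (G c)" unfolding G_def using Y(1) gr[OF that] image_compactin unfolding compact_space_def by blast
    then show ?thesis using cP(2) by (simp add: compactin_imp_closedin)
  qed
  have GL: "edim_le (subtopology ?P (G c)) L" if "c \<in> PiE T S" for c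
  proof (rule edim_le_homeomorphic_maps[OF _ YL])
    show "homeomorphic_maps Y (subtopology ?P (G c)) (\<lambda>y. (y, u c y)) fst"
      unfolding homeomorphic_maps_def using gr[OF that]
      by (auto simp: continuous_map_in_subtopology G_def intro: continuous_map_from_subtopology continuous_map_fst)
  qed
  let ?Y' = "\<Union>c\<in>PiE T S. G c"
  have finc: "finite (PiE T S)" using T S TY by (intro finite_PiE) auto
  have Y': "edim_le (subtopology ?P ?Y') L"
    by (rule edim_le_finite_union[OF cP L finc clG GL])
  have clY': "closedin ?P ?Y'" using finc clG by (intro closedin_Union) auto
  have pY': "p x \<in> ?Y'" if x: "x \<in> topspace X" for x
  proof -
    obtain c where c: "c \<in> PiE T S" "\<forall>t\<in>T. l t (g x) \<noteq> 0 \<longrightarrow> x \<in> U t (c t)" using choice[OF x] by blast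
    have "q x = u c (g x)"
      unfolding q_def u_def comb_def using c by (intro restrict_ext fibsum[OF x]) auto
    then show ?thesis using c(1) gY[OF x] by (auto simp: p_def G_def)
  qed
  \<comment> \<open>A sheet that carries weight at \<open>a\<close> has its base point within
    \<open>\<epsilon>\<close> of \<open>a\<close> for every function in \<open>F\<close>; averaging,
    and then moving along the segment, keeps this bound.\<close>
  have qO: "seg X r (q a) (?e a) \<in> O1" if a: "a \<in> A" and r: "r \<in> {0..1}" for a r
  proof (rule box)
    have aX: "a \<in> topspace X" using a AX by blast
    show "?e a \<in> ?e ` A" using a by simp
    show "seg X r (q a) (?e a) \<in> topspace (fcube X)"
      using q aX by (intro seg_in_fcube r point_eval_in_fcube) (auto simp: continuous_map_def)
    fix \<phi> assume \<phi>: "\<phi> \<in> F"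
    then have \<phi>': "\<phi> \<in> funs X" using F by blast
    have "\<bar>(\<Sum>i\<in>I. \<kappa> i a * \<phi> (snd i)) - (\<Sum>i\<in>I. \<kappa> i a * \<phi> a)\<bar> < \<epsilon>"
    proof (rule convex_sum_close[OF finI \<kappa>0[OF aX] sum1[OF aX]])
      fix i assume i: "i \<in> I" "\<kappa> i a \<noteq> 0"
      then have "a \<in> U (fst i) (snd i)" using \<kappa>U[of "fst i" "snd i"] by simp
      then have "a \<in> N (snd i)" using U(2)[of "fst i" "snd i"] i(1) TY by (auto simp: I_def)
      then show "\<bar>\<phi> (snd i) - \<phi> a\<bar> < \<epsilon>" using \<phi> by (auto simp: N_def funs_box_def abs_minus_commute)
    qed
    moreover have "(\<Sum>i\<in>I. \<kappa> i a * \<phi> a) = \<phi> a" using sum1[OF aX] by (simp add: sum_distrib_right[symmetric])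
    ultimately have d: "\<bar>q a \<phi> - \<phi> a\<bar> < \<epsilon>" using \<phi>' by (simp add: q_def comb_def)
    have "seg X r (q a) (?e a) \<phi> - ?e a \<phi> = (1 - r) * (q a \<phi> - \<phi> a)"
      using \<phi>' by (simp add: seg_def point_eval_def algebra_simps)
    then have "\<bar>seg X r (q a) (?e a) \<phi> - ?e a \<phi>\<bar> \<le> \<bar>q a \<phi> - \<phi> a\<bar>"
      using r by (simp add: abs_mult mult_left_le_one_le)
    then show "\<bar>seg X r (q a) (?e a) \<phi> - ?e a \<phi>\<bar> < \<epsilon>" using d by linarith
  qed
  have qA: "q a \<in> O1" if "a \<in> A" for a
  proof -
    have "q a \<in> topspace (fcube X)" using q that AX by (auto simp: continuous_map_def)
    then show ?thesis using qO[OF that, of 0] by (simp add: seg_0)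
  qed
  have "compactin ?P (p ` A)" using closedin_compact_space[OF X(1) A] p image_compactin by blast
  then have "closedin ?P (p ` A)" using cP(2) by (simp add: compactin_imp_closedin)
  moreover have pAY': "p ` A \<subseteq> ?Y'" using pY' AX by blast
  ultimately have clA': "closedin (subtopology ?P ?Y') (p ` A)" using closedin_closed_subtopology[OF clY'] by blast
  have eqA': "subtopology (subtopology ?P ?Y') (p ` A) = subtopology ?P (p ` A)"
    using pAY' by (simp add: subtopology_subtopology Int_absorb1)
  \<comment> \<open>\<open>p\<close> may identify points of \<open>A\<close> at which
    \<open>h\<close> differs, so the map extended over the graphs is \<open>H\<close> after the
    projection; its composite with \<open>p\<close> is \<open>H\<close> after \<open>q\<close>,
    which is homotopic to \<open>h\<close>.\<close>
  have sO: "continuous_map (subtopology ?P (p ` A)) (subtopology (fcube X) O1) snd"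
    using qA by (auto simp: continuous_map_in_subtopology p_def intro: continuous_map_from_subtopology continuous_map_snd)
  from continuous_map_compose[OF this H]
  obtain K where K: "continuous_map (subtopology ?P ?Y') L K"
    "homotopic (subtopology ?P (p ` A)) L K (H \<circ> snd)"
    using Y' clA' unfolding edim_le_def eqA'[symmetric] by blast
  have p': "continuous_map X (subtopology ?P ?Y') p" using p pY' by (auto simp: continuous_map_in_subtopology)
  have pA: "continuous_map (subtopology X A) (subtopology ?P (p ` A)) p"
    using p by (auto simp: continuous_map_in_subtopology intro: continuous_map_from_subtopology)
  have 1: "homotopic (subtopology X A) L (K \<circ> p) ((H \<circ> snd) \<circ> p)"
    by (rule homotopic_with_compose_continuous_map_right[OF K(2) pA]) simp
  have "(H \<circ> snd) \<circ> p = H \<circ> q" by (auto simp: p_def)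
  moreover have 2: "homotopic (subtopology X A) L (H \<circ> q) (H \<circ> ?e)"
    by (rule homotopic_segment[OF _ _ H])
       (use qO q continuous_map_point_eval[of X] in \<open>auto intro: continuous_map_from_subtopology\<close>)
  ultimately have "homotopic (subtopology X A) L (K \<circ> p) h"
    using homotopic_with_trans[OF homotopic_with_trans[OF 1] Hh] by simp
  then show "\<exists>H. continuous_map X L H \<and> homotopic (subtopology X A) L H h"
    using continuous_map_compose[OF p' K(1)] by blast
qed

text \<open>The image is closed in \<open>Y\<close>, so \<open>edim_le_closed\<close> passes the
  bound for \<open>Y\<close> on to it.\<close>

lemma edim_le_finite_fibres:
  assumes X: "compact_space X" "Hausdorff_space X" and Y: "compact_space Y" "Hausdorff_space Y"
    and L: "CW_complex L" and g: "continuous_map X Y g"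
    and fib: "\<And>y. y \<in> topspace Y \<Longrightarrow> finite {x \<in> topspace X. g x = y}"
    and YL: "edim_le Y L"
  shows "edim_le X L"
proof -
  let ?Y = "subtopology Y (g ` topspace X)"
  have "compactin Y (g ` topspace X)" using X(1) g image_compactin unfolding compact_space_def by blast
  then have cl: "closedin Y (g ` topspace X)" using Y(2) by (simp add: compactin_imp_closedin)
  have gt: "g ` topspace X \<subseteq> topspace Y" using cl closedin_subset by blast
  show ?thesis
  proof (rule edim_le_finite_fibres_surj[OF X _ _ L])
    show "compact_space ?Y" "Hausdorff_space ?Y"
      using cl Y by (simp_all add: closedin_compact_space compact_space_subtopology Hausdorff_space_subtopology)
    show "continuous_map X ?Y g" using g by (auto simp: continuous_map_in_subtopology)
    show "g ` topspace X = topspace ?Y" using gt by auto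
    show "edim_le ?Y L" using YL cl by (rule edim_le_closed)
  qed (use fib in auto)
qed


section \<open>The simplices spanned by the fibres\<close>

text \<open>The union of the skeleta of dimension \<open>k - 1\<close> of the simplices spanned by
  the fibres. Weights may vanish and \<open>card S\<close> is only bounded, so that limits in which
  atoms merge or disappear stay inside.\<close>

definition fibre_simplices :: "'a topology \<Rightarrow> 'b topology \<Rightarrow> ('a \<Rightarrow> 'b) \<Rightarrow> nat \<Rightarrow> ('b \<times> (('a \<Rightarrow> real) \<Rightarrow> real)) set" where
  "fibre_simplices X Y f k = {(y, comb X S t id) |y S t.
     y \<in> topspace Y \<and> finite S \<and> card S \<le> k \<and> S \<subseteq> {x \<in> topspace X. f x = y} \<and>
     (\<forall>x\<in>S. 0 \<le> t x) \<and> (\<Sum>x\<in>S. t x) = 1}"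

lemma comb_cong:
  assumes "I = I'" "\<And>i. i \<in> I' \<Longrightarrow> t i = t' i" "\<And>i. i \<in> I' \<Longrightarrow> p i = p' i"
  shows "comb X I t p = comb X I' t' p'"
  unfolding comb_def using assms by (intro restrict_ext sum.cong) auto

text \<open>The weights of coinciding points are added up, so a measure may be listed with many
  repetitions; only the number of distinct points is bounded by \<open>k\<close>.\<close>

lemma fibre_simplicesI:
  fixes X :: "'a topology"
  assumes y: "y \<in> topspace Y" and J: "finite J" "card (p ` J) \<le> k"
    and t: "\<And>i. i \<in> J \<Longrightarrow> 0 \<le> t i" "(\<Sum>i\<in>J. t i) = 1" and p: "\<And>i. i \<in> J \<Longrightarrow> p i \<in> topspace X \<and> f (p i) = y"
  shows "(y, comb X J t p) \<in> fibre_simplices X Y f k"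
proof -
  define t' where "t' x = (\<Sum>i\<in>{i \<in> J. p i = x}. t i)" for x
  have "comb X J t p = comb X (p ` J) t' id"
    unfolding comb_def
  proof (rule restrict_ext)
    fix \<phi> :: "'a \<Rightarrow> real"
    have "(\<Sum>i\<in>J. t i * \<phi> (p i)) = (\<Sum>x\<in>p ` J. \<Sum>i\<in>{i \<in> J. p i = x}. t i * \<phi> (p i))"
      using J(1) by (rule sum.image_gen)
    also have "\<dots> = (\<Sum>x\<in>p ` J. t' x * \<phi> (id x))"
      by (intro sum.cong refl) (simp add: t'_def sum_distrib_right)
    finally show "(\<Sum>i\<in>J. t i * \<phi> (p i)) = (\<Sum>x\<in>p ` J. t' x * \<phi> (id x))" .
  qed
  moreover have "(\<Sum>x\<in>p ` J. t' x) = 1"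
    unfolding t'_def using sum.image_gen[OF J(1), of t p] t(2) by simp
  moreover have "\<forall>x\<in>p ` J. 0 \<le> t' x" unfolding t'_def using t(1) by (auto intro: sum_nonneg)
  moreover have "p ` J \<subseteq> {x \<in> topspace X. f x = y}" using p by auto
  ultimately show ?thesis
    unfolding fibre_simplices_def using y J by blast
qed

lemma fibre_simplicesD:
  assumes "z \<in> fibre_simplices X Y f k"
  shows "\<exists>S t. fst z \<in> topspace Y \<and> snd z = comb X S t id \<and> finite S \<and> card S \<le> k \<and>
    S \<subseteq> {x \<in> topspace X. f x = fst z} \<and> (\<forall>x\<in>S. 0 \<le> t x) \<and> (\<Sum>x\<in>S. t x) = 1"
proof -
  obtain y S t where "z = (y, comb X S t id)" "y \<in> topspace Y" "finite S" "card S \<le> k"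
    "S \<subseteq> {x \<in> topspace X. f x = y}" "\<forall>x\<in>S. 0 \<le> t x" "(\<Sum>x\<in>S. t x) = 1"
    using assms unfolding fibre_simplices_def by blast
  then show ?thesis by (intro exI[of _ S] exI[of _ t]) simp
qed

lemma fibre_simplices_mono: "j \<le> k \<Longrightarrow> fibre_simplices X Y f j \<subseteq> fibre_simplices X Y f k"
  unfolding fibre_simplices_def by (force intro: order_trans)

lemma fibre_simplices_0: "fibre_simplices X Y f 0 = {}"
  unfolding fibre_simplices_def by auto

text \<open>The parameter space is compact: \<open>k\<close>-tuples of points in a common fibre
  together with weights of sum 1. The set is its continuous image in a Hausdorff space.\<close>

lemma closedin_fibre_simplices:
  assumes X: "compact_space X" and Y: "Hausdorff_space Y" and f: "continuous_map X Y f"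
  shows "closedin (prod_topology Y (fcube X)) (fibre_simplices X Y f k)"
proof (cases k)
  case 0 then show ?thesis by (simp add: fibre_simplices_0)
next
  case (Suc m)
  let ?J = "{..<k}" and ?P = "prod_topology Y (fcube X)"
  let ?Q = "prod_topology (product_topology (\<lambda>_. X) ?J) (product_topology (\<lambda>_. \<I>) ?J)"
  have k0: "0 \<in> ?J" using Suc by simp
  have c1: "continuous_map ?Q X (\<lambda>z. fst z i)" if "i \<in> ?J" for i
    using continuous_map_compose[OF continuous_map_fst continuous_map_product_projection[OF that]] by (simp add: o_def)
  have c2: "continuous_map ?Q euclideanreal (\<lambda>z. snd z i)" if "i \<in> ?J" for i
  proof -
    have "continuous_map ?Q \<I> (\<lambda>z. snd z i)"
      using continuous_map_compose[OF continuous_map_snd continuous_map_product_projection[OF that]] by (simp add: o_def)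
    then show ?thesis using continuous_map_in_subtopology by blast
  qed
  have cf: "continuous_map ?Q Y (\<lambda>z. f (fst z i))" if "i \<in> ?J" for i
    using continuous_map_compose[OF c1[OF that] f] by (simp add: o_def)
  \<comment> \<open>Index 0 serves as the reference for the common fibre, which is why
    \<open>k = 0\<close> is split off. Lying in a common fibre is a closed condition as
    \<open>Y\<close> is Hausdorff.\<close>
  define R where "R = topspace ?Q \<inter> (\<Inter>i\<in>?J. {z \<in> topspace ?Q. f (fst z i) = f (fst z 0)}) \<inter>
     {z \<in> topspace ?Q. (\<Sum>i\<in>?J. snd z i) \<in> {1}}"
  have "closedin ?Q R"
    unfolding R_def
  proof (intro closedin_Int closedin_INT closedin_topspace)
    show "closedin ?Q {z \<in> topspace ?Q. f (fst z i) = f (fst z 0)}" if "i \<in> ?J" for i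
      using closedin_continuous_maps_eq[OF Y cf[OF that] cf[OF k0]] .
    show "closedin ?Q {z \<in> topspace ?Q. (\<Sum>i\<in>?J. snd z i) \<in> {1}}"
      by (rule closedin_continuous_map_preimage[of _ euclideanreal]) (auto intro!: continuous_map_sum c2)
  qed (use k0 in auto)
  moreover have "compact_space ?Q"
    using X by (simp add: compact_space_prod_topology compact_space_product_topology compact_space_subtopology)
  ultimately have cR: "compactin ?Q R" by (simp add: closedin_compact_space)
  define m where "m z = (f (fst z 0), comb X ?J (snd z) (fst z))" for z
  have tR: "fst z i \<in> topspace X" "snd z i \<in> {0..1}" "f (fst z i) = f (fst z 0)" "(\<Sum>i\<in>?J. snd z i) = 1"
    if "z \<in> R" "i \<in> ?J" for z i
  proof -
    have z: "z \<in> topspace ?Q" "z \<in> (\<Inter>i\<in>?J. {z \<in> topspace ?Q. f (fst z i) = f (fst z 0)})"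
      "z \<in> {z \<in> topspace ?Q. (\<Sum>i\<in>?J. snd z i) \<in> {1}}"
      using that(1) unfolding R_def Int_iff by - (elim conjE, assumption)+
    have "fst z \<in> (\<Pi>\<^sub>E i\<in>?J. topspace X)" "snd z \<in> (\<Pi>\<^sub>E i\<in>?J. topspace \<I>)"
      using z(1) by (simp_all only: topspace_prod_topology topspace_product_topology mem_Times_iff)
    from PiE_mem[OF this(1) that(2)] PiE_mem[OF this(2) that(2)]
    show "fst z i \<in> topspace X" "snd z i \<in> {0..1}" by simp_all
    show "f (fst z i) = f (fst z 0)" using z(2) that(2) by (simp only: INT_iff mem_Collect_eq)
    show "(\<Sum>i\<in>?J. snd z i) = 1" using z(3) by simp
  qed
  have "continuous_map (subtopology ?Q R) ?P m"
    unfolding m_def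
  proof (rule continuous_map_pairedI)
    show "continuous_map (subtopology ?Q R) Y (\<lambda>z. f (fst z 0))"
      by (intro continuous_map_from_subtopology cf k0)
    show "continuous_map (subtopology ?Q R) (fcube X) (\<lambda>z. comb X ?J (snd z) (fst z))"
    proof (rule continuous_map_into_fcube)
      fix \<phi> assume \<phi>: "\<phi> \<in> funs X"
      have "continuous_map ?Q euclideanreal (\<lambda>z. \<phi> (fst z i))" if "i \<in> ?J" for i
        using continuous_map_compose[OF c1[OF that], of euclideanreal \<phi>] \<phi>
        by (simp add: o_def funs_def continuous_map_in_subtopology)
      then have "continuous_map ?Q euclideanreal (\<lambda>z. \<Sum>i\<in>?J. snd z i * \<phi> (fst z i))"
        by (intro continuous_map_sum continuous_map_real_mult c2) auto
      then show "continuous_map (subtopology ?Q R) euclideanreal (\<lambda>z. comb X ?J (snd z) (fst z) \<phi>)"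
        using \<phi> by (simp add: comb_def continuous_map_from_subtopology)
    next
      fix z assume "z \<in> topspace (subtopology ?Q R)"
      then have z: "z \<in> R" by simp
      show "comb X ?J (snd z) (fst z) \<in> topspace (fcube X)"
        using tR[OF z] k0 by (intro comb_in_fcube) auto
    qed
  qed
  moreover have "compactin (subtopology ?Q R) R" using cR by (simp add: compactin_subtopology)
  ultimately have "compactin ?P (m ` R)" using image_compactin by blast
  moreover have "m ` R = fibre_simplices X Y f k"
  proof (intro subset_antisym subsetI)
    fix w assume "w \<in> m ` R"
    then obtain z where z: "z \<in> R" "w = m z" by blast
    show "w \<in> fibre_simplices X Y f k"
      unfolding z(2) m_def
    proof (rule fibre_simplicesI)
      show "f (fst z 0) \<in> topspace Y" using f tR(1)[OF z(1) k0] by (auto simp: continuous_map_def)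
      show "card (fst z ` ?J) \<le> k" using card_image_le[of ?J "fst z"] by simp
      show "0 \<le> snd z i" if "i \<in> ?J" for i using tR(2)[OF z(1) that] by simp
      show "(\<Sum>i\<in>?J. snd z i) = 1" by (rule tR(4)[OF z(1) k0])
      show "fst z i \<in> topspace X \<and> f (fst z i) = f (fst z 0)" if "i \<in> ?J" for i
        using tR(1,3)[OF z(1) that] by simp
    qed simp
  next
    fix w assume wk: "w \<in> fibre_simplices X Y f k"
    obtain S t where w: "fst w \<in> topspace Y" "snd w = comb X S t id" and S: "finite S" "card S \<le> k"
      "S \<subseteq> {x \<in> topspace X. f x = fst w}" and t: "\<forall>x\<in>S. 0 \<le> t x" "(\<Sum>x\<in>S. t x) = 1"
      using fibre_simplicesD[OF wk] by (elim exE conjE)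
    obtain e where e: "bij_betw e {..<card S} S"
      using ex_bij_betw_nat_finite[OF S(1)] by (auto simp: atLeast0LessThan)
    have "S \<noteq> {}" using t(2) by auto
    then have cS: "0 < card S" using S(1) by (simp add: card_gt_0_iff)
    \<comment> \<open>A measure listed with fewer than \<open>k\<close> points is padded by
      repeating the point \<open>e 0\<close>, with weight 0.\<close>
    define x where "x = (\<lambda>i\<in>?J. e (if i < card S then i else 0))"
    define s where "s = (\<lambda>i\<in>?J. if i < card S then t (e i) else 0)"
    have eS: "e i \<in> S" if "i < card S" for i using e that by (auto simp: bij_betw_def)
    have xS: "x i \<in> S" if "i \<in> ?J" for i using that eS cS by (auto simp: x_def)
    have t1: "t x \<le> 1" if "x \<in> S" for x
      using member_le_sum[of x S t] S(1) t that by auto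
    have sums: "(\<Sum>i\<in>?J. s i * a (x i)) = (\<Sum>x\<in>S. t x * a x)" for a :: "'a \<Rightarrow> real"
    proof -
      have "(\<Sum>i\<in>?J. s i * a (x i)) = (\<Sum>i\<in>{..<card S}. s i * a (x i))"
        using S(2) by (intro sum.mono_neutral_right) (auto simp: s_def)
      also have "\<dots> = (\<Sum>i\<in>{..<card S}. t (e i) * a (e i))"
        using S(2) by (intro sum.cong) (auto simp: s_def x_def)
      also have "\<dots> = (\<Sum>x\<in>S. t x * a x)" by (rule sum.reindex_bij_betw[OF e])
      finally show ?thesis .
    qed
    have xf: "x i \<in> topspace X" "f (x i) = fst w" if i: "i \<in> ?J" for i using xS[OF i] S(3) by auto
    have s01: "s i \<in> {0..1}" if "i \<in> ?J" for i using that t(1) t1 eS by (auto simp: s_def)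
    have "x \<in> (\<Pi>\<^sub>E i\<in>?J. topspace X)" using xf(1) by (auto simp: x_def)
    moreover have "s \<in> (\<Pi>\<^sub>E i\<in>?J. {0..1})" using s01 by (auto simp: s_def)
    ultimately have "(x, s) \<in> R" using xf k0 sums[of "\<lambda>_. 1"] t(2) by (simp add: R_def)
    moreover have "m (x, s) = w"
      using w(2) xf(2)[OF k0] sums by (intro prod_eqI) (simp_all add: m_def comb_def)
    ultimately show "w \<in> m ` R" by force
  qed
  ultimately show ?thesis
    using Y by (metis Hausdorff_fcube Hausdorff_space_prod_topology compactin_imp_closedin)
qed


lemma funs_clamp:
  assumes "\<theta> \<in> funs X" shows "(\<lambda>x. clamp01 (a * \<theta> x - b)) \<in> funs X"
  unfolding funs_def mem_Collect_eq
proof (rule continuous_map_clamp01)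
  have "continuous_map X euclideanreal \<theta>" using assms by (simp add: funs_def continuous_map_in_subtopology)
  then show "continuous_map X euclideanreal (\<lambda>x. a * \<theta> x - b)" by (intro continuous_intros)
qed

lemma funs_mult:
  assumes "\<theta> \<in> funs X" "\<phi> \<in> funs X" shows "(\<lambda>x. \<theta> x * \<phi> x) \<in> funs X"
proof -
  have "continuous_map X euclideanreal (\<lambda>x. \<theta> x * \<phi> x)"
    using assms by (intro continuous_map_real_mult) (auto simp: funs_def continuous_map_in_subtopology)
  moreover have "\<theta> x * \<phi> x \<in> {0..1}" if "x \<in> topspace X" for x
    using funs01[OF assms(1) that] funs01[OF assms(2) that] by (auto simp: mult_le_one)
  ultimately show ?thesis by (auto simp: funs_def continuous_map_in_subtopology)
qed

text \<open>For a measure with one atom near each \<open>s\<close>, \<open>\<phi> s\<close> detects that atom and \<open>\<eta> s\<close> reads off its weight.\<close>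

lemma bump_pairs:
  assumes X: "compact_space X" "Hausdorff_space X" and S: "finite S" "S \<subseteq> topspace X"
  shows "\<exists>\<phi> \<eta> :: 'a \<Rightarrow> 'a \<Rightarrow> real. \<forall>s\<in>S. \<phi> s \<in> funs X \<and> \<eta> s \<in> funs X \<and> \<phi> s s = 1 \<and>
    (\<forall>x\<in>topspace X. \<phi> s x \<noteq> 0 \<longrightarrow> \<eta> s x = 1 \<and> (\<forall>s'\<in>S. s \<noteq> s' \<longrightarrow> \<eta> s' x = 0))"
proof -
  obtain D where D: "\<And>s. s \<in> S \<Longrightarrow> openin X (D s)" "\<And>s. s \<in> S \<Longrightarrow> s \<in> D s"
    "\<And>s s'. s \<in> S \<Longrightarrow> s' \<in> S \<Longrightarrow> s \<noteq> s' \<Longrightarrow> D s \<inter> D s' = {}"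
    using finite_Hausdorff_separation[OF X(2) S] by metis
  have "\<forall>s\<in>S. \<exists>\<theta>. \<theta> \<in> funs X \<and> \<theta> s = 1 \<and> (\<forall>z\<in>topspace X. z \<notin> D s \<longrightarrow> \<theta> z = 0)"
    using separating_fun[OF X D(1,2)] by metis
  from bchoice[OF this] obtain \<theta>
    where "\<forall>s\<in>S. \<theta> s \<in> funs X \<and> \<theta> s s = 1 \<and> (\<forall>z\<in>topspace X. z \<notin> D s \<longrightarrow> \<theta> s z = (0::real))" ..
  then have \<theta>: "\<theta> s \<in> funs X" "\<theta> s s = 1" "\<And>z. z \<in> topspace X \<Longrightarrow> z \<notin> D s \<Longrightarrow> \<theta> s z = (0::real)" if "s \<in> S" for s
    using that by auto
  have pos: "x \<in> D s \<and> 1/2 < \<theta> s x" if "s \<in> S" "x \<in> topspace X" "clamp01 (2 * \<theta> s x - 1) \<noteq> 0" for s x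
  proof -
    have "1/2 < \<theta> s x" using that(3) by (rule contrapos_np) (simp add: clamp01_def)
    then show ?thesis using \<theta>(3)[OF that(1,2)] by auto
  qed
  show ?thesis
  \<comment> \<open>Both functions come from one bump \<open>\<theta> s\<close>: the first is
    nonzero only where the bump exceeds 1/2, and there the second has already reached 1. The term
    \<open>- 0\<close> gives the second the form of \<open>funs_clamp\<close>.\<close>
  proof (rule exI[of _ "\<lambda>s x. clamp01 (2 * \<theta> s x - 1)"], rule exI[of _ "\<lambda>s x. clamp01 (2 * \<theta> s x - 0)"],
      intro ballI conjI impI)
    fix s assume s: "s \<in> S"
    show "(\<lambda>x. clamp01 (2 * \<theta> s x - 1)) \<in> funs X" by (rule funs_clamp[OF \<theta>(1)[OF s]])
    show "(\<lambda>x. clamp01 (2 * \<theta> s x - 0)) \<in> funs X" by (rule funs_clamp[OF \<theta>(1)[OF s]])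
    show "clamp01 (2 * \<theta> s s - 1) = 1" using \<theta>(2)[OF s] by simp
    fix x assume x: "x \<in> topspace X" "clamp01 (2 * \<theta> s x - 1) \<noteq> 0"
    show "clamp01 (2 * \<theta> s x - 0) = 1" using pos[OF s x] by (auto simp: clamp01_def)
    fix s' assume "s' \<in> S" "s \<noteq> s'"
    then have "x \<notin> D s'" using D(3)[OF s] pos[OF s x] by blast
    then show "clamp01 (2 * \<theta> s' x - 0) = 0" using \<theta>(3)[OF \<open>s' \<in> S\<close> x(1)] by simp
  qed
qed

text \<open>Near a measure with exactly \<open>k\<close> atoms every measure in \<open>fibre_simplices X Y f k\<close> has one atom
  near each of them.  The position of one atom and the weights of the other \<open>k - 1 \<le> n\<close> define a map
  to \<open>X \<times> I\<^sup>n\<close>; it has finite fibres because the remaining atoms lie in the same fibre of \<open>f\<close>.\<close>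

lemma edim_le_simplices_piece:
  fixes X :: "'a topology" and Y :: "'b topology" and L :: "'c topology"
  assumes X: "compact_space X" "Hausdorff_space X" and Y: "compact_space Y" "Hausdorff_space Y"
    and L: "CW_complex L" and f: "continuous_map X Y f"
    and fib: "\<And>y. y \<in> topspace Y \<Longrightarrow> finite {x \<in> topspace X. f x = y}"
    and XL: "edim_le (prod_topology X (cube n)) L" and k: "k \<le> n + 1"
    and z: "z \<in> fibre_simplices X Y f k" "z \<notin> fibre_simplices X Y f (k - 1)"
  obtains N O1 where "closedin (prod_topology Y (fcube X)) N" "openin (prod_topology Y (fcube X)) O1"
    "z \<in> O1" "O1 \<inter> fibre_simplices X Y f k \<subseteq> N" "edim_le (subtopology (prod_topology Y (fcube X)) N) L"
proof -
  let ?P = "prod_topology Y (fcube X)" and ?Z = "fibre_simplices X Y f k"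
  note cP = compact_Hausdorff_prod_fcube[OF Y, of X]
  have clZ: "closedin ?P ?Z" by (rule closedin_fibre_simplices[OF X(1) Y(2) f])
  obtain S t where zS: "fst z \<in> topspace Y" "snd z = comb X S t id" and S: "finite S" "card S \<le> k"
    "S \<subseteq> {x \<in> topspace X. f x = fst z}" and t: "\<forall>x\<in>S. 0 \<le> t x" "(\<Sum>x\<in>S. t x) = 1"
    using fibre_simplicesD[OF z(1)] by (elim exE conjE)
  have SX: "S \<subseteq> topspace X" using S(3) by blast
  \<comment> \<open>Fewer than \<open>k\<close> points of \<open>S\<close> cannot carry
    \<open>z\<close>. Applied to \<open>S\<close> itself this yields \<open>card S = k\<close>;
    applied to \<open>S\<close> without one point it yields positive weights.\<close>
  have notin: False if "card (id ` J) \<le> k - 1" "J \<subseteq> S" "(\<Sum>x\<in>J. t x) = 1" "comb X J t id = snd z" for J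
  proof -
    have "(fst z, comb X J t id) \<in> fibre_simplices X Y f (k - 1)"
      by (rule fibre_simplicesI[OF zS(1) finite_subset[OF that(2) S(1)] that(1) _ that(3)])
         (use that(2) S(3) t(1) in auto)
    then show False using z(2) that(4) by simp
  qed
  have cS: "card S = k"
  proof (rule ccontr)
    assume "card S \<noteq> k"
    then have "card (id ` S) \<le> k - 1" using S(2) by simp
    from notin[OF this subset_refl t(2) zS(2)[symmetric]] show False .
  qed
  have S0: "S \<noteq> {}" using t(2) by auto
  then have k0: "0 < k" using cS S(1) card_gt_0_iff[of S] by simp
  have tpos: "0 < t s" if s: "s \<in> S" for s
  proof (rule ccontr)
    assume "\<not> 0 < t s"
    then have t0: "t s = 0" using t(1) s by force
    show False
    proof (rule notin[of "S - {s}"])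
      show "card (id ` (S - {s})) \<le> k - 1" using s S(1) cS by simp
      show "(\<Sum>x\<in>S - {s}. t x) = 1" using t(2) sum.remove[OF S(1) s, of t] t0 by simp
      show "comb X (S - {s}) t id = snd z"
        unfolding zS(2) comb_def
      proof (rule restrict_ext)
        show "(\<Sum>i\<in>S - {s}. t i * \<psi> (id i)) = (\<Sum>i\<in>S. t i * \<psi> (id i))" for \<psi> :: "'a \<Rightarrow> real"
          using sum.remove[OF S(1) s, of "\<lambda>i. t i * \<psi> (id i)"] t0 by simp
      qed
    qed auto
  qed
  obtain \<phi> \<eta> :: "'a \<Rightarrow> 'a \<Rightarrow> real" where \<phi>: "\<And>s. s \<in> S \<Longrightarrow> \<phi> s \<in> funs X" and \<eta>: "\<And>s. s \<in> S \<Longrightarrow> \<eta> s \<in> funs X"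
    and \<phi>s: "\<And>s. s \<in> S \<Longrightarrow> \<phi> s s = 1"
    and \<eta>1: "\<And>s x. s \<in> S \<Longrightarrow> x \<in> topspace X \<Longrightarrow> \<phi> s x \<noteq> 0 \<Longrightarrow> \<eta> s x = 1"
    and \<eta>0: "\<And>s s' x. s \<in> S \<Longrightarrow> s' \<in> S \<Longrightarrow> s \<noteq> s' \<Longrightarrow> x \<in> topspace X \<Longrightarrow> \<phi> s x \<noteq> 0 \<Longrightarrow> \<eta> s' x = 0"
  proof -
    obtain \<phi> \<eta> :: "'a \<Rightarrow> 'a \<Rightarrow> real" where *: "\<forall>s\<in>S. \<phi> s \<in> funs X \<and> \<eta> s \<in> funs X \<and> \<phi> s s = 1 \<and>
        (\<forall>x\<in>topspace X. \<phi> s x \<noteq> 0 \<longrightarrow> \<eta> s x = 1 \<and> (\<forall>s'\<in>S. s \<noteq> s' \<longrightarrow> \<eta> s' x = 0))"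
      using bump_pairs[OF X S(1) SX] by (elim exE)
    show thesis by (rule that[of \<phi> \<eta>]) (use * in auto)
  qed
  have ev: "continuous_map ?P euclideanreal (\<lambda>w. snd w \<psi>)" if "\<psi> \<in> funs X" for \<psi>
    using continuous_map_compose[OF continuous_map_snd continuous_map_fcube_eval[OF that]] by (simp add: o_def)
  \<comment> \<open>The measure \<open>z\<close> takes the value \<open>t s\<close> at
    \<open>\<phi> s\<close>. Half of it leaves room for an open set around \<open>z\<close>, and
    being positive it still forces an atom near every \<open>s\<close>.\<close>
  define N where "N = ?Z \<inter> (\<Inter>s\<in>S. {w \<in> topspace ?P. snd w (\<phi> s) \<in> {t s / 2..}})"
  define O1 where "O1 = (\<Inter>s\<in>S. {w \<in> topspace ?P. snd w (\<phi> s) \<in> {t s / 2<..}})"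
  have clN: "closedin ?P N"
    unfolding N_def using S0 clZ \<phi>
    by (intro closedin_Int closedin_INT closedin_continuous_map_preimage[OF ev]) auto
  have opO: "openin ?P O1"
    unfolding O1_def using S0 S(1) \<phi>
    by (intro openin_INT2 openin_continuous_map_preimage[OF ev]) auto
  have ON: "O1 \<inter> ?Z \<subseteq> N" unfolding O1_def N_def by force
  have zP: "z \<in> topspace ?P" using z(1) clZ closedin_subset by blast
  have zO: "z \<in> O1"
    unfolding O1_def
  proof (intro INT_I CollectI conjI zP)
    fix s assume s: "s \<in> S"
    have "\<phi> s s' = 0" if "s' \<in> S" "s' \<noteq> s" for s'
    proof (rule ccontr)
      assume "\<phi> s s' \<noteq> 0"
      then have "\<eta> s' s' = 0" using \<eta>0[OF s that(1)] that SX by auto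
      moreover have "\<eta> s' s' = 1" using \<eta>1[OF that(1)] \<phi>s[OF that(1)] that SX by auto
      ultimately show False by simp
    qed
    then have "(\<Sum>x\<in>S. t x * \<phi> s x) = (\<Sum>x\<in>S. if x = s then t s else 0)"
      using \<phi>s[OF s] by (intro sum.cong) auto
    then have "snd z (\<phi> s) = t s" using \<phi>[OF s] s S(1) by (simp add: zS(2) comb_def)
    then show "snd z (\<phi> s) \<in> {t s / 2<..}" using tpos[OF s] by simp
  qed
  \<comment> \<open>Each of the \<open>k\<close> points \<open>s\<close> claims an atom at which
    \<open>\<phi> s\<close> is nonzero, the functions \<open>\<eta>\<close> show that these atoms
    are distinct, and at most \<open>k\<close> atoms exist; so the list is complete.\<close>
  have "\<exists>\<sigma> \<tau>. (\<forall>s\<in>S. \<sigma> s \<in> topspace X \<and> f (\<sigma> s) = fst w \<and> \<phi> s (\<sigma> s) \<noteq> 0 \<and> 0 < \<tau> s) \<and>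
      (\<Sum>s\<in>S. \<tau> s) = 1 \<and> snd w = comb X S \<tau> \<sigma>" if w: "w \<in> N" for w
  proof -
    have wZ: "w \<in> ?Z" and w\<phi>: "\<And>s. s \<in> S \<Longrightarrow> t s / 2 \<le> snd w (\<phi> s)" using w by (auto simp: N_def)
    obtain S' t' where w1: "fst w \<in> topspace Y" "snd w = comb X S' t' id" and S': "finite S'" "card S' \<le> k"
      "S' \<subseteq> {x \<in> topspace X. f x = fst w}" and t': "\<forall>x\<in>S'. 0 \<le> t' x" "(\<Sum>x\<in>S'. t' x) = 1"
      using fibre_simplicesD[OF wZ] by (elim exE conjE)
    have "\<exists>x\<in>S'. \<phi> s x \<noteq> 0 \<and> 0 < t' x" if s: "s \<in> S" for s
    proof (rule ccontr)
      assume "\<not> ?thesis"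
      then have "t' x * \<phi> s x = 0" if "x \<in> S'" for x using t'(1) that by force
      then have "(\<Sum>x\<in>S'. t' x * \<phi> s (id x)) = 0" by (intro sum.neutral) auto
      then have "snd w (\<phi> s) = 0" unfolding w1(2) comb_def restrict_apply'[OF \<phi>[OF s]] .
      then show False using w\<phi>[OF s] tpos[OF s] by simp
    qed
    then obtain \<sigma> where \<sigma>: "\<And>s. s \<in> S \<Longrightarrow> \<sigma> s \<in> S' \<and> \<phi> s (\<sigma> s) \<noteq> 0 \<and> 0 < t' (\<sigma> s)" by metis
    have "inj_on \<sigma> S"
    proof (rule inj_onI, rule ccontr)
      fix s s' assume ss: "s \<in> S" "s' \<in> S" "\<sigma> s = \<sigma> s'" "s \<noteq> s'"
      have "\<sigma> s' \<in> topspace X" using \<sigma>[OF ss(2)] S'(3) by blast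
      then have "\<eta> s' (\<sigma> s') = 0" "\<eta> s' (\<sigma> s') = 1"
        using \<eta>0[OF ss(1,2,4), of "\<sigma> s'"] \<sigma>[OF ss(1)] \<sigma>[OF ss(2)] ss(3) \<eta>1[OF ss(2), of "\<sigma> s'"] by auto
      then show False by simp
    qed
    moreover have "\<sigma> ` S = S'"
    proof (rule card_seteq[OF S'(1)])
      show "\<sigma> ` S \<subseteq> S'" using \<sigma> by blast
      show "card S' \<le> card (\<sigma> ` S)" using S'(2) cS card_image[OF \<open>inj_on \<sigma> S\<close>] by simp
    qed
    ultimately have bij: "bij_betw \<sigma> S S'" by (simp add: bij_betw_def)
    have "snd w = comb X S (\<lambda>s. t' (\<sigma> s)) \<sigma>"
      unfolding w1(2) comb_def id_def
      by (intro restrict_ext sum.reindex_bij_betw[OF bij, symmetric])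
    moreover have "(\<Sum>s\<in>S. t' (\<sigma> s)) = 1" using t'(2) sum.reindex_bij_betw[OF bij, of t'] by simp
    moreover have "\<sigma> s \<in> topspace X \<and> f (\<sigma> s) = fst w \<and> \<phi> s (\<sigma> s) \<noteq> 0 \<and> 0 < t' (\<sigma> s)" if "s \<in> S" for s
      using \<sigma>[OF that] S'(3) by auto
    ultimately show ?thesis by (intro exI[of _ \<sigma>] exI[of _ "\<lambda>s. t' (\<sigma> s)"]) simp
  qed
  then have "\<forall>w\<in>N. \<exists>\<sigma> \<tau>. (\<forall>s\<in>S. \<sigma> s \<in> topspace X \<and> f (\<sigma> s) = fst w \<and> \<phi> s (\<sigma> s) \<noteq> 0 \<and> 0 < \<tau> s) \<and>
      (\<Sum>s\<in>S. \<tau> s) = 1 \<and> snd w = comb X S \<tau> \<sigma>" ..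
  then obtain \<sigma> \<tau> where st: "\<forall>w\<in>N. (\<forall>s\<in>S. \<sigma> w s \<in> topspace X \<and> f (\<sigma> w s) = fst w \<and> \<phi> s (\<sigma> w s) \<noteq> 0 \<and> 0 < \<tau> w s) \<and>
      (\<Sum>s\<in>S. \<tau> w s) = 1 \<and> snd w = comb X S (\<tau> w) (\<sigma> w)"
    unfolding bchoice_iff by (elim exE)
  have \<sigma>: "\<sigma> w s \<in> topspace X" "f (\<sigma> w s) = fst w" "\<phi> s (\<sigma> w s) \<noteq> 0" "0 < \<tau> w s" if "w \<in> N" "s \<in> S" for w s
    using bspec[OF st that(1)] that(2) by simp_all
  have \<tau>1: "(\<Sum>s\<in>S. \<tau> w s) = 1" and wc: "snd w = comb X S (\<tau> w) (\<sigma> w)" if "w \<in> N" for w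
    using bspec[OF st that] by simp_all
  have \<eta>\<delta>: "\<eta> s (\<sigma> w s') = (if s' = s then 1 else 0)" if "w \<in> N" "s \<in> S" "s' \<in> S" for w s s'
    using \<eta>1[OF that(2) \<sigma>(1)[OF that(1,2)] \<sigma>(3)[OF that(1,2)]]
      \<eta>0[OF that(3,2) _ \<sigma>(1)[OF that(1,3)] \<sigma>(3)[OF that(1,3)]] by auto
  \<comment> \<open>Multiplication by \<open>\<eta> s\<close> erases every atom except the one near
    \<open>s\<close>, so this evaluation gives the weight of that atom times the value of
    \<open>\<psi>\<close> there.\<close>
  have read: "snd w (\<lambda>x. \<psi> x * \<eta> s x) = \<tau> w s * \<psi> (\<sigma> w s)" if "w \<in> N" "s \<in> S" "\<psi> \<in> funs X" for w s \<psi>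
  proof -
    have "snd w (\<lambda>x. \<psi> x * \<eta> s x) = (\<Sum>s'\<in>S. \<tau> w s' * (\<psi> (\<sigma> w s') * \<eta> s (\<sigma> w s')))"
      using funs_mult[OF that(3) \<eta>[OF that(2)]] by (simp add: wc[OF that(1)] comb_def)
    also have "\<dots> = (\<Sum>s'\<in>S. if s' = s then \<tau> w s * \<psi> (\<sigma> w s) else 0)"
      using \<eta>\<delta>[OF that(1,2)] by (intro sum.cong) auto
    finally show ?thesis using S(1) that(2) by simp
  qed
  have read\<eta>: "snd w (\<eta> s) = \<tau> w s" if "w \<in> N" "s \<in> S" for w s
  proof -
    have "snd w (\<eta> s) = (\<Sum>s'\<in>S. \<tau> w s' * \<eta> s (\<sigma> w s'))"
      using \<eta>[OF that(2)] by (simp add: wc[OF that(1)] comb_def)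
    also have "\<dots> = (\<Sum>s'\<in>S. if s' = s then \<tau> w s else 0)"
      using \<eta>\<delta>[OF that(1,2)] by (intro sum.cong) auto
    finally show ?thesis using S(1) that(2) by simp
  qed
  obtain e where e: "bij_betw e {..<k} S"
    using ex_bij_betw_nat_finite[OF S(1)] cS by (auto simp: atLeast0LessThan)
  have eS: "e i \<in> S" if "i < k" for i using e that by (auto simp: bij_betw_def)
  \<comment> \<open>The last atom contributes its position; its weight follows from the other
    \<open>k - 1\<close>.\<close>
  define b where "b = e (k - 1)"
  have bS: "b \<in> S" using eS k0 by (simp add: b_def)
  let ?N = "subtopology ?P N" and ?Q = "prod_topology X (cube n)"
  have NP: "N \<subseteq> topspace ?P" using clN closedin_subset by blast
  have tN: "topspace ?N = N" using NP by auto
  \<comment> \<open>The cube has \<open>n\<close> coordinates, of which only the first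
    \<open>k - 1\<close> are used; the rest are padded with 0.\<close>
  define c where "c w = (\<lambda>i\<in>{..<n}. if i < k - 1 then snd w (\<eta> (e i)) else 0)" for w :: "'b \<times> (('a \<Rightarrow> real) \<Rightarrow> real)"
  define g where "g w = (\<sigma> w b, c w)" for w
  \<comment> \<open>\<open>\<sigma>\<close> was merely chosen. It is continuous at index
    \<open>b\<close> because each \<open>\<psi> (\<sigma> w b)\<close> is a quotient of two
    evaluations of the measure, and these values determine the point through the embedding into the
    cube.\<close>
  have cont\<sigma>: "continuous_map ?N X (\<lambda>w. \<sigma> w b)"
  proof -
    let ?e = "point_eval X"
    have id: "continuous_map (subtopology (fcube X) (?e ` topspace X)) X (inv_into (topspace X) ?e)"
      by (rule continuous_map_on_compact_image[OF X(1) Hausdorff_fcube continuous_map_point_eval])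
         (rule continuous_map_eq[OF continuous_map_id], simp add: inj_point_eval[OF X])
    have "continuous_map ?N (fcube X) (\<lambda>w. ?e (\<sigma> w b))"
    proof (rule continuous_map_into_fcube)
      fix \<psi> assume \<psi>: "\<psi> \<in> funs X"
      have "continuous_map ?N euclideanreal (\<lambda>w. snd w (\<lambda>x. \<psi> x * \<eta> b x) / snd w (\<eta> b))"
      proof (rule continuous_map_real_divide)
        show "continuous_map ?N euclideanreal (\<lambda>w. snd w (\<lambda>x. \<psi> x * \<eta> b x))"
          by (intro continuous_map_from_subtopology ev funs_mult \<psi> \<eta> bS)
        show "continuous_map ?N euclideanreal (\<lambda>w. snd w (\<eta> b))"
          by (intro continuous_map_from_subtopology ev \<eta> bS)
        show "snd w (\<eta> b) \<noteq> 0" if "w \<in> topspace ?N" for w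
        proof -
          have "w \<in> N" using that unfolding tN .
          then show ?thesis using \<sigma>(4)[of w b] read\<eta>[of w b] bS by simp
        qed
      qed
      then show "continuous_map ?N euclideanreal (\<lambda>w. ?e (\<sigma> w b) \<psi>)"
      proof (rule continuous_map_eq)
        fix w assume "w \<in> topspace ?N"
        then have w: "w \<in> N" unfolding tN .
        show "snd w (\<lambda>x. \<psi> x * \<eta> b x) / snd w (\<eta> b) = ?e (\<sigma> w b) \<psi>"
          using read[OF w bS \<psi>] read\<eta>[OF w bS] \<sigma>(4)[OF w bS] \<psi> by (simp add: point_eval_def)
      qed
    next
      fix w assume "w \<in> topspace ?N"
      then have "w \<in> N" unfolding tN .
      then show "?e (\<sigma> w b) \<in> topspace (fcube X)" using \<sigma>(1)[of w b] bS by (intro point_eval_in_fcube)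
    qed
    moreover have "?e (\<sigma> w b) \<in> ?e ` topspace X" if "w \<in> topspace ?N" for w
      using that \<sigma>(1)[OF _ bS] unfolding tN by blast
    ultimately have "continuous_map ?N (subtopology (fcube X) (?e ` topspace X)) (\<lambda>w. ?e (\<sigma> w b))"
      unfolding continuous_map_in_subtopology by blast
    from continuous_map_compose[OF this id] show ?thesis
    proof (rule continuous_map_eq)
      fix w assume "w \<in> topspace ?N"
      then have "w \<in> N" unfolding tN .
      then show "(inv_into (topspace X) ?e \<circ> (\<lambda>w. ?e (\<sigma> w b))) w = \<sigma> w b"
        using \<sigma>(1)[of w b] bS inj_point_eval[OF X] by simp
    qed
  qed
  have g: "continuous_map ?N ?Q g"
    unfolding g_def
  proof (rule continuous_map_pairedI[OF cont\<sigma>])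
    have "continuous_map ?N \<I> (\<lambda>w. c w i)" if i: "i \<in> {..<n}" for i
    proof (cases "i < k - 1")
      case True
      then have es: "e i \<in> S" using eS by simp
      have "continuous_map ?N \<I> (\<lambda>w. snd w (\<eta> (e i)))"
        unfolding continuous_map_in_subtopology
      proof (intro conjI funcsetI)
        show "continuous_map ?N euclideanreal (\<lambda>w. snd w (\<eta> (e i)))"
          by (intro continuous_map_from_subtopology ev \<eta> es)
        show "snd w (\<eta> (e i)) \<in> {0..1}" if "w \<in> topspace ?N" for w
        proof -
          have "w \<in> topspace ?P" using that NP unfolding tN by blast
          then have "snd w \<in> (\<Pi>\<^sub>E \<psi>\<in>funs X. {0..1})"
            by (simp only: topspace_prod_topology topspace_fcube mem_Times_iff)
          then show ?thesis using \<eta>[OF es] by (rule PiE_mem)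
        qed
      qed
      then show ?thesis using i True by (simp add: c_def)
    next
      case False
      then show ?thesis using i by (simp add: c_def)
    qed
    then show "continuous_map ?N (cube n) c"
      unfolding cube_def continuous_map_componentwise by (auto simp: c_def)
  qed
  have fin: "finite {w \<in> topspace ?N. g w = q}" for q
  proof -
    \<comment> \<open>A value \<open>q\<close> of \<open>g\<close> determines the point of
      \<open>Y\<close> and all weights, the last one as the remainder to 1. Only the positions of
      the other atoms are open, and they lie in one finite fibre.\<close>
    define \<tau>q where "\<tau>q s = (if s = b then 1 - (\<Sum>i<k - 1. snd q i) else snd q (inv_into {..<k} e s))" for s
    let ?F = "{x \<in> topspace X. f x = f (fst q)}"
    have "{w \<in> topspace ?N. g w = q} \<subseteq> (\<lambda>\<rho>. (f (fst q), comb X S \<tau>q \<rho>)) ` (S \<rightarrow>\<^sub>E ?F)"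
    proof
      fix w assume "w \<in> {w \<in> topspace ?N. g w = q}"
      then have w: "w \<in> N" and gw: "g w = q" using tN by auto
      have q1: "fst q = \<sigma> w b" and q2: "snd q = c w" using gw by (auto simp: g_def)
      have fw: "f (fst q) = fst w" using \<sigma>(2)[OF w bS] q1 by simp
      have ci: "snd q i = \<tau> w (e i)" if "i < k - 1" for i
      proof -
        have "i < n" "e i \<in> S" using that k eS[of i] by simp_all
        then show ?thesis using that read\<eta>[OF w, of "e i"] by (simp add: q2 c_def)
      qed
      have \<tau>b: "\<tau> w b = 1 - (\<Sum>i<k - 1. snd q i)"
      proof -
        have "(\<Sum>s\<in>S. \<tau> w s) = (\<Sum>i<k. \<tau> w (e i))" by (rule sum.reindex_bij_betw[OF e, symmetric])
        also have "\<dots> = (\<Sum>i<Suc (k - 1). \<tau> w (e i))" using k0 by simp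
        also have "\<dots> = (\<Sum>i<k - 1. \<tau> w (e i)) + \<tau> w b" by (simp add: b_def)
        finally show ?thesis using \<tau>1[OF w] ci by simp
      qed
      have "\<tau> w s = \<tau>q s" if s: "s \<in> S" for s
      proof (cases "s = b")
        case False
        let ?i = "inv_into {..<k} e s"
        have i: "?i < k" "e ?i = s" using s e          by (auto simp: bij_betw_def f_inv_into_f dest: inv_into_into)
        then have "?i \<noteq> k - 1" using False by (auto simp: b_def)
        then have "?i < k - 1" using i(1) by simp
        then show ?thesis using ci i False by (simp add: \<tau>q_def)
      qed (simp add: \<tau>q_def \<tau>b)
      then have "snd w = comb X S \<tau>q (restrict (\<sigma> w) S)"
        unfolding wc[OF w] by (intro comb_cong) auto
      moreover have "restrict (\<sigma> w) S \<in> S \<rightarrow>\<^sub>E ?F" using \<sigma>(1,2)[OF w] fw by auto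
      ultimately show "w \<in> (\<lambda>\<rho>. (f (fst q), comb X S \<tau>q \<rho>)) ` (S \<rightarrow>\<^sub>E ?F)"
        using fw by (intro image_eqI[of _ _ "restrict (\<sigma> w) S"] prod_eqI) auto
    qed
    moreover have "finite ?F"
    proof (cases "f (fst q) \<in> topspace Y")
      case False
      moreover have "f x \<in> topspace Y" if "x \<in> topspace X" for x
        using f that by (simp add: continuous_map_def Pi_iff)
      ultimately have "?F = {}" by force
      then show ?thesis by (simp only: finite.emptyI)
    qed (rule fib)
    ultimately show ?thesis using S(1) by (meson finite_PiE finite_imageI finite_subset)
  qed
  have "edim_le ?N L"
  proof (rule edim_le_finite_fibres[OF _ _ _ _ L g fin XL])
    show "compact_space ?N" "Hausdorff_space ?N"
      using cP clN by (simp_all add: closedin_compact_space compact_space_subtopology Hausdorff_space_subtopology)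
    show "compact_space ?Q" "Hausdorff_space ?Q"
      using X unfolding cube_def
      by (simp_all add: compact_space_prod_topology Hausdorff_space_prod_topology compact_space_product_topology
          Hausdorff_space_product_topology compact_space_subtopology Hausdorff_space_subtopology)
  qed
  then show thesis using that clN opO zO ON by blast
qed


text \<open>The sum theorem is applied with the previous stratum as \<open>B\<close>. A closed set
  off it is compact, so finitely many of the local pieces cover it.\<close>

lemma edim_le_fibre_simplices:
  fixes X :: "'a topology" and Y :: "'b topology" and L :: "'c topology"
  assumes X: "compact_space X" "Hausdorff_space X" and Y: "compact_space Y" "Hausdorff_space Y"
    and L: "CW_complex L" and f: "continuous_map X Y f"
    and fib: "\<And>y. y \<in> topspace Y \<Longrightarrow> finite {x \<in> topspace X. f x = y}"
    and XL: "edim_le (prod_topology X (cube n)) L" and "k \<le> n + 1"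
  shows "edim_le (subtopology (prod_topology Y (fcube X)) (fibre_simplices X Y f k)) L"
  using assms(9)
proof (induction k)
  let ?P = "prod_topology Y (fcube X)"
  note cP = compact_Hausdorff_prod_fcube[OF Y, of X]
  {
    case 0
    show ?case
      using edim_le_finite_union[OF cP L finite.emptyI, of "\<lambda>_. {}"] by (simp add: fibre_simplices_0)
  next
    case (Suc k)
    let ?Z = "fibre_simplices X Y f (Suc k)" and ?B = "fibre_simplices X Y f k"
    have cl: "closedin ?P ?Z" "closedin ?P ?B" by (rule closedin_fibre_simplices[OF X(1) Y(2) f])+
    have BZ: "?B \<subseteq> ?Z" by (rule fibre_simplices_mono) simp
    have sub: "subtopology (subtopology ?P ?Z) C = subtopology ?P C" if "C \<subseteq> ?Z" for C
      using that by (simp add: subtopology_subtopology Int_absorb1)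
    have cZ: "compact_space (subtopology ?P ?Z)" "Hausdorff_space (subtopology ?P ?Z)"
      using cP cl by (simp_all add: closedin_compact_space compact_space_subtopology Hausdorff_space_subtopology)
    show ?case
    proof (rule edim_le_sum[OF cZ])
      show "nbhd_ext (prod_topology \<I> (subtopology ?P ?Z)) L" by (rule CW_complex_nbhd_ext_cylinder[OF cZ L])
      show "closedin (subtopology ?P ?Z) ?B" using cl BZ by (simp add: closedin_closed_subtopology)
      show "edim_le (subtopology (subtopology ?P ?Z) ?B) L" unfolding sub[OF BZ] using Suc by simp
      fix C assume "closedin (subtopology ?P ?Z) C" and CB: "C \<inter> ?B = {}"
      then have C: "closedin ?P C" "C \<subseteq> ?Z" using closedin_closed_subtopology[OF cl(1)] by auto
      have "\<exists>N O1. closedin ?P N \<and> openin ?P O1 \<and> z \<in> O1 \<and> O1 \<inter> ?Z \<subseteq> N \<and> edim_le (subtopology ?P N) L"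
        if z: "z \<in> C" for z
      proof -
        have z': "z \<in> ?Z" "z \<notin> fibre_simplices X Y f (Suc k - 1)" using z C(2) CB by auto
        show ?thesis
          by (rule edim_le_simplices_piece[OF X Y L f fib XL Suc.prems z']) blast+
      qed
      then have "\<forall>z\<in>C. \<exists>N O1. closedin ?P N \<and> openin ?P O1 \<and> z \<in> O1 \<and> O1 \<inter> ?Z \<subseteq> N \<and> edim_le (subtopology ?P N) L" ..
      then obtain N O1 where NO: "\<forall>z\<in>C. closedin ?P (N z) \<and> openin ?P (O1 z) \<and> z \<in> O1 z \<and> O1 z \<inter> ?Z \<subseteq> N z \<and>
          edim_le (subtopology ?P (N z)) L"
        unfolding bchoice_iff by (elim exE)
      have "compactin ?P C" using cP(1) C(1) by (simp add: closedin_compact_space)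
      then have "\<exists>\<F>. finite \<F> \<and> \<F> \<subseteq> O1 ` C \<and> C \<subseteq> \<Union>\<F>"
        by (rule compactinD) (use NO in auto)
      then obtain D where D: "finite D" "D \<subseteq> C" "C \<subseteq> (\<Union>z\<in>D. O1 z)"
        by (metis finite_subset_image)
      have "C = (\<Union>z\<in>D. C \<inter> N z)"
      proof
        show "C \<subseteq> (\<Union>z\<in>D. C \<inter> N z)"
        proof
          fix w assume w: "w \<in> C"
          then obtain z where z: "z \<in> D" "w \<in> O1 z" using D(3) by blast
          then have "O1 z \<inter> ?Z \<subseteq> N z" using NO D(2) by blast
          then show "w \<in> (\<Union>z\<in>D. C \<inter> N z)" using w z C(2) by blast
        qed
      qed blast
      moreover have "edim_le (subtopology ?P (\<Union>z\<in>D. C \<inter> N z)) L"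
      proof (rule edim_le_finite_union[OF cP L D(1)])
        fix z assume "z \<in> D"
        then have z: "closedin ?P (N z)" "edim_le (subtopology ?P (N z)) L" using NO D(2) by auto
        then show clz: "closedin ?P (C \<inter> N z)" using C(1) by blast
        have "closedin (subtopology ?P (N z)) (C \<inter> N z)"
          using clz z(1) by (simp add: closedin_closed_subtopology)
        from edim_le_closed[OF z(2) this] show "edim_le (subtopology ?P (C \<inter> N z)) L"
          by (simp add: subtopology_subtopology Int_absorb1)
      qed
      ultimately show "edim_le (subtopology (subtopology ?P ?Z) C) L" unfolding sub[OF C(2)] by simp
    qed
  }
qed

section \<open>Approximate selections\<close>

text \<open>The simplex over \<open>k\<close> is compact and lies in \<open>W\<close>. The points
  \<open>p t\<close> may come from different fibres over \<open>V\<close>, but each is close to a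
  point of the fibre over \<open>k\<close>; replacing them changes the average only a little, and
  the new average has at most \<open>m\<close> atoms because its points share a fibre.\<close>

lemma simplex_cover:
  fixes X :: "'a topology" and Y :: "'b topology"
  assumes X: "compact_space X" and Y: "compact_space Y" "Hausdorff_space Y"
    and f: "continuous_map X Y f" and surj: "f ` topspace X = topspace Y"
    and W: "openin (prod_topology Y (fcube X)) W" "fibre_simplices X Y f m \<subseteq> W"
    and card: "\<And>y. y \<in> topspace Y \<Longrightarrow> finite {x \<in> topspace X. f x = y} \<and> card {x \<in> topspace X. f x = y} \<le> m"
    and k: "k \<in> topspace Y"
  shows "\<exists>V. openin Y V \<and> k \<in> V \<and>
    (\<forall>y\<in>V. \<forall>(T :: 'b set) l p. finite T \<longrightarrow> (\<forall>t\<in>T. 0 \<le> l t) \<longrightarrow> (\<Sum>t\<in>T. l t) = 1 \<longrightarrow>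
      (\<forall>t\<in>T. l t \<noteq> 0 \<longrightarrow> p t \<in> topspace X \<and> f (p t) \<in> V) \<longrightarrow> (y, comb X T l p) \<in> W)"
proof -
  let ?P = "prod_topology Y (fcube X)" and ?Z = "fibre_simplices X Y f m" and ?F = "{x \<in> topspace X. f x = k}"
  note cP = compact_Hausdorff_prod_fcube[OF Y, of X]
  have clk: "closedin Y {k}" using Y(2) k Hausdorff_imp_t1_space t1_space_closedin_singleton by metis
  define C where "C = snd ` (?Z \<inter> {z \<in> topspace ?P. fst z \<in> {k}})"
  have "closedin ?P (?Z \<inter> {z \<in> topspace ?P. fst z \<in> {k}})"
    by (intro closedin_Int closedin_fibre_simplices[OF X Y(2) f] closedin_continuous_map_preimage[OF continuous_map_fst clk])
  then have "compactin ?P (?Z \<inter> {z \<in> topspace ?P. fst z \<in> {k}})" using cP(1) by (simp add: closedin_compact_space)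
  then have cC: "compactin (fcube X) C" unfolding C_def using continuous_map_snd image_compactin by blast
  have "{k} \<times> C \<subseteq> W" using W(2) by (force simp: C_def)
  then obtain V0 Q where V0: "openin Y V0" "openin (fcube X) Q" "{k} \<subseteq> V0" "C \<subseteq> Q" "V0 \<times> Q \<subseteq> W"
    using Wallace_theorem_prod_topology[OF _ cC W(1), of "{k}"] k by auto
  obtain F \<epsilon> where F: "finite F" "F \<subseteq> funs X" and \<epsilon>: "\<epsilon> > (0::real)"
    and box: "\<And>c u. c \<in> C \<Longrightarrow> u \<in> topspace (fcube X) \<Longrightarrow> (\<And>\<phi>. \<phi> \<in> F \<Longrightarrow> \<bar>u \<phi> - c \<phi>\<bar> < \<epsilon>) \<Longrightarrow> u \<in> Q"
    using fcube_box[OF cC V0(2,4)] by metis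
  define N where "N = funs_box X F \<epsilon>"
  have N: "openin X (N s)" for s unfolding N_def using F by (rule openin_funs_box)
  have oN: "openin X (\<Union>x'\<in>?F. N x')" using N by blast
  have FN: "?F \<subseteq> (\<Union>x'\<in>?F. N x')"
  proof
    fix x assume x: "x \<in> ?F"
    then have "x \<in> N x" using \<epsilon> by (auto simp: N_def funs_box_def)
    then show "x \<in> (\<Union>x'\<in>?F. N x')" using x by blast
  qed
  obtain V1 where V1: "openin Y V1" "k \<in> V1" "\<And>x. x \<in> topspace X \<Longrightarrow> f x \<in> V1 \<Longrightarrow> x \<in> (\<Union>x'\<in>?F. N x')"
    using fibre_nbhd[OF X Y(2) f oN FN k] by blast
  have main: "(y, comb X T l p) \<in> W"
    if y: "y \<in> V0 \<inter> V1" and T: "finite T" and l: "\<forall>t\<in>T. 0 \<le> l t" "(\<Sum>t\<in>T. l t) = 1"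
      and p: "\<forall>t\<in>T. l t \<noteq> 0 \<longrightarrow> p t \<in> topspace X \<and> f (p t) \<in> V0 \<inter> V1" for y l p and T :: "'b set"
  proof -
    \<comment> \<open>Surjectivity supplies \<open>x0\<close>, the default replacement for indices
      of weight 0, whose points \<open>p t\<close> are arbitrary.\<close>
    have "k \<in> f ` topspace X" using k by (simp add: surj)
    then obtain x0 where x0: "x0 \<in> ?F" by blast
    have "\<exists>x'\<in>?F. l t \<noteq> 0 \<longrightarrow> p t \<in> N x'" if t: "t \<in> T" for t
    proof (cases "l t = 0")
      case False
      then have "p t \<in> topspace X" "f (p t) \<in> V1" using p t by auto
      from V1(3)[OF this] show ?thesis by blast
    qed (use x0 in blast)
    then have "\<forall>t\<in>T. \<exists>x'. x' \<in> ?F \<and> (l t \<noteq> 0 \<longrightarrow> p t \<in> N x')" by blast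
    from bchoice[OF this] obtain p' where p': "\<forall>t\<in>T. p' t \<in> ?F \<and> (l t \<noteq> 0 \<longrightarrow> p t \<in> N (p' t))" ..
    have "card (p' ` T) \<le> card ?F" using card[OF k] p' by (intro card_mono) auto
    then have ct: "card (p' ` T) \<le> m" using card[OF k] by linarith
    have kZ: "(k, comb X T l p') \<in> ?Z"
      by (rule fibre_simplicesI[OF k T ct]) (use l p' in auto)
    moreover have "?Z \<subseteq> topspace ?P" using closedin_fibre_simplices[OF X Y(2) f] closedin_subset by blast
    ultimately have "comb X T l p' \<in> C" unfolding C_def by force
    moreover have "comb X T l p \<in> topspace (fcube X)" using l p by (intro comb_in_fcube) auto
    moreover have "\<bar>comb X T l p \<phi> - comb X T l p' \<phi>\<bar> < \<epsilon>" if \<phi>: "\<phi> \<in> F" for \<phi>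
    proof -
      have "\<bar>(\<Sum>t\<in>T. l t * \<phi> (p t)) - (\<Sum>t\<in>T. l t * \<phi> (p' t))\<bar> < \<epsilon>"
      proof (rule convex_sum_close[OF T _ l(2)])
        show "0 \<le> l t" if "t \<in> T" for t using l(1) that by blast
        show "\<bar>\<phi> (p t) - \<phi> (p' t)\<bar> < \<epsilon>" if "t \<in> T" "l t \<noteq> 0" for t
        proof -
          have "p t \<in> N (p' t)" using p' that by blast
          then show ?thesis using \<phi> by (auto simp: N_def funs_box_def)
        qed
      qed
      then show ?thesis using \<phi> F(2) by (simp add: comb_def subset_iff)
    qed
    ultimately have "comb X T l p \<in> Q" by (rule box)
    then show ?thesis using V0(5) y by blast
  qed
  show ?thesis
  proof (intro exI[of _ "V0 \<inter> V1"] conjI ballI allI impI)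
    show "openin Y (V0 \<inter> V1)" using V0(1) V1(1) by blast
    show "k \<in> V0 \<inter> V1" using V0(3) V1(2) by auto
  qed (rule main; assumption)
qed

theorem edim_le_finite_to_one_image:
  fixes X :: "'a topology" and Y :: "'b topology" and L :: "'c topology"
  assumes X: "compact_space X" "Hausdorff_space X" and Y: "compact_space Y" "Hausdorff_space Y"
    and L: "CW_complex L" and f: "continuous_map X Y f" and surj: "f ` topspace X = topspace Y"
    and card: "\<And>y. y \<in> topspace Y \<Longrightarrow> finite {x \<in> topspace X. f x = y} \<and> card {x \<in> topspace X. f x = y} \<le> n + 1"
    and XL: "edim_le (prod_topology X (cube n)) L"
  shows "edim_le Y L"
  unfolding edim_le_def
proof (intro allI impI)
  fix A h assume A: "closedin Y A" and h: "continuous_map (subtopology Y A) L h"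
  let ?P = "prod_topology Y (fcube X)" and ?Z = "fibre_simplices X Y f (n + 1)"
  note cP = compact_Hausdorff_prod_fcube[OF Y, of X]
  have clZ: "closedin ?P ?Z" by (rule closedin_fibre_simplices[OF X(1) Y(2) f])
  have ZL: "edim_le (subtopology ?P ?Z) L"
    by (rule edim_le_fibre_simplices[OF X Y L f _ XL]) (use card in auto)
  \<comment> \<open>The preimage of \<open>A\<close> in the whole product, not just in
    \<open>?Z\<close>: the approximate section may leave \<open>?Z\<close>, and over
    \<open>A\<close> the extended map must still be known up to homotopy.\<close>
  define N where "N = {z \<in> topspace ?P. fst z \<in> A}"
  have clN: "closedin ?P N" unfolding N_def by (rule closedin_continuous_map_preimage[OF continuous_map_fst A])
  have fN: "continuous_map (subtopology ?P N) (subtopology Y A) fst"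
    by (auto simp: continuous_map_in_subtopology N_def intro: continuous_map_from_subtopology continuous_map_fst)
  have hN: "continuous_map (subtopology ?P N) L (h \<circ> fst)"
    using fN h by (rule continuous_map_compose)
  have "closedin (subtopology ?P ?Z) (N \<inter> ?Z)"
    using clN clZ by (simp add: closedin_closed_subtopology closedin_Int)
  moreover have sub: "subtopology (subtopology ?P ?Z) (N \<inter> ?Z) = subtopology ?P (N \<inter> ?Z)"
    by (simp add: subtopology_subtopology Int_absorb1)
  moreover have "continuous_map (subtopology ?P (N \<inter> ?Z)) L (h \<circ> fst)"
    using hN by (rule continuous_map_from_subtopology_mono) blast
  ultimately obtain g where g: "continuous_map (subtopology ?P ?Z) L g"
    "homotopic (subtopology ?P (N \<inter> ?Z)) L g (h \<circ> fst)"
    using ZL[unfolded edim_le_def, rule_format, of "N \<inter> ?Z" "h \<circ> fst"] by auto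
  have ext: "nbhd_ext (prod_topology \<I> ?P) L" by (rule CW_complex_nbhd_ext_cylinder[OF cP L])
  obtain W H where W: "openin ?P W" "N \<union> ?Z \<subseteq> W" and H: "continuous_map (subtopology ?P W) L H"
    "homotopic (subtopology ?P N) L H (h \<circ> fst)"
    by (rule nbhd_ext_union[OF cP ext clN clZ hN g]) (rule that)
  have "\<forall>k\<in>topspace Y. \<exists>V. openin Y V \<and> k \<in> V \<and>
    (\<forall>y\<in>V. \<forall>(T :: 'b set) l p. finite T \<longrightarrow> (\<forall>t\<in>T. 0 \<le> l t) \<longrightarrow> (\<Sum>t\<in>T. l t) = 1 \<longrightarrow>
      (\<forall>t\<in>T. l t \<noteq> 0 \<longrightarrow> p t \<in> topspace X \<and> f (p t) \<in> V) \<longrightarrow> (y, comb X T l p) \<in> W)"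
    using W(2) by (intro ballI simplex_cover[OF X(1) Y f surj W(1) _ card]) auto
  from bchoice[OF this] obtain U where U: "\<forall>k\<in>topspace Y. openin Y (U k) \<and> k \<in> U k \<and>
    (\<forall>y\<in>U k. \<forall>(T :: 'b set) l p. finite T \<longrightarrow> (\<forall>t\<in>T. 0 \<le> l t) \<longrightarrow> (\<Sum>t\<in>T. l t) = 1 \<longrightarrow>
      (\<forall>t\<in>T. l t \<noteq> 0 \<longrightarrow> p t \<in> topspace X \<and> f (p t) \<in> U k) \<longrightarrow> (y, comb X T l p) \<in> W)" ..
  then have U1: "openin Y (U k)" "k \<in> U k" if "k \<in> topspace Y" for k using that by blast+
  \<comment> \<open>Several weights may be nonzero at one point \<open>y\<close>; the star property
    places all their centres in a single \<open>U k\<close>, as \<open>simplex_cover\<close>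
    demands.\<close>
  obtain V where V: "\<And>y. y \<in> topspace Y \<Longrightarrow> openin Y (V y)" "\<And>y. y \<in> topspace Y \<Longrightarrow> y \<in> V y"
    and star: "\<And>z. z \<in> topspace Y \<Longrightarrow> \<exists>k\<in>topspace Y. z \<in> U k \<and> (\<forall>y\<in>topspace Y. z \<in> V y \<longrightarrow> V y \<subseteq> U k)"
    using star_refinement[OF Y, of U] U1 by metis
  obtain T and l :: "'b \<Rightarrow> 'b \<Rightarrow> real" where T: "finite T" "T \<subseteq> topspace Y"
    and l: "\<And>t. t \<in> T \<Longrightarrow> continuous_map Y euclideanreal (l t)" "\<And>t y. y \<in> topspace Y \<Longrightarrow> 0 \<le> l t y"
    "\<And>y. y \<in> topspace Y \<Longrightarrow> (\<Sum>t\<in>T. l t y) = 1"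
    "\<And>t y. t \<in> T \<Longrightarrow> y \<in> topspace Y \<Longrightarrow> l t y \<noteq> 0 \<Longrightarrow> y \<in> V t"
    using partition_of_unity[OF Y V] by metis
  \<comment> \<open>One arbitrary preimage for each centre; the continuity of \<open>s\<close> comes
    from the weights \<open>l t\<close> alone.\<close>
  define p where "p = inv_into (topspace X) f"
  have p: "p t \<in> topspace X" "f (p t) = t" if "t \<in> T" for t
    using T(2) that inv_into_into[of t f "topspace X"] f_inv_into_f[of t f "topspace X"]
    by (auto simp: surj p_def)
  define s where "s y = comb X T (\<lambda>t. l t y) p" for y
  have s: "continuous_map Y (fcube X) s"
  proof (rule continuous_map_into_fcube)
    show "continuous_map Y euclideanreal (\<lambda>z. s z \<phi>)" if "\<phi> \<in> funs X" for \<phi>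
      using that T l(1) by (simp add: s_def comb_def) (intro continuous_map_sum continuous_map_real_mult_right)
    show "s y \<in> topspace (fcube X)" if "y \<in> topspace Y" for y
      unfolding s_def using l(2,3)[OF that] p(1) by (intro comb_in_fcube) auto
  qed
  have gr: "continuous_map Y ?P (\<lambda>y. (y, s y))" using s by (intro continuous_map_pairedI) auto
  have sW: "(y, s y) \<in> W" if y: "y \<in> topspace Y" for y
  proof -
    obtain k where k: "k \<in> topspace Y" "y \<in> U k" and star_k: "\<forall>t\<in>topspace Y. y \<in> V t \<longrightarrow> V t \<subseteq> U k"
      using star[OF y] by blast
    have "p t \<in> topspace X \<and> f (p t) \<in> U k" if t: "t \<in> T" "l t y \<noteq> 0" for t
    proof -
      have tY: "t \<in> topspace Y" using t(1) T(2) by blast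
      then have "V t \<subseteq> U k" using l(4)[OF t(1) y t(2)] star_k by blast
      then show ?thesis using p[OF t(1)] V(2)[OF tY] by auto
    qed
    then show ?thesis
      unfolding s_def
      using bspec[OF conjunct2[OF conjunct2[OF bspec[OF U k(1)]]] k(2), rule_format, of T "\<lambda>t. l t y" p]
        T(1) l(2,3)[OF y] by blast
  qed
  have grW: "continuous_map Y (subtopology ?P W) (\<lambda>y. (y, s y))"
    using gr sW by (auto simp: continuous_map_in_subtopology)
  have "continuous_map (subtopology Y A) (subtopology ?P N) (\<lambda>y. (y, s y))"
    using continuous_map_from_subtopology[OF gr, of A] s unfolding continuous_map_in_subtopology
    by (auto simp: N_def continuous_map_def Pi_iff)
  then have 1: "homotopic (subtopology Y A) L (H \<circ> (\<lambda>y. (y, s y))) ((h \<circ> fst) \<circ> (\<lambda>y. (y, s y)))"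
    by (rule homotopic_with_compose_continuous_map_right[OF H(2)]) simp
  have "(h \<circ> fst) \<circ> (\<lambda>y. (y, s y)) = h" by auto
  then show "\<exists>H. continuous_map Y L H \<and> homotopic (subtopology Y A) L H h"
    using 1 continuous_map_compose[OF grW H(1)] by auto
qed

theorem corollary4p2:
  fixes X :: "'a topology" and Y :: "'b topology" and f :: "'a \<Rightarrow> 'b" and n :: nat
  assumes "compact_space X" and "Hausdorff_space X"
    and "compact_space Y" and "Hausdorff_space Y"
    and "continuous_map X Y f" and "f ` topspace X = topspace Y"
    and "\<And>y. y \<in> topspace Y \<Longrightarrow>
           finite {x \<in> topspace X. f x = y} \<and> card {x \<in> topspace X. f x = y} \<le> n + 1"
  shows "edim_le_edim TYPE('c) Y (prod_topology X (cube n))"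
  unfolding edim_le_edim_def
  using edim_le_finite_to_one_image[OF assms(1-4) _ assms(5-7)] by blast

end
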